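(* Let $0<\alpha<2$, let $\Omega$ be the open unit disk in $\mathbb{R}^2$, and let $k\in\mathbb{R}$. For every $\widetilde g(x)=\omega^{\alpha/2}g(x)$ with $g\in L^2_{\alpha/2}(\Omega)$, $$k\,(-\Delta)^{\frac{\alpha}{2}}\widetilde g(x)=-\nabla\cdot(-\Delta)^{\frac{\alpha-2}{2}}\,k\,\mathbf{I}\,\nabla\widetilde g(x)\qquad\text{in }\Omega,$$ where $\mathbf{I}$ is the $2\times2$ identity matrix.
   Context: $\omega^{\gamma}=(1-r^2)^{\gamma}$ on $\Omega$, $r=|x|$, and $\widetilde g=\omega^{\alpha/2}g$ is extended by $0$ to $\mathbb{R}^2\setminus\Omega$. $L^2_{\alpha/2}(\Omega)$ is the weighted space with norm $\|g\|^2=\int_\Omega(1-r^2)^{\alpha/2}g^2\,dx$. With polar coordinates $(r,\varphi)$, $V_{l,1}=r^l\cos(l\varphi)$ ($l\ge0$), $V_{l,-1}=r^l\sin(l\varphi)$ ($l\ge1$) and $P_n^{(a,b)}$ the standard Jacobi polynomials, the functions $V_{l,\mu}(x)P_n^{(\alpha/2,\,l)}(2r^2-1)$, $l,n\ge0$, $\mu\in\{1,-1\}$, $(l,\mu)\neq(0,-1)$, form an orthogonal basis of $L^2_{\alpha/2}(\Omega)$. Integral fractional Laplacian on $\mathbb{R}^2$: $(-\Delta)^{\frac{\alpha}{2}}u(x)=\frac{1}{|\gamma_2(-\alpha)|}\lim_{\epsilon\to0}\int_{\mathbb{R}^2\setminus B(x,\epsilon)}\frac{u(x)-u(y)}{|x-y|^{2+\alpha}}\,dy$,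 where $\gamma_2(\beta)=2^{\beta}\pi\,\Gamma(\beta/2)/\Gamma((2-\beta)/2)$. Riesz potential of order $2-\alpha$ on $\mathbb{R}^2$: $(-\Delta)^{\frac{\alpha-2}{2}}v(x)=\frac{1}{\gamma_2(2-\alpha)}\int_{\mathbb{R}^2}\frac{v(x-y)}{|y|^{\alpha}}\,dy$, applied componentwise to vector fields (gradients in $\Omega$ extended by zero outside $\Omega$). Interpretation of the identity: for $g$ one of the basis functions it is a pointwise identity in $\Omega$; for general $g\in L^2_{\alpha/2}(\Omega)$, both operators act term by term on the expansion of $g$ in the basis, and equality means equality of the coefficients of the basis functions. *)

theory Defs
  imports "HOL-Analysis.Analysis"
begin

abbreviation unit_disk :: "(real^2) set" ("\<Omega>") where
  "\<Omega> \<equiv> ball 0 1"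

definition weight :: "real \<Rightarrow> real^2 \<Rightarrow> real" where
  "weight \<gamma> x = (1 - (norm x)\<^sup>2) powr \<gamma>"

definition weighted_ext :: "real \<Rightarrow> (real^2 \<Rightarrow> real) \<Rightarrow> real^2 \<Rightarrow> real" where
  "weighted_ext \<alpha> g x = (if x \<in> \<Omega> then weight (\<alpha>/2) x * g x else 0)"

text \<open>Members are functions rather than classes modulo null sets; their values outside
  \<^term>\<open>\<Omega>\<close> are irrelevant.\<close>

definition weighted_L2 :: "real \<Rightarrow> (real^2 \<Rightarrow> real) set" where
  "weighted_L2 \<alpha> = {g. set_borel_measurable lebesgue \<Omega> g \<and>
     set_integrable lebesgue \<Omega> (\<lambda>x. weight (\<alpha>/2) x * (g x)\<^sup>2)}"

definition weighted_inner :: "real \<Rightarrow> (real^2 \<Rightarrow> real) \<Rightarrow> (real^2 \<Rightarrow> real) \<Rightarrow> real" where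
  "weighted_inner \<alpha> f g = (LINT x:\<Omega>|lebesgue. weight (\<alpha>/2) x * (f x * g x))"

text \<open>The standard explicit sum, normalised by
  \<open>P\<^sub>n\<^sup>(\<^sup>a\<^sup>,\<^sup>b\<^sup>)(1) = (n + a) gchoose n\<close>.\<close>

definition jacobi :: "real \<Rightarrow> real \<Rightarrow> nat \<Rightarrow> real \<Rightarrow> real" where
  "jacobi a b n t = (\<Sum>s\<le>n. ((real n + a) gchoose s) * ((real n + b) gchoose (n - s))
     * ((t - 1) / 2) ^ (n - s) * ((t + 1) / 2) ^ s)"

definition polar_angle :: "real^2 \<Rightarrow> real" where
  "polar_angle x = Arg (Complex (x $ 1) (x $ 2))"

text \<open>The second index is \<open>\<mu> = 1\<close> (cosine) or \<open>\<mu> = -1\<close> (sine). At the origin the value of the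
  angle is immaterial: for \<open>l > 0\<close> the radial factor vanishes, for \<open>l = 0\<close> the angular factor
  is constant.\<close>

definition solid_harmonic :: "nat \<Rightarrow> int \<Rightarrow> real^2 \<Rightarrow> real" where
  "solid_harmonic l \<mu> x = norm x ^ l *
     (if \<mu> = 1 then cos (real l * polar_angle x) else sin (real l * polar_angle x))"

definition basis_index :: "(nat \<times> nat \<times> int) set" where
  "basis_index = {(l, n, \<mu>). \<mu> \<in> {1, -1} \<and> (l, \<mu>) \<noteq> (0, -1)}"

definition basis_fun :: "real \<Rightarrow> nat \<times> nat \<times> int \<Rightarrow> real^2 \<Rightarrow> real" where
  "basis_fun \<alpha> = (\<lambda>(l, n, \<mu>) x.
     solid_harmonic l \<mu> x * jacobi (\<alpha>/2) (real l) n (2 * (norm x)\<^sup>2 - 1))"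

definition basis_coeff :: "real \<Rightarrow> (real^2 \<Rightarrow> real) \<Rightarrow> nat \<times> nat \<times> int \<Rightarrow> real" where
  "basis_coeff \<alpha> g j =
     weighted_inner \<alpha> g (basis_fun \<alpha> j) / weighted_inner \<alpha> (basis_fun \<alpha> j) (basis_fun \<alpha> j)"

definition gamma2 :: "real \<Rightarrow> real" where
  "gamma2 \<beta> = 2 powr \<beta> * pi * Gamma (\<beta>/2) / Gamma ((2 - \<beta>)/2)"

definition frac_integrand :: "real \<Rightarrow> (real^2 \<Rightarrow> real) \<Rightarrow> real^2 \<Rightarrow> real^2 \<Rightarrow> real" where
  "frac_integrand \<alpha> u x y = (u x - u y) / norm (x - y) powr (2 + \<alpha>)"

definition frac_truncated :: "real \<Rightarrow> (real^2 \<Rightarrow> real) \<Rightarrow> real^2 \<Rightarrow> real \<Rightarrow> real" where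
  "frac_truncated \<alpha> u x \<epsilon> =
     1 / \<bar>gamma2 (-\<alpha>)\<bar> * (LINT y:(- ball x \<epsilon>)|lebesgue. frac_integrand \<alpha> u x y)"

definition frac_laplacian :: "real \<Rightarrow> (real^2 \<Rightarrow> real) \<Rightarrow> real^2 \<Rightarrow> real" where
  "frac_laplacian \<alpha> u x = Lim (at_right 0) (frac_truncated \<alpha> u x)"

text \<open>Limits, integrals and derivatives are total in HOL. The predicates whose names end in
  \<open>defined\<close> state that the limits, integrals and derivatives involved actually exist.\<close>

definition frac_laplacian_defined :: "real \<Rightarrow> (real^2 \<Rightarrow> real) \<Rightarrow> real^2 \<Rightarrow> bool" where
  "frac_laplacian_defined \<alpha> u x \<longleftrightarrow>
     (\<forall>\<epsilon>>0. set_integrable lebesgue (- ball x \<epsilon>) (frac_integrand \<alpha> u x)) \<and>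
     (\<exists>L. (frac_truncated \<alpha> u x \<longlongrightarrow> L) (at_right 0))"

text \<open>The Riesz potential \<open>(-\<Delta>)\<close> to the power \<open>(\<alpha> - 2)/2\<close>, of order \<open>2 - \<alpha>\<close>.\<close>

definition riesz_integrand :: "real \<Rightarrow> (real^2 \<Rightarrow> real) \<Rightarrow> real^2 \<Rightarrow> real^2 \<Rightarrow> real" where
  "riesz_integrand \<alpha> v x y = v (x - y) / norm y powr \<alpha>"

definition riesz_potential :: "real \<Rightarrow> (real^2 \<Rightarrow> real) \<Rightarrow> real^2 \<Rightarrow> real" where
  "riesz_potential \<alpha> v x = 1 / gamma2 (2 - \<alpha>) * (LINT y|lebesgue. riesz_integrand \<alpha> v x y)"

definition riesz_field :: "real \<Rightarrow> (real^2 \<Rightarrow> real^2) \<Rightarrow> real^2 \<Rightarrow> real^2" where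
  "riesz_field \<alpha> v x = (\<chi> i. riesz_potential \<alpha> (\<lambda>y. v y $ i) x)"

definition riesz_field_defined :: "real \<Rightarrow> (real^2 \<Rightarrow> real^2) \<Rightarrow> real^2 \<Rightarrow> bool" where
  "riesz_field_defined \<alpha> v x \<longleftrightarrow> (\<forall>i. integrable lebesgue (riesz_integrand \<alpha> (\<lambda>y. v y $ i) x))"

definition grad :: "(real^2 \<Rightarrow> real) \<Rightarrow> real^2 \<Rightarrow> real^2" where
  "grad u x = (\<chi> i. frechet_derivative u (at x) (axis i 1))"

definition divergence :: "(real^2 \<Rightarrow> real^2) \<Rightarrow> real^2 \<Rightarrow> real" where
  "divergence v x = (\<Sum>i\<in>UNIV. frechet_derivative v (at x) (axis i 1) $ i)"

text \<open>The field \<open>K \<nabla>u\<close>, with the gradient taken in \<^term>\<open>\<Omega>\<close> and extended by zero.\<close>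

definition flux :: "real^2^2 \<Rightarrow> (real^2 \<Rightarrow> real) \<Rightarrow> real^2 \<Rightarrow> real^2" where
  "flux K u x = (if x \<in> \<Omega> then K *v grad u x else 0)"

definition div_riesz_grad :: "real \<Rightarrow> real^2^2 \<Rightarrow> (real^2 \<Rightarrow> real) \<Rightarrow> real^2 \<Rightarrow> real" where
  "div_riesz_grad \<alpha> K u x = divergence (riesz_field \<alpha> (flux K u)) x"

definition div_riesz_grad_defined :: "real \<Rightarrow> real^2^2 \<Rightarrow> (real^2 \<Rightarrow> real) \<Rightarrow> real^2 \<Rightarrow> bool" where
  "div_riesz_grad_defined \<alpha> K u x \<longleftrightarrow>
     (\<forall>y\<in>\<Omega>. u differentiable (at y)) \<and>
     (\<forall>y\<in>\<Omega>. riesz_field_defined \<alpha> (flux K u) y) \<and>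
     riesz_field \<alpha> (flux K u) differentiable (at x)"

text \<open>For \<open>g\<close> with expansion \<open>\<Sum>\<^sub>j c\<^sub>j p\<^sub>j\<close> in the basis, an operator \<open>T\<close> acts term by term on the
  weighted extension of \<open>g\<close> as the formal series of the \<open>c\<^sub>j T(p\<^sub>j)\<close>, where \<open>T(p\<^sub>j)\<close> is \<open>T\<close> applied to
  the weighted extension of \<open>p\<^sub>j\<close>. Expanding every \<open>T(p\<^sub>j)\<close> in the basis again, the coefficient of
  \<open>p\<^sub>i\<close> is the sum over \<open>j\<close> of \<open>c\<^sub>j\<close> times the \<open>i\<close>-th coefficient of \<open>T(p\<^sub>j)\<close>. If \<open>T(p\<^sub>j) = \<lambda>\<^sub>j p\<^sub>j\<close>
  for all \<open>j\<close>, this is \<open>c\<^sub>i \<lambda>\<^sub>i\<close>, but diagonality is not built into the definition.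

  \<open>has_termwise_coeff \<alpha> T g i s\<close> says that this coefficient exists and equals \<open>s\<close>.\<close>

definition has_termwise_coeff ::
  "real \<Rightarrow> ((real^2 \<Rightarrow> real) \<Rightarrow> real^2 \<Rightarrow> real) \<Rightarrow> (real^2 \<Rightarrow> real) \<Rightarrow>
     nat \<times> nat \<times> int \<Rightarrow> real \<Rightarrow> bool" where
  "has_termwise_coeff \<alpha> T g i s \<longleftrightarrow>
     (\<forall>j\<in>basis_index. T (weighted_ext \<alpha> (basis_fun \<alpha> j)) \<in> weighted_L2 \<alpha>) \<and>
     ((\<lambda>j. basis_coeff \<alpha> g j * basis_coeff \<alpha> (T (weighted_ext \<alpha> (basis_fun \<alpha> j))) i)
        has_sum s) basis_index"

end

theory Submission
  imports Defs
begin

text \<open>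
  For a polynomial \<open>p\<close> let \<open>u\<close> be its weighted extension. Symmetrising the integral in \<open>y = x + z\<close> and
  \<open>y = x - z\<close>, the fractional Laplacian at \<open>x\<close> is a negative multiple of the absolutely convergent
  integral of \<open>(u(x + z) + u(x - z) - 2 u(x)) / |z|\<^sup>2\<^sup>+\<^sup>\<alpha>\<close>.

  For the other operator, replace \<open>|z|\<^sup>-\<^sup>\<alpha>\<close> by the smooth kernel \<open>K\<^sub>e(z) = (|z|\<^sup>2 + e\<^sup>2)\<close> to the power
  \<open>-\<alpha>/2\<close>. Differentiating under the integral and integrating by parts on lines (\<open>u\<close> vanishes on the
  boundary circle), the partial derivatives of the convolution of \<open>\<partial>\<^sub>iu\<close> with \<open>K\<^sub>e\<close> become half the integral of the
  second difference of \<open>u\<close> against \<open>\<partial>\<^sub>i\<partial>\<^sub>jK\<^sub>e\<close>, because the latter is even with integral zero. These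
  converge locally uniformly as \<open>e \<rightarrow> 0\<close>, so the Riesz field is differentiable, and the trace of the
  limiting Hessian is \<open>\<alpha>\<^sup>2 / |z|\<^sup>2\<^sup>+\<^sup>\<alpha>\<close>; the constants agree since \<open>\<gamma>\<^sub>2(2 - \<alpha>) = \<alpha>\<^sup>2 |\<gamma>\<^sub>2(-\<alpha>)|\<close>.

  The term-by-term coefficients exist without knowledge of the eigenvalues. The truncated operators
  are symmetric and bounded by a multiple of \<open>(1 - |x|)\<close> to the power \<open>-\<alpha>/2\<close>, uniformly in the truncation. Hence
  the fractional Laplacian of a weighted basis function lies in the weighted \<open>L\<^sup>2\<close> space and is
  symmetric, so the \<open>i\<close>-th coefficients sum up the products of the expansions of \<open>g\<close> and of the image of the
  \<open>i\<close>-th basis function, which converges absolutely by Bessel's inequality. Orthogonality of the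
  basis follows from rotations in the angular variable, and in the radial one from Beta integrals,
  which turn the Jacobi polynomial into an \<open>n\<close>-th finite difference of a polynomial of lower degree.
\<close>

section \<open>Integrals over the plane\<close>

text \<open>Two singularities shape the estimates. At the circle the gradient of a weighted
  polynomial can grow like 1 - r^2 to the power \<alpha>/2 - 1; at the origin the gradient of the
  Riesz kernel has size |z|^(-1-\<alpha>), not integrable for \<alpha> \<ge> 1, and its Hessian has
  size |z|^(-2-\<alpha>), never integrable. So neither factor of the convolution can be
  differentiated directly, and the smoothing exists to make the manipulation legitimate. What
  survives the limit is that |z|^(2+\<alpha>) times the Hessian is bounded independently of
  \<open>e\<close>: the integrable majorant found for the fractional Laplacian then controls all
  smoothed operators at once.

  The boundary exponents are matched. The image of a weighted polynomial is of order (1 -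
  |x|)^(-\<alpha>/2); paired with a weighted test function of order (1 - |x|)^(\<alpha>/2) it is
  bounded, and its square times the weight is again of order (1 - |x|)^(-\<alpha>/2), integrable
  since \<alpha> < 2. These two facts stand in for explicit eigenvalues. The analysis is carried out
  for arbitrary polynomials; the Jacobi structure enters through orthogonality, which Bessel's
  inequality requires.\<close>

lemma has_integral_indicator_UNIV:
  fixes f :: "'a::euclidean_space \<Rightarrow> real"
  shows "((\<lambda>s. indicator S s * f s) has_integral v) UNIV \<longleftrightarrow> (f has_integral v) S"
proof -
  have "(\<lambda>s. indicator S s * f s) = (\<lambda>s. if s \<in> S then f s else 0)"
    by (auto simp: indicator_def)
  then show ?thesis by (simp add: has_integral_restrict_UNIV)
qed

text \<open>The disk of radius sqrt s has area pi * s, linear in s, so pushing forward by the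
  squared norm instead of the norm leaves a constant density. Half-lines generate the Borel sets,
  and on them the comparison is exactly this area formula.\<close>

lemma distr_norm_sq:
  "distr lborel borel (\<lambda>x::real^2. (norm x)\<^sup>2) = density lborel (\<lambda>s. ennreal (pi * indicator {0..} s))"
  (is "?M = ?N")
proof (rule measure_eqI_generator_eq[where E="range lessThan" and \<Omega>=UNIV and A="\<lambda>i. {..<real i}"])
  show "Int_stable (range lessThan :: real set set)"
  proof (rule Int_stableI)
    fix a b :: "real set" assume "a \<in> range lessThan" "b \<in> range lessThan"
    then obtain x y where "a = {..<x}" "b = {..<y}" by blast
    then have "a \<inter> b = {..<min x y}" by auto
    then show "a \<inter> b \<in> range lessThan" by blast
  qed
  have em: "emeasure ?M {..<s} = ennreal (pi * max 0 s)" for s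
  proof -
    have "(norm x)\<^sup>2 < s \<longleftrightarrow> norm x < sqrt s" if "0 \<le> s" for x :: "real^2"
      using real_sqrt_less_iff[of "(norm x)\<^sup>2" s] by simp
    then have "(\<lambda>x::real^2. (norm x)\<^sup>2) -` {..<s} = ball 0 (sqrt s)" if "0 \<le> s"
      using that by auto
    moreover have "(\<lambda>x::real^2. (norm x)\<^sup>2) -` {..<s} = {}" if "s < 0"
      using that by (auto simp: not_less dest: le_less_trans[OF zero_le_power2])
    ultimately show ?thesis
      by (cases "0 \<le> s")
        (auto simp: emeasure_distr emeasure_ball unit_ball_vol_2 max_def)
  qed
  have en: "emeasure ?N {..<s} = ennreal (pi * max 0 s)" for s
  proof -
    have "emeasure ?N {..<s} = (\<integral>\<^sup>+x. ennreal pi * indicator {0..<s} x \<partial>lborel)"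
      by (subst emeasure_density) (auto intro!: nn_integral_cong simp: indicator_def)
    also have "\<dots> = ennreal pi * emeasure lborel {0..<s}"
      by (subst nn_integral_cmult_indicator) auto
    also have "\<dots> = ennreal (pi * max 0 s)"
      by (cases "0 \<le> s") (auto simp: max_def ennreal_mult)
    finally show ?thesis .
  qed
  show "emeasure ?M X = emeasure ?N X" if "X \<in> range lessThan" for X
    using that em en by auto
  show "sets ?M = sigma_sets UNIV (range lessThan)"
    by (simp add: borel_eq_lessThan eucl_less_def lessThan_def)
  show "sets ?N = sigma_sets UNIV (range lessThan)"
    by (simp add: borel_eq_lessThan eucl_less_def lessThan_def)
  show "(\<Union>i. {..<real i}) = UNIV" by (auto intro: reals_Archimedean2)
  show "emeasure ?M {..<real i} \<noteq> \<infinity>" for i by (simp add: em)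
qed auto

lemma has_bochner_integral_norm_sq_iff:
  fixes f :: "real \<Rightarrow> real"
  assumes [measurable]: "f \<in> borel_measurable borel"
  shows "has_bochner_integral lborel (\<lambda>x::real^2. f ((norm x)\<^sup>2)) v \<longleftrightarrow>
    has_bochner_integral lborel (\<lambda>s. pi * indicator {0..} s * f s) v"
proof -
  have "has_bochner_integral lborel (\<lambda>x::real^2. f ((norm x)\<^sup>2)) v
      \<longleftrightarrow> has_bochner_integral (distr lborel borel (\<lambda>x::real^2. (norm x)\<^sup>2)) f v"
    by (simp add: has_bochner_integral_iff integrable_distr_eq integral_distr)
  also have "\<dots> \<longleftrightarrow> has_bochner_integral lborel (\<lambda>s. pi * indicator {0..} s * f s) v"
    unfolding distr_norm_sq
    by (simp add: has_bochner_integral_iff integrable_real_density integral_real_density)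
  finally show ?thesis .
qed

text \<open>Nonnegativity is what turns the gauge integral, in which explicit antiderivatives are
  available, into a Lebesgue integral.\<close>

lemma has_bochner_integral_norm_sq:
  fixes f :: "real \<Rightarrow> real"
  assumes [measurable]: "f \<in> borel_measurable borel" and "\<And>s. 0 \<le> s \<Longrightarrow> 0 \<le> f s"
    and "(f has_integral v) {0..}"
  shows "has_bochner_integral lborel (\<lambda>x::real^2. f ((norm x)\<^sup>2)) (pi * v)"
proof -
  have "((\<lambda>s. indicator {0..} s * f s) has_integral v) UNIV"
    using assms(3) by (simp add: has_integral_indicator_UNIV)
  moreover have nn: "0 \<le> indicator {0..} s * f s" for s
    using assms(2) by (simp add: indicator_def)
  ultimately have "(\<integral>\<^sup>+s. ennreal (indicator {0..} s * f s) \<partial>lborel) = ennreal v"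
    by (intro nn_integral_has_integral_lborel) auto
  moreover have "0 \<le> v" by (rule has_integral_nonneg[OF assms(3)]) (use assms(2) in auto)
  ultimately have "has_bochner_integral lborel (\<lambda>s. indicator {0..} s * f s) v"
    using nn by (intro has_bochner_integral_nn_integral) auto
  from has_bochner_integral_mult_right[OF this, of pi] show ?thesis
    by (simp add: has_bochner_integral_norm_sq_iff mult_ac)
qed

lemma has_bochner_integral_ball_norm_powr:
  fixes b R :: real
  assumes "b < 2" "0 \<le> R"
  shows "has_bochner_integral lborel (\<lambda>x::real^2. indicator (ball 0 R) x * norm x powr (- b))
    (pi * (R powr (2 - b) / (1 - b / 2)))"
proof -
  have "((\<lambda>s. s powr (-b/2)) has_integral (R\<^sup>2 powr (-b/2+1) / (-b/2+1))) {0..R\<^sup>2}"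
    using assms by (intro has_integral_powr_from_0) auto
  then have "((\<lambda>s. indicator {0..R\<^sup>2} s * s powr (-b/2)) has_integral (R\<^sup>2 powr (-b/2+1) / (-b/2+1))) UNIV"
    by (simp only: has_integral_indicator_UNIV)
  then have 1: "((\<lambda>s. indicator {0..<R\<^sup>2} s * s powr (-b/2)) has_integral (R\<^sup>2 powr (-b/2+1) / (-b/2+1))) {0..}"
    apply (subst has_integral_restrict_UNIV[symmetric])
    apply (rule has_integral_spike[where S="{R\<^sup>2}", rotated 2], assumption)
    by (auto simp: indicator_def)
  have "R\<^sup>2 powr (-b/2+1) = R powr (2 - b)"
    using assms by (cases "R = 0") (auto simp: powr_def ln_realpow algebra_simps)
  moreover have "indicator {0..<R\<^sup>2} ((norm x)\<^sup>2) * (norm x)\<^sup>2 powr (-b/2)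
    = indicator (ball 0 R) x * norm x powr (- b)" for x :: "real^2"
  proof -
    have "(norm x)\<^sup>2 powr (-b/2) = norm x powr (-b)"
      by (cases "x = 0") (auto simp: powr_def ln_realpow algebra_simps)
    moreover have "(norm x)\<^sup>2 < R\<^sup>2 \<longleftrightarrow> norm x < R"
      using assms by (metis norm_ge_zero pos2 power_mono_iff linorder_not_le)
    ultimately show ?thesis by (simp add: indicator_def)
  qed
  ultimately show ?thesis
    using has_bochner_integral_norm_sq[OF _ _ 1] by (simp add: add.commute)
qed

lemma has_bochner_integral_outside_norm_powr:
  fixes b R :: real
  assumes "2 < b" "0 < R"
  shows "has_bochner_integral lborel (\<lambda>x::real^2. indicator (- ball 0 R) x * norm x powr (- b))
    (pi * (R powr (2 - b) / (b / 2 - 1)))"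
proof -
  have "((\<lambda>s. s powr (-b/2)) has_integral (- (R\<^sup>2 powr (-b/2+1)) / (-b/2+1))) {R\<^sup>2..}"
    using assms by (intro has_integral_powr_to_inf) auto
  then have 1: "((\<lambda>s. indicator {R\<^sup>2..} s * s powr (-b/2)) has_integral (- (R\<^sup>2 powr (-b/2+1)) / (-b/2+1))) {0..}"
    apply (subst has_integral_restrict_UNIV[symmetric])
    apply (subst (asm) has_integral_restrict_UNIV[symmetric])
    apply (rule has_integral_eq[rotated], assumption)
    by (auto simp: indicator_def intro: order.trans[OF zero_le_power2])
  have "R\<^sup>2 powr (-b/2+1) = R powr (2 - b)"
    using assms by (auto simp: powr_def ln_realpow algebra_simps)
  then have "- (R\<^sup>2 powr (-b/2+1)) / (-b/2+1) = R powr (2 - b) / (b / 2 - 1)"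
    using assms by (simp add: field_simps)
  moreover have "indicator {R\<^sup>2..} ((norm x)\<^sup>2) * (norm x)\<^sup>2 powr (-b/2)
    = indicator (- ball 0 R) x * norm x powr (- b)" for x :: "real^2"
  proof -
    have "(norm x)\<^sup>2 powr (-b/2) = norm x powr (-b)"
      by (cases "x = 0") (auto simp: powr_def ln_realpow algebra_simps)
    moreover have "R\<^sup>2 \<le> (norm x)\<^sup>2 \<longleftrightarrow> \<not> norm x < R"
      using assms by (metis norm_ge_zero pos2 power_mono_iff linorder_not_le less_imp_le)
    ultimately show ?thesis by (simp add: indicator_def)
  qed
  ultimately show ?thesis
    using has_bochner_integral_norm_sq[OF _ _ 1] by (simp add: add.commute)
qed

lemma integrable_weight_powr:
  assumes "-1 < c"
  shows "integrable lborel (\<lambda>x::real^2. indicator (ball 0 1) x * (1 - (norm x)\<^sup>2) powr c)"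
proof -
  have "((\<lambda>s. s powr c) has_integral (1 powr (c+1) / (c+1))) {0..1}"
    using assms by (intro has_integral_powr_from_0) auto
  then have "((\<lambda>s. s powr c) has_integral (1 powr (c+1) / (c+1))) (cbox 0 1)" by simp
  from has_integral_affinity[OF this, of "-1" 1]
  have "((\<lambda>s. (1 - s) powr c) has_integral (1 / (c+1))) {0..1}"
    by (simp add: image_affinity_atLeastAtMost_diff)
  then have "((\<lambda>s. indicator {0..1} s * (1-s) powr c) has_integral (1 / (c+1))) UNIV"
    by (simp only: has_integral_indicator_UNIV)
  then have 1: "((\<lambda>s. indicator {0..<1} s * (1-s) powr c) has_integral (1/(c+1))) {0..}"
    apply (subst has_integral_restrict_UNIV[symmetric])
    apply (rule has_integral_spike[where S="{1}", rotated 2], assumption)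
    by (auto simp: indicator_def)
  have "indicator {0..<1} ((norm x)\<^sup>2) * (1 - (norm x)\<^sup>2) powr c
    = indicator (ball 0 1) x * (1 - (norm x)\<^sup>2) powr c" for x :: "real^2"
    using abs_square_less_1[of "norm x"] by (simp add: indicator_def)
  then show ?thesis
    using has_bochner_integral_norm_sq[OF _ _ 1] by (simp only: has_bochner_integral_iff) simp
qed

section \<open>Invariance of Lebesgue measure under reflections, translations and orthogonal
  maps\<close>

lemma lborel_distr_reflect:
  fixes c :: "'a::euclidean_space"
  shows "distr lborel borel (\<lambda>x. c - x) = lborel"
  by (subst lborel_affine[of "-1" c]) (auto simp: density_1)

lemma integral_lborel_reflect:
  fixes f :: "'a::euclidean_space \<Rightarrow> real"
  assumes [measurable]: "f \<in> borel_measurable borel"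
  shows "(LINT y|lborel. f (c - y)) = (LINT y|lborel. f y)"
  by (subst (2) lborel_distr_reflect[of c, symmetric]) (simp add: integral_distr)

lemma integrable_lborel_reflect:
  fixes f :: "'a::euclidean_space \<Rightarrow> real"
  assumes "integrable lborel f"
  shows "integrable lborel (\<lambda>y. f (c - y))"
proof -
  have [measurable]: "f \<in> borel_measurable borel" using assms by auto
  show ?thesis
    using assms by (subst (asm) lborel_distr_reflect[of c, symmetric]) (simp add: integrable_distr_eq)
qed

lemma integral_lborel_translate:
  fixes f :: "'a::euclidean_space \<Rightarrow> real"
  assumes [measurable]: "f \<in> borel_measurable borel"
  shows "(LINT y|lborel. f (c + y)) = (LINT y|lborel. f y)"
  by (subst (2) lborel_distr_plus[of c, symmetric]) (simp add: integral_distr)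

lemma lborel_distr_orthogonal:
  fixes g :: "real^'n::{finite,wellorder} \<Rightarrow> real^'n::_"
  assumes g: "orthogonal_transformation g"
  shows "distr lborel borel g = lborel"
proof (rule lborel_eqI[symmetric])
  have [measurable]: "g \<in> borel_measurable borel"
    using orthogonal_transformation_linear[OF g]
    by (intro borel_measurable_continuous_onI linear_continuous_on) (simp add: linear_linear)
  fix l u :: "real^'n::_" assume lu: "\<And>b. b \<in> Basis \<Longrightarrow> l \<bullet> b \<le> u \<bullet> b"
  have gi: "orthogonal_transformation (inv g)" using g by (rule orthogonal_transformation_inv)
  have eq: "g -` box l u = inv g ` box l u"
    using orthogonal_transformation_bij[OF g] by (simp add: bij_vimage_eq_inv_image)
  have lm: "inv g ` box l u \<in> lmeasurable"
    by (rule measurable_orthogonal_image[OF gi]) auto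
  have "emeasure (distr lborel borel g) (box l u) = emeasure lborel (inv g ` box l u)"
    by (subst emeasure_distr) (auto simp: eq)
  also have "\<dots> = emeasure lebesgue (inv g ` box l u)"
    using measurable_sets[of g borel borel "box l u"] eq by (simp add: emeasure_completion)
  also have "\<dots> = ennreal (measure lebesgue (inv g ` box l u))"
    using lm by (simp add: emeasure_eq_measure2 fmeasurableD2 emeasure_eq_ennreal_measure)
  also have "measure lebesgue (inv g ` box l u) = measure lebesgue (box l u)"
    by (rule measure_orthogonal_image[OF gi]) auto
  also have "ennreal \<dots> = emeasure lborel (box l u)"
    by (simp add: emeasure_lborel_box_eq measure_lborel_box_eq)
  finally show "emeasure (distr lborel borel g) (box l u) = ennreal (\<Prod>b\<in>Basis. (u - l) \<bullet> b)"
    using lu by (simp add: emeasure_lborel_box)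
qed simp

section \<open>Fubini along coordinate lines\<close>

lemma lborel_real2_eq_distr:
  "(lborel :: (real^2) measure) = distr (lborel \<Otimes>\<^sub>M lborel) borel (\<lambda>(a, b). a *\<^sub>R axis 1 1 + b *\<^sub>R axis 2 1)"
  (is "_ = distr _ _ ?v")
proof (rule lborel_eqI)
  have [measurable]: "?v \<in> borel_measurable (borel \<Otimes>\<^sub>M borel)"
    unfolding borel_prod case_prod_beta' by (intro borel_measurable_continuous_onI continuous_intros)
  fix l u :: "real^2" assume lu: "\<And>b. b \<in> Basis \<Longrightarrow> l \<bullet> b \<le> u \<bullet> b"
  have b: "(Basis :: (real^2) set) = {axis 1 1, axis 2 1}"
    by (auto simp: Basis_vec_def UNIV_2)
  have lu': "l $ 1 \<le> u $ 1" "l $ 2 \<le> u $ 2"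
    using lu[of "axis 1 1"] lu[of "axis 2 1"] b by (auto simp: inner_axis)
  have "?v -` box l u = greaterThanLessThan (l $ 1) (u $ 1) \<times> greaterThanLessThan (l $ 2) (u $ 2)"
    by (auto simp: mem_box_cart forall_2 axis_def)
  moreover have "axis 1 1 \<noteq> (axis 2 1 :: real^2)" by (simp add: axis_eq_axis)
  ultimately show "emeasure (distr (lborel \<Otimes>\<^sub>M lborel) borel ?v) (box l u) = (\<Prod>b\<in>Basis. (u - l) \<bullet> b)"
    using lu' by (subst emeasure_distr)
      (auto simp: space_pair_measure lborel.emeasure_pair_measure_Times b inner_axis ennreal_mult)
qed simp

text \<open>Fubini in direction \<open>i\<close>. Base points with i-th coordinate 0 meet every line
  once, and integrability on the line may be assumed because Fubini supplies it for almost every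
  line; this is what makes the fundamental theorem applicable there.\<close>

lemma integral_real2_zero_by_lines:
  fixes f :: "real^2 \<Rightarrow> real"
  assumes f: "integrable lborel f"
    and z: "\<And>y. y $ i = 0 \<Longrightarrow> integrable lborel (\<lambda>t. f (y + t *\<^sub>R axis i 1)) \<Longrightarrow> (LINT t|lborel. f (y + t *\<^sub>R axis i 1)) = 0"
  shows "(LINT x|lborel. f x) = 0"
proof -
  let ?v = "\<lambda>(a, b). a *\<^sub>R axis 1 1 + b *\<^sub>R axis 2 1 :: real^2"
  have [measurable]: "f \<in> borel_measurable borel" using f by auto
  have [measurable]: "?v \<in> borel_measurable (borel \<Otimes>\<^sub>M borel)"
    unfolding borel_prod case_prod_beta' by (intro borel_measurable_continuous_onI continuous_intros)
  have int: "integrable (lborel \<Otimes>\<^sub>M lborel) (\<lambda>p. f (?v p))"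
    using f by (subst (asm) lborel_real2_eq_distr) (simp add: integrable_distr_eq)
  have eq: "(LINT x|lborel. f x) = (LINT p|(lborel \<Otimes>\<^sub>M lborel). f (?v p))"
    by (subst lborel_real2_eq_distr) (simp add: integral_distr)
  have int': "integrable (lborel \<Otimes>\<^sub>M lborel) (\<lambda>(a,b). f (a *\<^sub>R axis 1 1 + b *\<^sub>R axis 2 1))"
    using int by (simp add: case_prod_beta')
  show ?thesis
  proof (cases "i = 1")
    case True
    have "(LINT p|(lborel \<Otimes>\<^sub>M lborel). f (?v p)) = (LINT b|lborel. LINT a|lborel. f (a *\<^sub>R axis 1 1 + b *\<^sub>R axis 2 1))"
      using lborel_pair.integral_snd[OF int'] by (simp add: case_prod_beta')
    moreover have "AE b in lborel. (LINT a|lborel. f (a *\<^sub>R axis 1 1 + b *\<^sub>R axis 2 1)) = 0"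
      using lborel_pair.AE_integrable_snd[OF int']
    proof eventually_elim
      case (elim b)
      then show ?case using z[of "b *\<^sub>R axis 2 1"] True by (simp add: add.commute axis_def)
    qed
    then have "(LINT b|lborel. LINT a|lborel. f (a *\<^sub>R axis 1 1 + b *\<^sub>R axis 2 1)) = 0"
      by (rule integral_eq_zero_AE)
    ultimately show ?thesis using eq by simp
  next
    case False
    then have i: "i = 2" using exhaust_2 by blast
    have "(LINT p|(lborel \<Otimes>\<^sub>M lborel). f (?v p)) = (LINT a|lborel. LINT b|lborel. f (a *\<^sub>R axis 1 1 + b *\<^sub>R axis 2 1))"
      using lborel_pair.integral_fst[OF int'] by (simp add: case_prod_beta')
    moreover have "AE a in lborel. (LINT b|lborel. f (a *\<^sub>R axis 1 1 + b *\<^sub>R axis 2 1)) = 0"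
      using lborel_pair.AE_integrable_fst[OF int']
    proof eventually_elim
      case (elim a)
      then show ?case using z[of "a *\<^sub>R axis 1 1"] i by (simp add: axis_def)
    qed
    then have "(LINT a|lborel. LINT b|lborel. f (a *\<^sub>R axis 1 1 + b *\<^sub>R axis 2 1)) = 0"
      by (rule integral_eq_zero_AE)
    ultimately show ?thesis using eq by simp
  qed
qed

section \<open>Weighted polynomials on the disk\<close>

text \<open>Induction over the generation of polynomial functions. That the partial derivatives are
  polynomials again makes them bounded on the closed disk and allows a further
  differentiation.\<close>

lemma real_polynomial_has_derivative:
  fixes p :: "real^2 \<Rightarrow> real"
  assumes "real_polynomial_function p"
  shows "\<exists>q. (\<forall>i. real_polynomial_function (q i)) \<and>
    (\<forall>x. (p has_derivative (\<lambda>h. \<Sum>i\<in>UNIV. h $ i * q i x)) (at x))"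
  using assms
proof induction
  case (linear f)
  have "f h = (\<Sum>i\<in>UNIV. h $ i * f (axis i 1))" for h
  proof -
    have "f h = f (\<Sum>i\<in>UNIV. h $ i *\<^sub>R axis i 1)"
      by (subst basis_expansion[of h, symmetric]) (simp only: scalar_mult_eq_scaleR)
    also have "\<dots> = (\<Sum>i\<in>UNIV. f (h $ i *\<^sub>R axis i 1))"
      by (rule linear_sum[OF bounded_linear.linear[OF linear]])
    also have "\<dots> = (\<Sum>i\<in>UNIV. h $ i * f (axis i 1))"
      by (simp add: linear_scale[OF bounded_linear.linear[OF linear]])
    finally show ?thesis .
  qed
  then have "(\<lambda>h. \<Sum>i\<in>UNIV. h $ i * f (axis i 1)) = f" by (intro ext) (rule sym)
  moreover have "(f has_derivative f) (at x)" for x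
    using linear by (rule bounded_linear_imp_has_derivative)
  ultimately show ?case
    by (intro exI[of _ "\<lambda>i x. f (axis i 1)"]) (auto intro: real_polynomial_function.intros(2))
next
  case (const c)
  show ?case
    by (intro exI[of _ "\<lambda>i x. 0"]) (auto intro: real_polynomial_function.intros(2))
next
  case (add f g)
  then obtain qf qg where "\<And>i. real_polynomial_function (qf i)" "\<And>i. real_polynomial_function (qg i)"
    and [derivative_intros]: "\<And>x. (f has_derivative (\<lambda>h. \<Sum>i\<in>UNIV. h $ i * qf i x)) (at x)"
    "\<And>x. (g has_derivative (\<lambda>h. \<Sum>i\<in>UNIV. h $ i * qg i x)) (at x)" by blast
  then show ?case
    by (intro exI[of _ "\<lambda>i x. qf i x + qg i x"])
      (auto intro!: derivative_eq_intros real_polynomial_function.intros(3) simp: algebra_simps sum.distrib)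
next
  case (mult f g)
  then obtain qf qg where "\<And>i. real_polynomial_function (qf i)" "\<And>i. real_polynomial_function (qg i)"
    and [derivative_intros]: "\<And>x. (f has_derivative (\<lambda>h. \<Sum>i\<in>UNIV. h $ i * qf i x)) (at x)"
    "\<And>x. (g has_derivative (\<lambda>h. \<Sum>i\<in>UNIV. h $ i * qg i x)) (at x)" by blast
  with mult show ?case
    by (intro exI[of _ "\<lambda>i x. f x * qg i x + qf i x * g x"])
      (auto intro!: derivative_eq_intros real_polynomial_function.intros(3) real_polynomial_function.intros(4)
        simp: algebra_simps sum.distrib sum_distrib_left)
qed

lemma real_polynomial_component: "real_polynomial_function (\<lambda>x::real^2. x $ i)"
  by (rule real_polynomial_function.intros(1)) (rule bounded_linear_vec_nth)

lemma real_polynomial_norm_sq: "real_polynomial_function (\<lambda>x::real^2. (norm x)\<^sup>2)"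
proof -
  have "(\<lambda>x::real^2. (norm x)\<^sup>2) = (\<lambda>x. \<Sum>i\<in>UNIV. x $ i * x $ i)"
    by (simp add: power2_norm_eq_inner inner_vec_def)
  then show ?thesis
    by (simp add: real_polynomial_function.intros(4) real_polynomial_component real_polynomial_function_sum)
qed

lemma real_polynomial_bounded:
  fixes p :: "real^2 \<Rightarrow> real"
  assumes "real_polynomial_function p"
  shows "\<exists>C\<ge>0. \<forall>x\<in>cball 0 1. \<bar>p x\<bar> \<le> C"
proof -
  have "continuous_on (cball 0 1) p"
    using assms continuous_real_polymonial_function continuous_at_imp_continuous_on by blast
  then have "compact (p ` cball 0 1)" by (intro compact_continuous_image) auto
  then obtain C where "\<forall>y\<in>p ` cball 0 1. norm y \<le> C"
    using compact_imp_bounded bounded_iff by blast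
  then show ?thesis by (intro exI[of _ "max C 0"]) auto
qed

lemma real_polynomial_lipschitz:
  fixes p :: "real^2 \<Rightarrow> real"
  assumes "real_polynomial_function p"
  shows "\<exists>L\<ge>0. \<forall>x\<in>cball 0 1. \<forall>y\<in>cball 0 1. \<bar>p x - p y\<bar> \<le> L * norm (x - y)"
proof -
  obtain q where q: "\<And>i. real_polynomial_function (q i)"
    and d: "\<And>x. (p has_derivative (\<lambda>h. \<Sum>i\<in>UNIV. h $ i * q i x)) (at x)"
    using real_polynomial_has_derivative[OF assms] by blast
  obtain C where C: "\<And>i. C i \<ge> 0" "\<And>i x. x \<in> cball 0 1 \<Longrightarrow> \<bar>q i x\<bar> \<le> C i"
    using real_polynomial_bounded[OF q] by metis
  have on: "onorm (\<lambda>h. \<Sum>i\<in>UNIV. h $ i * q i x) \<le> (\<Sum>i\<in>UNIV. C i)" if "x \<in> cball 0 1" for x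
  proof (rule onorm_le)
    fix h :: "real^2"
    have "norm (\<Sum>i\<in>UNIV. h $ i * q i x) \<le> (\<Sum>i\<in>UNIV. norm h * C i)"
      by (rule sum_norm_le) (auto simp: abs_mult intro!: mult_mono component_le_norm_cart C that)
    then show "norm (\<Sum>i\<in>UNIV. h $ i * q i x) \<le> (\<Sum>i\<in>UNIV. C i) * norm h"
      by (simp add: sum_distrib_left mult.commute)
  qed
  have "\<bar>p x - p y\<bar> \<le> (\<Sum>i\<in>UNIV. C i) * norm (x - y)" if "x \<in> cball 0 1" "y \<in> cball 0 1" for x y
    using differentiable_bound[of "cball 0 1" p "\<lambda>x h. \<Sum>i\<in>UNIV. h $ i * q i x" "\<Sum>i\<in>UNIV. C i" x y]
      d on that by (auto intro: has_derivative_at_withinI)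
  then show ?thesis using C by (intro exI[of _ "\<Sum>i\<in>UNIV. C i"]) (auto intro: sum_nonneg)
qed

lemma real_polynomial_borel_measurable:
  fixes p :: "'a::euclidean_space \<Rightarrow> real"
  assumes "real_polynomial_function p"
  shows "p \<in> borel_measurable borel"
  using assms continuous_real_polymonial_function continuous_at_imp_continuous_on
  by (intro borel_measurable_continuous_onI) blast

lemma weight_base_pos: "x \<in> \<Omega> \<Longrightarrow> 0 < 1 - (norm x)\<^sup>2"
  using abs_square_less_1[of "norm x"] by simp

lemma weight_mult_self:
  assumes "x \<in> \<Omega>"
  shows "weight (c - 1) x * (1 - (norm x)\<^sup>2) = weight c x"
proof -
  have "0 < 1 - (norm x)\<^sup>2" using assms by (rule weight_base_pos)
  then show ?thesis
    unfolding weight_def by (metis powr_mult_base add.commute diff_add_cancel mult.commute less_imp_le)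
qed

text \<open>Weighted polynomials are closed under differentiation at the price of one unit in the
  exponent: the product rule with (1 - r^2)^(c-1) pulled out leaves the polynomial (1 - r^2)
  \<partial>_i p - 2 c x_i p. Applied twice, it produces the boundary exponent \<alpha>/2 - 2 of
  second derivatives.\<close>

lemma weight_times_polynomial_has_derivative:
  fixes p :: "real^2 \<Rightarrow> real"
  assumes p: "real_polynomial_function p"
  shows "\<exists>q. (\<forall>i. real_polynomial_function (q i)) \<and>
    (\<forall>x\<in>\<Omega>. ((\<lambda>x. weight c x * p x) has_derivative
       (\<lambda>h. \<Sum>i\<in>UNIV. h $ i * (weight (c - 1) x * q i x))) (at x))"
proof -
  obtain r where r: "\<And>i. real_polynomial_function (r i)"
    and d[derivative_intros]: "\<And>x. (p has_derivative (\<lambda>h. \<Sum>i\<in>UNIV. h $ i * r i x)) (at x)"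
    using real_polynomial_has_derivative[OF p] by blast
  define q where "q i x = (1 - (norm x)\<^sup>2) * r i x - 2 * c * x $ i * p x" for i x
  have "real_polynomial_function (q i)" for i
    unfolding q_def
    by (intro real_polynomial_function_diff real_polynomial_function.intros(4) real_polynomial_function.intros(2)
        real_polynomial_norm_sq r real_polynomial_component p)
  moreover have "((\<lambda>x. weight c x * p x) has_derivative
       (\<lambda>h. \<Sum>i\<in>UNIV. h $ i * (weight (c - 1) x * q i x))) (at x)" if x: "x \<in> \<Omega>" for x
  proof -
    have pos: "0 < 1 - x \<bullet> x" using weight_base_pos[OF x] by (simp add: power2_norm_eq_inner)
    have "((\<lambda>x. (1 - x \<bullet> x) powr c) has_derivative
        (\<lambda>h. - (2 * c * (1 - x \<bullet> x) powr (c - 1) * (x \<bullet> h)))) (at x)"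
      using pos by (auto intro!: derivative_eq_intros simp: inner_commute powr_diff field_simps)
    then have w: "(weight c has_derivative (\<lambda>h. - (2 * c * weight (c - 1) x * (x \<bullet> h)))) (at x)"
      unfolding weight_def[abs_def] power2_norm_eq_inner .
    show ?thesis
      apply (rule has_derivative_eq_rhs[OF has_derivative_mult[OF w d]])
      apply (simp add: fun_eq_iff q_def inner_vec_def sum_2)
      apply (subst weight_mult_self[OF x, of c, symmetric])
      apply (simp add: algebra_simps)
      done
  qed
  ultimately show ?thesis by blast
qed

text \<open>One formula valid up to and on the circle, where it relies on 0 \<open>powr\<close>
  (\<alpha>/2) = 0. It makes the boundary regularity a property of a truncated Lipschitz function
  raised to a power.\<close>

lemma weighted_ext_eq_max:
  assumes "0 < \<alpha>" "x \<in> cball 0 1"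
  shows "weighted_ext \<alpha> p x = (max 0 (1 - (norm x)\<^sup>2)) powr (\<alpha>/2) * p x"
proof (cases "x \<in> \<Omega>")
  case True
  then show ?thesis using weight_base_pos[OF True] by (simp add: weighted_ext_def weight_def)
next
  case False
  then have "norm x = 1" using assms by auto
  then show ?thesis using False by (simp add: weighted_ext_def)
qed

section \<open>Hoelder continuity across the boundary circle\<close>

text \<open>Subadditivity of t^g for g \<le> 1: if b < a, the numbers b/a and (a-b)/a lie in [0,1]
  and add up to 1, and each is at most its g-th power.\<close>

lemma powr_diff_le:
  fixes a b g :: real
  assumes "0 \<le> a" "0 \<le> b" "0 < g" "g \<le> 1"
  shows "\<bar>a powr g - b powr g\<bar> \<le> \<bar>a - b\<bar> powr g"
proof -
  have *: "a powr g - b powr g \<le> (a - b) powr g" if "0 \<le> b" "b < a" for a b :: real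
  proof -
    have "b / a \<le> (b / a) powr g" "(a - b) / a \<le> ((a - b) / a) powr g"
      using that assms powr_mono'[of g 1 "b / a"] powr_mono'[of g 1 "(a - b) / a"] by (auto simp: field_simps)
    moreover have "b / a + (a - b) / a = 1" using that by (simp add: field_simps)
    ultimately have "1 \<le> (b / a) powr g + ((a - b) / a) powr g" by linarith
    also have "\<dots> = (b powr g + (a - b) powr g) / a powr g"
      using that by (simp add: powr_divide add_divide_distrib)
    finally show ?thesis using that by (simp add: field_simps)
  qed
  show ?thesis
  proof (cases a b rule: linorder_cases)
    case less
    then show ?thesis using *[of a b] assms powr_mono2[of g a b] by (auto simp: abs_minus_commute)
  next
    case greater
    then show ?thesis using *[of b a] assms powr_mono2[of g b a] by auto
  qed auto
qed

context
  fixes \<alpha> :: real and p :: "real^2 \<Rightarrow> real"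
  assumes \<alpha>: "0 < \<alpha>" "\<alpha> < 2" and p: "real_polynomial_function p"
begin

lemma weighted_ext_bounded: "\<exists>C\<ge>0. \<forall>x. \<bar>weighted_ext \<alpha> p x\<bar> \<le> C"
proof -
  obtain C where C: "C \<ge> 0" "\<And>x. x \<in> cball 0 1 \<Longrightarrow> \<bar>p x\<bar> \<le> C"
    using real_polynomial_bounded[OF p] by blast
  have "\<bar>weighted_ext \<alpha> p x\<bar> \<le> C" for x
  proof (cases "x \<in> \<Omega>")
    case True
    have "weight (\<alpha>/2) x \<le> 1"
      unfolding weight_def using weight_base_pos[OF True] \<alpha> by (intro powr_le1) auto
    then have "weight (\<alpha>/2) x * \<bar>p x\<bar> \<le> 1 * C"
      using C True by (intro mult_mono) (auto simp: weight_def)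
    then show ?thesis using True by (simp add: weighted_ext_def abs_mult weight_def)
  qed (use C in \<open>auto simp: weighted_ext_def\<close>)
  then show ?thesis using C by blast
qed

lemma weighted_ext_borel [measurable]: "weighted_ext \<alpha> p \<in> borel_measurable borel"
proof -
  have [measurable]: "p \<in> borel_measurable borel" by (rule real_polynomial_borel_measurable[OF p])
  have "weighted_ext \<alpha> p = (\<lambda>x. indicator \<Omega> x * ((1 - (norm x)\<^sup>2) powr (\<alpha>/2) * p x))"
    by (auto simp: weighted_ext_def weight_def indicator_def)
  moreover have [measurable]: "\<Omega> \<in> sets borel" by simp
  ultimately show ?thesis by simp
qed

text \<open>The order \<alpha>/2 is dictated by the boundary: 1 - r^2, cut off at 0, is Lipschitz,
  so its power \<alpha>/2 is Hoelder of that order, while the polynomial factor is Lipschitz on the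
  disk. The estimate has to hold on the whole plane, since second differences reach outside the
  disk.\<close>

lemma weighted_ext_holder:
  "\<exists>C\<ge>0. \<forall>x y. \<bar>weighted_ext \<alpha> p x - weighted_ext \<alpha> p y\<bar> \<le> C * norm (x - y) powr (\<alpha>/2)"
proof -
  define g where "g = \<alpha>/2"
  have g: "0 < g" "g < 1" using \<alpha> by (auto simp: g_def)
  obtain C where C: "C \<ge> 0" "\<And>x. x \<in> cball 0 1 \<Longrightarrow> \<bar>p x\<bar> \<le> C"
    using real_polynomial_bounded[OF p] by blast
  obtain L where L: "L \<ge> 0" "\<And>x y. x \<in> cball 0 1 \<Longrightarrow> y \<in> cball 0 1 \<Longrightarrow> \<bar>p x - p y\<bar> \<le> L * norm (x - y)"
    using real_polynomial_lipschitz[OF p] by metis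
  define W where "W x = max 0 (1 - (norm x)\<^sup>2) powr g" for x :: "real^2"
  have Wn: "0 \<le> W x" "W x \<le> 1" for x
    unfolding W_def using g by (auto intro!: powr_le1)
  \<comment> \<open>Cutting the norm off at 1 turns the truncated weight into 1 - a^2 with a in
    [0,1]; the constant 2 bounds the factor a + b.\<close>
  have lip: "\<bar>max 0 (1 - (norm x)\<^sup>2) - max 0 (1 - (norm y)\<^sup>2)\<bar> \<le> 2 * norm (x - y)" for x y :: "real^2"
  proof -
    have c: "max 0 (1 - (norm z)\<^sup>2) = 1 - (min 1 (norm z))\<^sup>2" for z :: "real^2"
      using abs_square_le_1[of "norm z"] by (auto simp: max_def min_def)
    let ?a = "min 1 (norm x)" and ?b = "min 1 (norm y)"
    have "\<bar>?b\<^sup>2 - ?a\<^sup>2\<bar> = \<bar>?b - ?a\<bar> * (?b + ?a)"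
      by (simp add: power2_eq_square square_diff_square_factored abs_mult mult.commute)
    also have "\<dots> \<le> norm (x - y) * 2"
      using norm_triangle_ineq3[of x y] by (intro mult_mono) auto
    finally show ?thesis unfolding c by simp
  qed
  have WW: "\<bar>W x - W y\<bar> \<le> 2 * norm (x - y) powr g" for x y
  proof -
    have "\<bar>W x - W y\<bar> \<le> \<bar>max 0 (1 - (norm x)\<^sup>2) - max 0 (1 - (norm y)\<^sup>2)\<bar> powr g"
      unfolding W_def using g by (intro powr_diff_le) auto
    also have "\<dots> \<le> (2 * norm (x - y)) powr g"
      using lip g by (intro powr_mono2) auto
    also have "\<dots> = 2 powr g * norm (x - y) powr g" by (simp add: powr_mult)
    also have "\<dots> \<le> 2 powr 1 * norm (x - y) powr g" using g by (intro mult_right_mono powr_mono) auto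
    finally show ?thesis by simp
  qed
  have in_ball: "\<bar>weighted_ext \<alpha> p x - weighted_ext \<alpha> p y\<bar> \<le> (2 * C + 2 * L) * norm (x - y) powr g"
    if xy: "x \<in> cball 0 1" "y \<in> cball 0 1" for x y
  proof -
    have n2: "norm (x - y) \<le> 2" using xy norm_triangle_ineq4[of x y] by simp
    have "norm (x - y) \<le> 2 * norm (x - y) powr g"
    proof (cases "x = y")
      case False
      then have "norm (x - y) = norm (x - y) powr (1 - g) * norm (x - y) powr g"
        by (simp flip: powr_add)
      also have "\<dots> \<le> 2 powr (1 - g) * norm (x - y) powr g"
        using n2 g by (intro mult_right_mono powr_mono2) auto
      also have "\<dots> \<le> 2 powr 1 * norm (x - y) powr g" using g by (intro mult_right_mono powr_mono) auto
      finally show ?thesis by simp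
    qed auto
    then have "L * norm (x - y) \<le> L * (2 * norm (x - y) powr g)" using L by (intro mult_left_mono)
    then have pp: "\<bar>p x - p y\<bar> \<le> 2 * L * norm (x - y) powr g" using L(2)[OF xy] by simp
    have "W x * p x - W y * p y = (W x - W y) * p x + W y * (p x - p y)" by (simp add: algebra_simps)
    also have "\<bar>\<dots>\<bar> \<le> \<bar>W x - W y\<bar> * \<bar>p x\<bar> + W y * \<bar>p x - p y\<bar>"
      using Wn(1)[of y] by (metis abs_mult abs_of_nonneg abs_triangle_ineq)
    also have "\<dots> \<le> (2 * norm (x - y) powr g) * C + 1 * (2 * L * norm (x - y) powr g)"
      using WW C xy Wn pp by (intro add_mono mult_mono) auto
    finally show ?thesis
      using weighted_ext_eq_max[OF \<alpha>(1) xy(1), of p] weighted_ext_eq_max[OF \<alpha>(1) xy(2), of p]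
      by (simp add: W_def g_def algebra_simps)
  qed
  \<comment> \<open>The weight of the outer point is 0, so the weight of the inner point is itself a
    difference of weights and is controlled by the distance.\<close>
  have out: "\<bar>weighted_ext \<alpha> p x\<bar> \<le> (2 * C) * norm (x - y) powr g" if "x \<in> \<Omega>" "y \<notin> \<Omega>" for x y
  proof -
    have "W y = 0" unfolding W_def using that by (simp add: max_def)
      (metis abs_square_less_1 abs_norm_cancel diff_ge_0_iff_ge not_le order_antisym)
    then have "W x \<le> 2 * norm (x - y) powr g" using WW[of x y] by simp
    then have "W x * \<bar>p x\<bar> \<le> (2 * norm (x - y) powr g) * C"
      using C that by (intro mult_mono) auto
    then show ?thesis
      using weighted_ext_eq_max[OF \<alpha>(1), of x p] that Wn(1)[of x] by (simp add: abs_mult W_def g_def mult_ac)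
  qed
  have "\<bar>weighted_ext \<alpha> p x - weighted_ext \<alpha> p y\<bar> \<le> (2 * C + 2 * L) * norm (x - y) powr g" for x y
  proof (cases "x \<in> \<Omega>"; cases "y \<in> \<Omega>")
    assume "x \<in> \<Omega>" "y \<in> \<Omega>" then show ?thesis by (intro in_ball) auto
  next
    assume xy: "x \<in> \<Omega>" "y \<notin> \<Omega>"
    have "(2 * C) * norm (x - y) powr g \<le> (2 * C + 2 * L) * norm (x - y) powr g"
      using L by (intro mult_right_mono) auto
    then show ?thesis using out[OF xy] xy by (simp add: weighted_ext_def[of _ _ y])
  next
    assume xy: "x \<notin> \<Omega>" "y \<in> \<Omega>"
    have "(2 * C) * norm (x - y) powr g \<le> (2 * C + 2 * L) * norm (x - y) powr g"
      using L by (intro mult_right_mono) auto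
    then show ?thesis using out[OF xy(2,1)] xy by (simp add: weighted_ext_def[of _ _ x] norm_minus_commute)
  qed (use C L in \<open>auto simp: weighted_ext_def\<close>)
  then show ?thesis unfolding g_def using C L by (intro exI[of _ "2 * C + 2 * L"]) auto
qed

end

section \<open>Second differences inside the disk\<close>

text \<open>The mean value theorem is applied twice: to f(t) + f(-t) on [0,1], giving f'(\<xi>) -
  f'(-\<xi>), and then to f' on [-\<xi>, \<xi>], whose length is at most 2.\<close>

lemma second_difference_bound:
  fixes f :: "real \<Rightarrow> real"
  assumes f: "\<And>t. \<bar>t\<bar> \<le> 1 \<Longrightarrow> (f has_real_derivative f' t) (at t)"
    and f': "\<And>t. \<bar>t\<bar> \<le> 1 \<Longrightarrow> (f' has_real_derivative f'' t) (at t)"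
    and M: "\<And>t. \<bar>t\<bar> \<le> 1 \<Longrightarrow> \<bar>f'' t\<bar> \<le> M"
  shows "\<bar>f 1 + f (-1) - 2 * f 0\<bar> \<le> 2 * M"
proof -
  have d: "((\<lambda>t. f t + f (- t)) has_real_derivative f' t - f' (- t)) (at t)" if "0 \<le> t" "t \<le> 1" for t
    using that by (auto intro!: derivative_eq_intros f DERIV_chain2[OF f])
  obtain \<xi> where \<xi>: "0 < \<xi>" "\<xi> < 1" and 1: "(f 1 + f (-1)) - (f 0 + f (-0)) = (1 - 0) * (f' \<xi> - f' (- \<xi>))"
    using MVT2[of 0 1 "\<lambda>t. f t + f (- t)" "\<lambda>t. f' t - f' (- t)"] d by auto
  obtain \<eta> where \<eta>: "- \<xi> < \<eta>" "\<eta> < \<xi>" and 2: "f' \<xi> - f' (- \<xi>) = (\<xi> - - \<xi>) * f'' \<eta>"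
    using MVT2[of "-\<xi>" \<xi> f' f''] f' \<xi> by auto
  have "f 1 + f (-1) - 2 * f 0 = 2 * \<xi> * f'' \<eta>" using 1 2 by simp
  also have "\<bar>\<dots>\<bar> \<le> 2 * 1 * M" unfolding abs_mult
    using \<xi> \<eta> M by (intro mult_mono) auto
  finally show ?thesis by simp
qed

lemma weighted_ext_has_derivative:
  assumes "real_polynomial_function p"
  shows "\<exists>q. (\<forall>i. real_polynomial_function (q i)) \<and>
    (\<forall>x\<in>\<Omega>. (weighted_ext \<alpha> p has_derivative
       (\<lambda>h. \<Sum>i\<in>UNIV. h $ i * (weight (\<alpha>/2 - 1) x * q i x))) (at x))"
proof -
  obtain q where "\<forall>i. real_polynomial_function (q i)"
    and d: "\<And>x. x \<in> \<Omega> \<Longrightarrow> ((\<lambda>x. weight (\<alpha>/2) x * p x) has_derivative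
       (\<lambda>h. \<Sum>i\<in>UNIV. h $ i * (weight (\<alpha>/2 - 1) x * q i x))) (at x)"
    using weight_times_polynomial_has_derivative[OF assms] by blast
  moreover have "(weighted_ext \<alpha> p has_derivative
       (\<lambda>h. \<Sum>i\<in>UNIV. h $ i * (weight (\<alpha>/2 - 1) x * q i x))) (at x)" if "x \<in> \<Omega>" for x
    by (rule has_derivative_transform_within_open[OF d[OF that], of \<Omega>])
      (use that in \<open>auto simp: weighted_ext_def\<close>)
  ultimately show ?thesis by blast
qed

text \<open>For |z| at most half the distance d = 1 - |x| to the circle, the segment from x - z to x
  + z stays at distance at least d/2 from it. Along it 1 - r^2 \<ge> 1 - r \<ge> d/2, so second
  derivatives are at most a constant times (d/2)^(\<alpha>/2 - 2).\<close>

lemma weighted_ext_second_difference: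
  assumes p: "real_polynomial_function p" and \<alpha>: "\<alpha> < 2"
  shows "\<exists>C\<ge>0. \<forall>x\<in>\<Omega>. \<forall>z. norm z \<le> (1 - norm x) / 2 \<longrightarrow>
    \<bar>weighted_ext \<alpha> p (x + z) + weighted_ext \<alpha> p (x - z) - 2 * weighted_ext \<alpha> p x\<bar>
      \<le> C * (1 - norm x) powr (\<alpha>/2 - 2) * (norm z)\<^sup>2"
proof -
  let ?u = "weighted_ext \<alpha> p"
  obtain q where q: "\<And>i. real_polynomial_function (q i)"
    and d: "\<And>x. x \<in> \<Omega> \<Longrightarrow> (?u has_derivative (\<lambda>h. \<Sum>i\<in>UNIV. h $ i * (weight (\<alpha>/2 - 1) x * q i x))) (at x)"
    using weighted_ext_has_derivative[OF p, of \<alpha>] by blast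
  have "\<forall>i. \<exists>r. (\<forall>j. real_polynomial_function (r j)) \<and>
    (\<forall>x\<in>\<Omega>. ((\<lambda>x. weight (\<alpha>/2 - 1) x * q i x) has_derivative
       (\<lambda>h. \<Sum>j\<in>UNIV. h $ j * (weight (\<alpha>/2 - 1 - 1) x * r j x))) (at x))"
    using weight_times_polynomial_has_derivative[OF q] by blast
  from choice[OF this] obtain r where r: "\<And>i j. real_polynomial_function (r i j)"
    and d2: "\<And>i x. x \<in> \<Omega> \<Longrightarrow> ((\<lambda>x. weight (\<alpha>/2 - 1) x * q i x) has_derivative
       (\<lambda>h. \<Sum>j\<in>UNIV. h $ j * (weight (\<alpha>/2 - 1 - 1) x * r i j x))) (at x)"
    by blast
  obtain B where B: "\<And>i j. B i j \<ge> 0" "\<And>i j x. x \<in> cball 0 1 \<Longrightarrow> \<bar>r i j x\<bar> \<le> B i j"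
    using real_polynomial_bounded[OF r] by metis
  define S where "S = (\<Sum>i\<in>UNIV. \<Sum>j\<in>UNIV. B i j)"
  \<comment> \<open>The 2 comes from \<open>second_difference_bound\<close>, the power of 1/2 from
    replacing d by d/2, and \<open>S\<close> adds up the bounds on the polynomial factors of all
    second partial derivatives.\<close>
  define C where "C = 2 * (S * (1/2) powr (\<alpha>/2 - 2))"
  have S: "0 \<le> S" unfolding S_def by (intro sum_nonneg B)
  have "\<bar>?u (x + z) + ?u (x - z) - 2 * ?u x\<bar> \<le> C * (1 - norm x) powr (\<alpha>/2 - 2) * (norm z)\<^sup>2"
    if x: "x \<in> \<Omega>" and z: "norm z \<le> (1 - norm x) / 2" for x z
  proof -
    define y where "y t = x + t *\<^sub>R z" for t
    have yn: "norm (y t) \<le> (1 + norm x) / 2" if "\<bar>t\<bar> \<le> 1" for t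
    proof -
      have "norm (y t) \<le> norm x + \<bar>t\<bar> * norm z"
        unfolding y_def by (metis norm_scaleR norm_triangle_ineq)
      also have "\<bar>t\<bar> * norm z \<le> 1 * norm z" using that by (intro mult_right_mono) auto
      also have "norm x + 1 * norm z \<le> (1 + norm x) / 2" using z by (simp add: field_simps)
      finally show ?thesis by simp
    qed
    have y\<Omega>: "y t \<in> \<Omega>" if "\<bar>t\<bar> \<le> 1" for t
      using yn[OF that] x by simp
    have yd: "(y has_derivative (\<lambda>s. s *\<^sub>R z)) (at t)" for t
      unfolding y_def by (auto intro!: derivative_eq_intros)
    have f1: "((\<lambda>t. ?u (y t)) has_real_derivative
        (\<Sum>i\<in>UNIV. z $ i * (weight (\<alpha>/2 - 1) (y t) * q i (y t)))) (at t)" if "\<bar>t\<bar> \<le> 1" for t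
      unfolding has_field_derivative_def
      by (rule has_derivative_eq_rhs[OF has_derivative_compose[OF yd d[OF y\<Omega>[OF that]]]])
        (auto simp: fun_eq_iff sum_distrib_left sum_distrib_right mult_ac)
    have c2: "((\<lambda>t. weight (\<alpha>/2 - 1) (y t) * q i (y t)) has_real_derivative
        (\<Sum>j\<in>UNIV. z $ j * (weight (\<alpha>/2 - 1 - 1) (y t) * r i j (y t)))) (at t)" if "\<bar>t\<bar> \<le> 1" for t i
      unfolding has_field_derivative_def
      by (rule has_derivative_eq_rhs[OF has_derivative_compose[OF yd d2[OF y\<Omega>[OF that]]]])
        (auto simp: fun_eq_iff sum_distrib_left sum_distrib_right mult_ac)
    have f2: "((\<lambda>t. \<Sum>i\<in>UNIV. z $ i * (weight (\<alpha>/2 - 1) (y t) * q i (y t))) has_real_derivative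
        (\<Sum>i\<in>UNIV. z $ i * (\<Sum>j\<in>UNIV. z $ j * (weight (\<alpha>/2 - 1 - 1) (y t) * r i j (y t))))) (at t)"
      if "\<bar>t\<bar> \<le> 1" for t
      by (intro DERIV_sum DERIV_cmult c2 that)
    let ?d = "1 - norm x"
    have dpos: "0 < ?d" using x by simp
    have wb: "weight (\<alpha>/2 - 1 - 1) (y t) \<le> (1/2) powr (\<alpha>/2 - 2) * ?d powr (\<alpha>/2 - 2)" if "\<bar>t\<bar> \<le> 1" for t
    proof -
      have "(norm (y t))\<^sup>2 \<le> norm (y t)"
        using y\<Omega>[OF that] by (simp add: power2_eq_square mult_left_le)
      then have "?d / 2 \<le> 1 - (norm (y t))\<^sup>2" using yn[OF that] by (simp add: field_simps)
      then have "(1 - (norm (y t))\<^sup>2) powr (\<alpha>/2 - 1 - 1) \<le> (1/2 * ?d) powr (\<alpha>/2 - 1 - 1)"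
        using dpos \<alpha> by (intro powr_mono2') auto
      moreover have "(1/2 * ?d) powr (\<alpha>/2 - 1 - 1) = (1/2) powr (\<alpha>/2 - 2) * ?d powr (\<alpha>/2 - 2)"
        using dpos by (subst powr_mult) auto
      ultimately show ?thesis unfolding weight_def by simp
    qed
    have f3: "\<bar>\<Sum>i\<in>UNIV. z $ i * (\<Sum>j\<in>UNIV. z $ j * (weight (\<alpha>/2 - 1 - 1) (y t) * r i j (y t)))\<bar>
        \<le> S * ((1/2) powr (\<alpha>/2 - 2) * ?d powr (\<alpha>/2 - 2)) * (norm z)\<^sup>2" if t: "\<bar>t\<bar> \<le> 1" for t
    proof -
      let ?E = "(1/2) powr (\<alpha>/2 - 2) * ?d powr (\<alpha>/2 - 2)"
      have "\<bar>z $ i * (z $ j * (weight (\<alpha>/2 - 1 - 1) (y t) * r i j (y t)))\<bar> \<le> norm z * (norm z * (?E * B i j))" for i j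
        unfolding abs_mult using wb[OF t] B y\<Omega>[OF t]
        by (intro mult_mono component_le_norm_cart) (auto simp: weight_def intro!: mult_nonneg_nonneg)
      then have "\<bar>\<Sum>i\<in>UNIV. \<Sum>j\<in>UNIV. z $ i * (z $ j * (weight (\<alpha>/2 - 1 - 1) (y t) * r i j (y t)))\<bar>
         \<le> (\<Sum>i\<in>UNIV. \<Sum>j\<in>UNIV. norm z * (norm z * (?E * B i j)))"
        by (intro sum_norm_le[where 'a=real, unfolded real_norm_def]) auto
      also have "\<dots> = S * ?E * (norm z)\<^sup>2"
        by (simp add: S_def sum_distrib_left sum_distrib_right power2_eq_square mult_ac)
      finally show ?thesis by (simp add: sum_distrib_left)
    qed
    show ?thesis
      using second_difference_bound[OF f1 f2 f3] by (simp add: y_def C_def mult_ac)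
  qed
  then show ?thesis using S unfolding C_def by (intro exI[of _ C] conjI) (auto simp: C_def)
qed

section \<open>The fractional Laplacian of a weighted polynomial\<close>

definition second_diff :: "(real^2 \<Rightarrow> real) \<Rightarrow> real^2 \<Rightarrow> real^2 \<Rightarrow> real" where
  "second_diff u x z = u (x + z) + u (x - z) - 2 * u x"

lemma bounded_times_integrable:
  fixes f k :: "'a::euclidean_space \<Rightarrow> real"
  assumes C: "\<And>z. \<bar>f z\<bar> \<le> C" and [measurable]: "f \<in> borel_measurable borel" and k: "integrable lborel k"
  shows "integrable lborel (\<lambda>z. f z * k z)"
proof (rule Bochner_Integration.integrable_bound[of _ "\<lambda>z. C * k z"])
  have [measurable]: "k \<in> borel_measurable borel" using k by auto
  show "integrable lborel (\<lambda>z. C * k z)" using k by simp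
  show "(\<lambda>z. f z * k z) \<in> borel_measurable lborel" by simp
  have "\<bar>f z\<bar> * \<bar>k z\<bar> \<le> \<bar>C\<bar> * \<bar>k z\<bar>" for z using C[of z] by (intro mult_right_mono) auto
  then show "AE z in lborel. norm (f z * k z) \<le> norm (C * k z)" by (auto simp: abs_mult)
qed

context
  fixes \<alpha> :: real and p :: "real^2 \<Rightarrow> real"
  assumes \<alpha>: "0 < \<alpha>" "\<alpha> < 2" and p: "real_polynomial_function p"
begin

lemmas weighted_ext_measurable [measurable] = weighted_ext_borel[OF \<alpha> p]

lemma weighted_ext_integrable: "integrable lborel (weighted_ext \<alpha> p)"
proof -
  obtain C where C: "C \<ge> 0" "\<And>x. \<bar>weighted_ext \<alpha> p x\<bar> \<le> C"
    using weighted_ext_bounded[OF \<alpha> p] by blast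
  have "integrable lborel (\<lambda>x. weighted_ext \<alpha> p x * indicator \<Omega> x)"
    by (rule bounded_times_integrable[OF C(2) weighted_ext_borel[OF \<alpha> p]]) (auto simp: emeasure_ball)
  moreover have "(\<lambda>x. weighted_ext \<alpha> p x * indicator \<Omega> x) = weighted_ext \<alpha> p"
    by (auto simp: weighted_ext_def)
  ultimately show ?thesis by simp
qed

lemma second_diff_measurable [measurable]:
  "(\<lambda>(x, z). second_diff (weighted_ext \<alpha> p) x z) \<in> borel_measurable (borel \<Otimes>\<^sub>M borel)"
  unfolding second_diff_def by measurable

text \<open>Inside half the distance to the boundary the second derivatives of the function are controlled;
  outside, Hoelder continuity of order \<open>\<alpha>/2\<close> suffices. The bound is chosen so that its integral in \<open>z\<close>
  scales like \<open>(1 - |x|)\<close> to the power \<open>-\<alpha>/2\<close>.\<close>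

lemma second_diff_kernel_bound:
  "\<exists>C\<ge>0. \<forall>x\<in>\<Omega>. \<forall>z. \<bar>second_diff (weighted_ext \<alpha> p) x z / norm z powr (2 + \<alpha>)\<bar> \<le>
     C * ((1 - norm x) powr (\<alpha>/2 - 2) * (indicator (ball 0 (1 - norm x)) z * norm z powr (- \<alpha>))
        + indicator (- ball 0 ((1 - norm x) / 2)) z * norm z powr (- (2 + \<alpha>/2)))"
proof -
  obtain C1 where C1: "C1 \<ge> 0" "\<And>x z. x \<in> \<Omega> \<Longrightarrow> norm z \<le> (1 - norm x) / 2 \<Longrightarrow>
      \<bar>second_diff (weighted_ext \<alpha> p) x z\<bar> \<le> C1 * (1 - norm x) powr (\<alpha>/2 - 2) * (norm z)\<^sup>2"
    using weighted_ext_second_difference[OF p \<alpha>(2)] unfolding second_diff_def by blast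
  obtain C2 where C2: "C2 \<ge> 0" "\<And>x y. \<bar>weighted_ext \<alpha> p x - weighted_ext \<alpha> p y\<bar> \<le> C2 * norm (x - y) powr (\<alpha>/2)"
    using weighted_ext_holder[OF \<alpha> p] by blast
  define C where "C = max C1 (2 * C2)"
  show ?thesis
  proof (intro exI[of _ C] conjI ballI allI)
    show "0 \<le> C" unfolding C_def using C1 by simp
    fix x z :: "real^2" assume x: "x \<in> \<Omega>"
    let ?d = "1 - norm x"
    let ?A = "?d powr (\<alpha>/2 - 2) * (indicator (ball 0 ?d) z * norm z powr (- \<alpha>))"
    let ?B = "indicator (- ball 0 (?d / 2)) z * norm z powr (- (2 + \<alpha>/2))"
    have d: "0 < ?d" using x by simp
    have AB: "0 \<le> ?A" "0 \<le> ?B" by auto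
    show "\<bar>second_diff (weighted_ext \<alpha> p) x z / norm z powr (2 + \<alpha>)\<bar> \<le> C * (?A + ?B)"
    proof (cases "z = 0")
      case True then show ?thesis using AB C1 by (simp add: C_def)
    next
      case False
      show ?thesis
      proof (cases "norm z \<le> ?d / 2")
        case True
        then have z: "z \<in> ball 0 ?d" using d by simp
        have "\<bar>second_diff (weighted_ext \<alpha> p) x z / norm z powr (2 + \<alpha>)\<bar>
           \<le> C1 * ?d powr (\<alpha>/2 - 2) * (norm z)\<^sup>2 / norm z powr (2 + \<alpha>)"
          using C1(2)[OF x True] by (simp add: abs_divide divide_right_mono)
        also have "\<dots> = C1 * (?d powr (\<alpha>/2 - 2) * norm z powr (- \<alpha>))"
          using False by (simp add: powr_add powr_minus_divide)
        also have "\<dots> = C1 * ?A" using z by simp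
        also have "\<dots> \<le> C * (?A + ?B)" using AB C1 by (intro mult_mono) (auto simp: C_def)
        finally show ?thesis .
      next
        case False': False
        have "\<bar>second_diff (weighted_ext \<alpha> p) x z\<bar> \<le> 2 * C2 * norm z powr (\<alpha>/2)"
          using C2(2)[of "x + z" x] C2(2)[of "x - z" x] by (simp add: second_diff_def)
        then have "\<bar>second_diff (weighted_ext \<alpha> p) x z / norm z powr (2 + \<alpha>)\<bar>
            \<le> 2 * C2 * norm z powr (\<alpha>/2) / norm z powr (2 + \<alpha>)"
          by (simp add: abs_divide divide_right_mono)
        also have "\<dots> = 2 * C2 * norm z powr (- (2 + \<alpha>/2))"
          using False powr_diff[of "norm z" "\<alpha>/2" "2 + \<alpha>"] by (simp add: diff_divide_distrib algebra_simps)
        also have "\<dots> = 2 * C2 * ?B" using False' by simp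
        also have "\<dots> \<le> C * (?A + ?B)" using AB C1 by (intro mult_mono) (auto simp: C_def)
        finally show ?thesis .
      qed
    qed
  qed
qed

text \<open>With d = 1 - |x|, the inner piece integrates to a multiple of d^(\<alpha>/2 - 2) d^(2 -
  \<alpha>) and the outer one to a multiple of d^(2 - (2 + \<alpha>/2)), both d^(-\<alpha>/2).
  Bounding the integral of the absolute value makes the estimate pass to every truncation.\<close>

lemma second_diff_kernel_integrable:
  "\<exists>C\<ge>0. \<forall>x\<in>\<Omega>. integrable lborel (\<lambda>z. second_diff (weighted_ext \<alpha> p) x z / norm z powr (2 + \<alpha>)) \<and>
     (LINT z|lborel. \<bar>second_diff (weighted_ext \<alpha> p) x z / norm z powr (2 + \<alpha>)\<bar>) \<le> C * (1 - norm x) powr (- (\<alpha>/2))"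
proof -
  obtain C where C: "C \<ge> 0" and bd: "\<And>x z. x \<in> \<Omega> \<Longrightarrow> \<bar>second_diff (weighted_ext \<alpha> p) x z / norm z powr (2 + \<alpha>)\<bar> \<le>
     C * ((1 - norm x) powr (\<alpha>/2 - 2) * (indicator (ball 0 (1 - norm x)) z * norm z powr (- \<alpha>))
        + indicator (- ball 0 ((1 - norm x) / 2)) z * norm z powr (- (2 + \<alpha>/2)))"
    using second_diff_kernel_bound by blast
  \<comment> \<open>The denominators are those of the exact radial integrals: 1 - \<alpha>/2 is
    positive because \<alpha> < 2, and \<alpha>/4 = (2 + \<alpha>/2)/2 - 1 because \<alpha> >
    0.\<close>
  define D where "D = C * (pi / (1 - \<alpha>/2) + pi * (1/2) powr (- (\<alpha>/2)) / (\<alpha>/4))"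
  show ?thesis
  proof (intro exI[of _ D] conjI ballI)
    show "0 \<le> D" using C \<alpha> by (auto simp: D_def intro!: mult_nonneg_nonneg add_nonneg_nonneg divide_nonneg_nonneg)
    fix x :: "real^2" assume x: "x \<in> \<Omega>"
    let ?d = "1 - norm x"
    have d: "0 < ?d" using x by simp
    let ?g = "\<lambda>z::real^2. C * (?d powr (\<alpha>/2 - 2) * (indicator (ball 0 ?d) z * norm z powr (- \<alpha>))
        + indicator (- ball 0 (?d / 2)) z * norm z powr (- (2 + \<alpha>/2)))"
    let ?f = "\<lambda>z. second_diff (weighted_ext \<alpha> p) x z / norm z powr (2 + \<alpha>)"
    have "has_bochner_integral lborel ?g (C * (?d powr (\<alpha>/2 - 2) * (pi * (?d powr (2 - \<alpha>) / (1 - \<alpha> / 2)))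
       + pi * ((?d/2) powr (2 - (2 + \<alpha>/2)) / ((2 + \<alpha>/2) / 2 - 1))))"
      using has_bochner_integral_ball_norm_powr[of \<alpha> ?d] has_bochner_integral_outside_norm_powr[of "2 + \<alpha>/2" "?d/2"] d \<alpha>
      by (intro has_bochner_integral_mult_right has_bochner_integral_add) simp_all
    also have "C * (?d powr (\<alpha>/2 - 2) * (pi * (?d powr (2 - \<alpha>) / (1 - \<alpha> / 2)))
       + pi * ((?d/2) powr (2 - (2 + \<alpha>/2)) / ((2 + \<alpha>/2) / 2 - 1))) = D * ?d powr (- (\<alpha>/2))"
    proof -
      have "?d powr (\<alpha>/2 - 2) * (pi * (?d powr (2 - \<alpha>) / (1 - \<alpha> / 2))) =
         pi / (1 - \<alpha>/2) * (?d powr (\<alpha>/2 - 2) * ?d powr (2 - \<alpha>))" by simp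
      also have "?d powr (\<alpha>/2 - 2) * ?d powr (2 - \<alpha>) = ?d powr (- (\<alpha>/2))"
        by (subst powr_add[symmetric]) (simp add: field_simps)
      finally have 1: "?d powr (\<alpha>/2 - 2) * (pi * (?d powr (2 - \<alpha>) / (1 - \<alpha> / 2))) =
         pi / (1 - \<alpha>/2) * ?d powr (- (\<alpha>/2))" .
      have "(1/2 * ?d) powr (- (\<alpha>/2)) = (1/2) powr (- (\<alpha>/2)) * ?d powr (- (\<alpha>/2))"
        using d by (subst powr_mult) auto
      then have 2: "pi * ((?d/2) powr (2 - (2 + \<alpha>/2)) / ((2 + \<alpha>/2) / 2 - 1)) =
          pi * (1/2) powr (- (\<alpha>/2)) / (\<alpha>/4) * ?d powr (- (\<alpha>/2))" by (simp add: add_divide_distrib)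
      show ?thesis unfolding 1 2 D_def by (simp only: distrib_right mult.assoc)
    qed
    finally have g: "integrable lborel ?g" "(LINT z|lborel. ?g z) = D * ?d powr (- (\<alpha>/2))"
      by (auto simp only: has_bochner_integral_iff)
    show int: "integrable lborel ?f"
      by (rule Bochner_Integration.integrable_bound[OF g(1)]) (use bd[OF x] in \<open>auto intro!: AE_I2 order.trans[OF _ abs_ge_self]\<close>)
    show "(LINT z|lborel. \<bar>?f z\<bar>) \<le> D * ?d powr (- (\<alpha>/2))"
      unfolding g(2)[symmetric]
      by (rule integral_mono[OF integrable_abs[OF int] g(1)]) (rule bd[OF x])
  qed
qed

section \<open>Truncated operators and the principal value\<close>

abbreviation (input) truncated_kernel :: "real \<Rightarrow> real^2 \<Rightarrow> real" where
  "truncated_kernel \<epsilon> z \<equiv> indicator (- ball 0 \<epsilon>) z * norm z powr (- (2 + \<alpha>))"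

lemma truncated_kernel_integrable:
  assumes "0 < \<epsilon>" shows "integrable lborel (truncated_kernel \<epsilon>)"
  using has_bochner_integral_outside_norm_powr[of "2 + \<alpha>" \<epsilon>] assms \<alpha> by (simp add: has_bochner_integral_iff)

text \<open>Away from the pole each term of the numerator is integrable by itself, so the integral
  may be split and shifted freely. The convolution form displays the symmetric kernel and serves the
  symmetry of the operator; the second-difference form, the average over y = x + z and y = x - z,
  serves the limit and the uniform bounds.\<close>

lemma frac_integrand_truncated:
  assumes "0 < \<epsilon>"
  shows frac_integrand_set_integrable: "set_integrable lebesgue (- ball x \<epsilon>) (frac_integrand \<alpha> (weighted_ext \<alpha> p) x)"
    and frac_truncated_eq_convolution: "frac_truncated \<alpha> (weighted_ext \<alpha> p) x \<epsilon> = 1 / \<bar>gamma2 (-\<alpha>)\<bar> *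
       (weighted_ext \<alpha> p x * (LINT z|lborel. truncated_kernel \<epsilon> z)
         - (LINT y|lborel. weighted_ext \<alpha> p y * truncated_kernel \<epsilon> (x - y)))"
    and frac_truncated_eq_second_diff: "frac_truncated \<alpha> (weighted_ext \<alpha> p) x \<epsilon> = - (1 / (2 * \<bar>gamma2 (-\<alpha>)\<bar>)) *
       (LINT z|lborel. indicator (- ball 0 \<epsilon>) z * (second_diff (weighted_ext \<alpha> p) x z / norm z powr (2 + \<alpha>)))"
proof -
  let ?u = "weighted_ext \<alpha> p" and ?k = "truncated_kernel \<epsilon>"
  obtain C where C: "C \<ge> 0" "\<And>x. \<bar>?u x\<bar> \<le> C"
    using weighted_ext_bounded[OF \<alpha> p] by blast
  have k: "integrable lborel ?k" by (rule truncated_kernel_integrable[OF assms])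
  have km[measurable]: "?k \<in> borel_measurable borel" using k by auto
  have kx: "integrable lborel (\<lambda>y. ?k (x - y))" by (rule integrable_lborel_reflect[OF k])
  have kxi: "(LINT y|lborel. ?k (x - y)) = (LINT y|lborel. ?k y)" by (rule integral_lborel_reflect[OF km])
  have uk: "integrable lborel (\<lambda>y. ?u y * ?k (x - y))"
    by (rule bounded_times_integrable[OF C(2) weighted_ext_measurable kx])
  have ukp: "integrable lborel (\<lambda>z. ?u (x + z) * ?k z)"
    by (rule bounded_times_integrable[OF C(2) _ k]) measurable
  have ukm: "integrable lborel (\<lambda>z. ?u (x - z) * ?k z)"
    by (rule bounded_times_integrable[OF C(2) _ k]) measurable
  have mu: "(\<lambda>y. ?u y * ?k (x - y)) \<in> borel_measurable borel" using uk by auto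
  have e1: "(LINT y|lborel. ?u y * ?k (x - y)) = (LINT z|lborel. ?u (x - z) * ?k z)"
    using integral_lborel_reflect[OF mu, of x] by simp
  have e2: "(LINT y|lborel. ?u y * ?k (x - y)) = (LINT z|lborel. ?u (x + z) * ?k z)"
    using integral_lborel_translate[OF mu, of x] by (simp add: indicator_def)
  let ?F = "\<lambda>y. (?u x - ?u y) * ?k (x - y)"
  have Fint: "integrable lborel ?F"
    using kx uk by (simp add: left_diff_distrib)
  have Feq: "indicator (- ball x \<epsilon>) y *\<^sub>R frac_integrand \<alpha> ?u x y = ?F y" for y
    using norm_minus_commute[of x y]
    by (cases "norm (x - y) < \<epsilon>") (simp_all add: frac_integrand_def powr_minus_divide dist_norm del: minus_add_distrib)
  show "set_integrable lebesgue (- ball x \<epsilon>) (frac_integrand \<alpha> ?u x)"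
    unfolding set_integrable_def Feq using Fint by (simp add: integrable_completion)
  have "(LINT y:(- ball x \<epsilon>)|lebesgue. frac_integrand \<alpha> ?u x y) = (LINT y|lborel. ?F y)"
    unfolding set_lebesgue_integral_def Feq using Fint by (intro integral_completion) auto
  also have "\<dots> = ?u x * (LINT z|lborel. ?k z) - (LINT y|lborel. ?u y * ?k (x - y))"
    using kx uk kxi by (simp only: left_diff_distrib) (subst Bochner_Integration.integral_diff, auto)
  finally have I: "(LINT y:(- ball x \<epsilon>)|lebesgue. frac_integrand \<alpha> ?u x y) = 
     ?u x * (LINT z|lborel. ?k z) - (LINT y|lborel. ?u y * ?k (x - y))" .
  show "frac_truncated \<alpha> ?u x \<epsilon> = 1 / \<bar>gamma2 (-\<alpha>)\<bar> *
       (?u x * (LINT z|lborel. ?k z) - (LINT y|lborel. ?u y * ?k (x - y)))"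
    unfolding frac_truncated_def I ..
  have "(LINT z|lborel. indicator (- ball 0 \<epsilon>) z * (second_diff ?u x z / norm z powr (2 + \<alpha>)))
     = (LINT z|lborel. (?u (x + z) * ?k z + ?u (x - z) * ?k z) - 2 * ?u x * ?k z)"
    by (intro Bochner_Integration.integral_cong refl)
      (simp add: second_diff_def powr_minus_divide indicator_def add_divide_distrib diff_divide_distrib
        del: minus_add_distrib)
  also have "\<dots> = 2 * (LINT y|lborel. ?u y * ?k (x - y)) - 2 * (?u x * (LINT z|lborel. ?k z))"
    using ukp ukm k e1 e2 by (subst Bochner_Integration.integral_diff) auto
  finally have J: "(LINT z|lborel. indicator (- ball 0 \<epsilon>) z * (second_diff ?u x z / norm z powr (2 + \<alpha>)))
     = 2 * (LINT y|lborel. ?u y * ?k (x - y)) - 2 * (?u x * (LINT z|lborel. ?k z))" .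
  \<comment> \<open>The case c = 0 is settled by the convention 1 / 0 = 0, so the identity applies
    to the normalising constant as it stands.\<close>
  have arith: "1 / c * (B - A) = - (1 / (2 * c)) * (2 * A - 2 * B)" for A B c :: real
    by (cases "c = 0") (simp_all add: field_simps)
  show "frac_truncated \<alpha> ?u x \<epsilon> = - (1 / (2 * \<bar>gamma2 (-\<alpha>)\<bar>)) *
       (LINT z|lborel. indicator (- ball 0 \<epsilon>) z * (second_diff ?u x z / norm z powr (2 + \<alpha>)))"
    unfolding frac_truncated_def I J by (rule arith)
qed

lemma frac_truncated_tendsto:
  assumes x: "x \<in> \<Omega>"
  shows "(frac_truncated \<alpha> (weighted_ext \<alpha> p) x \<longlongrightarrow> - (1 / (2 * \<bar>gamma2 (-\<alpha>)\<bar>)) *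
       (LINT z|lborel. second_diff (weighted_ext \<alpha> p) x z / norm z powr (2 + \<alpha>))) (at_right 0)"
proof (rule tendsto_at_right_sequentially[of 0 1])
  fix S :: "nat \<Rightarrow> real" assume S: "\<And>n. 0 < S n" "S \<longlonglongrightarrow> 0"
  let ?f = "\<lambda>z. second_diff (weighted_ext \<alpha> p) x z / norm z powr (2 + \<alpha>)"
  have int: "integrable lborel ?f" using second_diff_kernel_integrable x by blast
  have [measurable]: "?f \<in> borel_measurable borel" using int by auto
  have "(\<lambda>n. LINT z|lborel. indicator (- ball 0 (S n)) z * ?f z) \<longlonglongrightarrow> (LINT z|lborel. ?f z)"
  proof (rule integral_dominated_convergence[where w="\<lambda>z. \<bar>?f z\<bar>"])
    show "integrable lborel (\<lambda>z. \<bar>?f z\<bar>)" using int by (rule integrable_abs)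
    show "AE z in lborel. (\<lambda>n. indicator (- ball 0 (S n)) z * ?f z) \<longlonglongrightarrow> ?f z"
    proof (rule AE_I2)
      fix z :: "real^2"
      show "(\<lambda>n. indicator (- ball 0 (S n)) z * ?f z) \<longlonglongrightarrow> ?f z"
      proof (cases "z = 0")
        case False
        then have "eventually (\<lambda>n. S n < norm z) sequentially"
          using S(2) by (intro order_tendstoD) auto
        then have "eventually (\<lambda>n. indicator (- ball 0 (S n)) z * ?f z = ?f z) sequentially"
          by eventually_elim auto
        then show ?thesis by (rule tendsto_eventually)
      qed simp
    qed
    show "AE z in lborel. norm (indicator (- ball 0 (S n)) z * ?f z) \<le> \<bar>?f z\<bar>" for n
      by (auto simp: indicator_def)
  qed measurable
  then show "(\<lambda>n. frac_truncated \<alpha> (weighted_ext \<alpha> p) x (S n)) \<longlonglongrightarrow>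
     - (1 / (2 * \<bar>gamma2 (-\<alpha>)\<bar>)) * (LINT z|lborel. ?f z)"
    unfolding frac_truncated_eq_second_diff[OF S(1)] by (intro tendsto_intros)
qed simp

lemma frac_laplacian_weighted_ext:
  assumes x: "x \<in> \<Omega>"
  shows "frac_laplacian \<alpha> (weighted_ext \<alpha> p) x = - (1 / (2 * \<bar>gamma2 (-\<alpha>)\<bar>)) *
       (LINT z|lborel. second_diff (weighted_ext \<alpha> p) x z / norm z powr (2 + \<alpha>))"
  unfolding frac_laplacian_def using frac_truncated_tendsto[OF x] by (intro tendsto_Lim) auto

lemma frac_laplacian_defined_weighted_ext:
  assumes x: "x \<in> \<Omega>"
  shows "frac_laplacian_defined \<alpha> (weighted_ext \<alpha> p) x"
  unfolding frac_laplacian_defined_def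
  using frac_truncated_tendsto[OF x] frac_integrand_set_integrable by blast

lemma frac_truncated_bound:
  "\<exists>C\<ge>0. \<forall>x\<in>\<Omega>. (\<forall>\<epsilon>>0. \<bar>frac_truncated \<alpha> (weighted_ext \<alpha> p) x \<epsilon>\<bar> \<le> C * (1 - norm x) powr (- (\<alpha>/2))) \<and>
     \<bar>frac_laplacian \<alpha> (weighted_ext \<alpha> p) x\<bar> \<le> C * (1 - norm x) powr (- (\<alpha>/2))"
proof -
  obtain C where C: "C \<ge> 0"
    and int: "\<And>x. x \<in> \<Omega> \<Longrightarrow> integrable lborel (\<lambda>z. second_diff (weighted_ext \<alpha> p) x z / norm z powr (2 + \<alpha>))"
    and bd: "\<And>x. x \<in> \<Omega> \<Longrightarrow>
     (LINT z|lborel. \<bar>second_diff (weighted_ext \<alpha> p) x z / norm z powr (2 + \<alpha>)\<bar>) \<le> C * (1 - norm x) powr (- (\<alpha>/2))"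
    using second_diff_kernel_integrable by blast
  define D where "D = 1 / (2 * \<bar>gamma2 (-\<alpha>)\<bar>)"
  have D: "0 \<le> D" unfolding D_def by simp
  show ?thesis
  proof (intro exI[of _ "D * C"] conjI ballI allI impI)
    show "0 \<le> D * C" using C D by simp
    fix x :: "real^2" assume x: "x \<in> \<Omega>"
    let ?f = "\<lambda>z. second_diff (weighted_ext \<alpha> p) x z / norm z powr (2 + \<alpha>)"
    have [measurable]: "?f \<in> borel_measurable borel" using int[OF x] by auto
    have "\<bar>LINT z|lborel. ?f z\<bar> \<le> C * (1 - norm x) powr (- (\<alpha>/2))"
      using integral_abs_bound[of lborel ?f] bd[OF x] by linarith
    then have "D * \<bar>LINT z|lborel. ?f z\<bar> \<le> D * (C * (1 - norm x) powr (- (\<alpha>/2)))"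
      using D by (intro mult_left_mono)
    then show "\<bar>frac_laplacian \<alpha> (weighted_ext \<alpha> p) x\<bar> \<le> D * C * (1 - norm x) powr (- (\<alpha>/2))"
      unfolding frac_laplacian_weighted_ext[OF x] D_def[symmetric] using D by (simp add: abs_mult mult.assoc)
    fix \<epsilon> :: real assume e: "0 < \<epsilon>"
    have i2: "integrable lborel (\<lambda>z. indicator (- ball 0 \<epsilon>) z * ?f z)"
      by (rule Bochner_Integration.integrable_bound[OF int[OF x]]) (auto simp: indicator_def)
    have "\<bar>LINT z|lborel. indicator (- ball 0 \<epsilon>) z * ?f z\<bar> \<le> (LINT z|lborel. \<bar>indicator (- ball 0 \<epsilon>) z * ?f z\<bar>)"
      by (rule integral_abs_bound)
    also have "\<dots> \<le> (LINT z|lborel. \<bar>?f z\<bar>)"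
      by (rule integral_mono[OF integrable_abs[OF i2] integrable_abs[OF int[OF x]]]) (auto simp: indicator_def)
    also have "\<dots> \<le> C * (1 - norm x) powr (- (\<alpha>/2))" by (rule bd[OF x])
    finally have "D * \<bar>LINT z|lborel. indicator (- ball 0 \<epsilon>) z * ?f z\<bar> \<le> D * (C * (1 - norm x) powr (- (\<alpha>/2)))"
      using D by (intro mult_left_mono)
    then show "\<bar>frac_truncated \<alpha> (weighted_ext \<alpha> p) x \<epsilon>\<bar> \<le> D * C * (1 - norm x) powr (- (\<alpha>/2))"
      unfolding frac_truncated_eq_second_diff[OF e] D_def[symmetric] using D by (simp add: abs_mult mult.assoc)
  qed
qed

lemma frac_truncated_measurable:
  assumes "0 < \<epsilon>"
  shows "(\<lambda>x. frac_truncated \<alpha> (weighted_ext \<alpha> p) x \<epsilon>) \<in> borel_measurable borel"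
proof -
  have [measurable]: "(\<lambda>(x, z). indicator (- ball 0 \<epsilon>) z * (second_diff (weighted_ext \<alpha> p) x z / norm z powr (2 + \<alpha>)))
     \<in> borel_measurable (borel \<Otimes>\<^sub>M lborel)" by measurable
  show ?thesis
    unfolding frac_truncated_eq_second_diff[OF assms]
    by (intro borel_measurable_times borel_measurable_const lborel.borel_measurable_lebesgue_integral) simp
qed

text \<open>Measurability is read off the integral with parameter, which represents the limit inside
  \<Omega>; hence the indicator.\<close>

lemma frac_laplacian_measurable:
  "(\<lambda>x. indicator \<Omega> x * frac_laplacian \<alpha> (weighted_ext \<alpha> p) x) \<in> borel_measurable borel"
proof -
  have [measurable]: "(\<lambda>(x, z). (second_diff (weighted_ext \<alpha> p) x z / norm z powr (2 + \<alpha>)))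
     \<in> borel_measurable (borel \<Otimes>\<^sub>M lborel)" by measurable
  have [measurable]: "(\<lambda>x. LINT z|lborel. second_diff (weighted_ext \<alpha> p) x z / norm z powr (2 + \<alpha>)) \<in> borel_measurable borel"
    by (intro lborel.borel_measurable_lebesgue_integral) simp
  have [measurable]: "\<Omega> \<in> sets borel" by simp
  have "(\<lambda>x. indicator \<Omega> x * frac_laplacian \<alpha> (weighted_ext \<alpha> p) x) = 
     (\<lambda>x. indicator \<Omega> x * (- (1 / (2 * \<bar>gamma2 (-\<alpha>)\<bar>)) *
       (LINT z|lborel. second_diff (weighted_ext \<alpha> p) x z / norm z powr (2 + \<alpha>))))"
    by (auto simp: indicator_def frac_laplacian_weighted_ext)
  also have "\<dots> \<in> borel_measurable borel" by measurable
  finally show ?thesis .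
qed

end

text \<open>Fubini, with a kernel depending only on |x - y|. The truncated kernel is bounded by
  \<epsilon>^(-2-\<alpha>) and both functions are bounded and vanish off \<Omega>, so the double
  integral has a constant majorant on \<Omega> \<times> \<Omega>. The remaining multiplication by a
  constant is symmetric anyway.\<close>

lemma frac_truncated_symmetric:
  assumes \<alpha>: "0 < \<alpha>" "\<alpha> < 2" and p: "real_polynomial_function p" and q: "real_polynomial_function q"
    and e: "0 < \<epsilon>"
  shows "(LINT x|lborel. frac_truncated \<alpha> (weighted_ext \<alpha> p) x \<epsilon> * weighted_ext \<alpha> q x)
    = (LINT x|lborel. weighted_ext \<alpha> p x * frac_truncated \<alpha> (weighted_ext \<alpha> q) x \<epsilon>)"
proof -
  let ?u = "weighted_ext \<alpha> p" and ?v = "weighted_ext \<alpha> q"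
  let ?k = "\<lambda>z::real^2. indicator (- ball 0 \<epsilon>) z * norm z powr (- (2 + \<alpha>))"
  have [measurable]: "?u \<in> borel_measurable borel" "?v \<in> borel_measurable borel"
    by (rule weighted_ext_borel[OF \<alpha> p] weighted_ext_borel[OF \<alpha> q])+
  obtain Cp where Cp: "Cp \<ge> 0" "\<And>x. \<bar>?u x\<bar> \<le> Cp" using weighted_ext_bounded[OF \<alpha> p] by blast
  obtain Cq where Cq: "Cq \<ge> 0" "\<And>x. \<bar>?v x\<bar> \<le> Cq" using weighted_ext_bounded[OF \<alpha> q] by blast
  have kb: "\<bar>?k z\<bar> \<le> \<epsilon> powr (- (2 + \<alpha>))" for z
    using e \<alpha> by (auto simp: indicator_def intro!: powr_mono2')
  have \<Omega>2: "integrable (lborel \<Otimes>\<^sub>M lborel) (indicator (\<Omega> \<times> \<Omega>) :: (real^2) \<times> (real^2) \<Rightarrow> real)"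
    by (auto simp: lborel.emeasure_pair_measure_Times emeasure_ball ennreal_mult_less_top less_top[symmetric] ennreal_mult_eq_top_iff)
  have int: "integrable (lborel \<Otimes>\<^sub>M lborel) (\<lambda>(x, y). ?v x * (?u y * ?k (x - y)))"
  proof (rule Bochner_Integration.integrable_bound)
    show "integrable (lborel \<Otimes>\<^sub>M lborel) (\<lambda>p. (Cq * (Cp * \<epsilon> powr (- (2 + \<alpha>)))) * indicator (\<Omega> \<times> \<Omega>) p :: real)"
      using \<Omega>2 by (intro integrable_mult_right)
    have "\<bar>?v x * (?u y * ?k (x - y))\<bar> \<le> (Cq * (Cp * \<epsilon> powr (- (2 + \<alpha>)))) * indicator (\<Omega> \<times> \<Omega>) (x, y)" for x y
    proof (cases "x \<in> \<Omega> \<and> y \<in> \<Omega>")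
      case True
      then show ?thesis using kb[of "x - y"] Cp Cq unfolding abs_mult[of "?v x"] abs_mult[of "?u y"]
        by (simp del: abs_mult) (intro mult_mono, auto)
    qed (auto simp: weighted_ext_def indicator_def)
    then show "AE p in lborel \<Otimes>\<^sub>M lborel. norm (case p of (x, y) \<Rightarrow> ?v x * (?u y * ?k (x - y)))
       \<le> norm ((Cq * (Cp * \<epsilon> powr (- (2 + \<alpha>)))) * indicator (\<Omega> \<times> \<Omega>) p :: real)"
      by (intro AE_I2) (auto intro!: order.trans[OF _ abs_ge_self])
  qed measurable
  have sym: "(LINT x|lborel. ?v x * (LINT y|lborel. ?u y * ?k (x - y))) = (LINT y|lborel. ?u y * (LINT x|lborel. ?v x * ?k (y - x)))"
  proof -
    have "(LINT x|lborel. ?v x * (LINT y|lborel. ?u y * ?k (x - y))) = (LINT x|lborel. LINT y|lborel. ?v x * (?u y * ?k (x - y)))"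
      by simp
    also have "\<dots> = (LINT y|lborel. LINT x|lborel. ?v x * (?u y * ?k (x - y)))"
      using lborel_pair.Fubini_integral[OF int] by simp
    also have "\<dots> = (LINT y|lborel. LINT x|lborel. ?u y * (?v x * ?k (y - x)))"
      by (intro Bochner_Integration.integral_cong refl) (simp add: indicator_def norm_minus_commute mult_ac)
    finally show ?thesis by simp
  qed
  have iuv: "integrable lborel (\<lambda>x. ?u x * ?v x)"
  proof (rule Bochner_Integration.integrable_bound)
    show "integrable lborel (\<lambda>x::real^2. (Cp * Cq) * indicator \<Omega> x)"
      by (intro integrable_mult_right) (auto simp: emeasure_ball)
    have "\<bar>?u x * ?v x\<bar> \<le> Cp * Cq * indicator \<Omega> x" for x
    proof (cases "x \<in> \<Omega>")
      case True
      have "\<bar>?u x\<bar> * \<bar>?v x\<bar> \<le> Cp * Cq" using Cp Cq by (intro mult_mono) auto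
      then show ?thesis using True by (simp add: abs_mult)
    qed (simp add: weighted_ext_def)
    then show "AE x in lborel. norm (?u x * ?v x) \<le> norm ((Cp * Cq) * indicator \<Omega> x)"
      by (intro AE_I2) (auto intro!: order.trans[OF _ abs_ge_self])
  qed measurable
  have i1: "integrable lborel (\<lambda>x. ?v x * (LINT y|lborel. ?u y * ?k (x - y)))"
    using lborel_pair.integrable_fst'[OF int] by simp
  have i2: "integrable lborel (\<lambda>x. ?u x * (LINT y|lborel. ?v y * ?k (x - y)))"
  proof -
    have "(\<lambda>y. LINT x|lborel. ?v x * (?u y * ?k (x - y))) = (\<lambda>y. LINT x|lborel. ?u y * (?v x * ?k (y - x)))"
      by (intro ext Bochner_Integration.integral_cong refl) (simp add: indicator_def norm_minus_commute mult_ac)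
    then show ?thesis
      using lborel_pair.integrable_snd[OF int] by simp
  qed
  let ?K = "LINT z|lborel. ?k z" and ?c = "1 / \<bar>gamma2 (-\<alpha>)\<bar>"
  have "(LINT x|lborel. frac_truncated \<alpha> ?u x \<epsilon> * ?v x) =
     (LINT x|lborel. ?c * (?K * (?u x * ?v x) - ?v x * (LINT y|lborel. ?u y * ?k (x - y))))"
    unfolding frac_truncated_eq_convolution[OF \<alpha> p e]
    by (intro Bochner_Integration.integral_cong refl) (simp add: algebra_simps)
  also have "\<dots> = ?c * (?K * (LINT x|lborel. ?u x * ?v x) - (LINT x|lborel. ?v x * (LINT y|lborel. ?u y * ?k (x - y))))"
    using iuv i1 by (simp only: integral_mult_right_zero) (subst Bochner_Integration.integral_diff, auto)
  also have "\<dots> = ?c * (?K * (LINT x|lborel. ?u x * ?v x) - (LINT x|lborel. ?u x * (LINT y|lborel. ?v y * ?k (x - y))))"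
    using sym by simp
  also have "\<dots> = (LINT x|lborel. ?c * (?K * (?u x * ?v x) - ?u x * (LINT y|lborel. ?v y * ?k (x - y))))"
    using iuv i2 by (simp only: integral_mult_right_zero) (subst Bochner_Integration.integral_diff, auto)
  also have "\<dots> = (LINT x|lborel. ?u x * frac_truncated \<alpha> ?v x \<epsilon>)"
    unfolding frac_truncated_eq_convolution[OF \<alpha> q e]
    by (intro Bochner_Integration.integral_cong refl) (simp add: algebra_simps)
  finally show ?thesis .
qed

section \<open>Smoothed Riesz kernels\<close>

text \<open>The kernel \<open>|z|\<^sup>-\<^sup>\<alpha>\<close>, smoothed at the origin by \<open>e \<noteq> 0\<close>; the singular kernel is the case \<open>e = 0\<close>.\<close>

definition kern :: "real \<Rightarrow> real \<Rightarrow> real^2 \<Rightarrow> real" where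
  "kern \<alpha> e z = ((norm z)\<^sup>2 + e\<^sup>2) powr (- \<alpha>/2)"

definition kern_grad :: "real \<Rightarrow> real \<Rightarrow> 2 \<Rightarrow> real^2 \<Rightarrow> real" where
  "kern_grad \<alpha> e j z = - \<alpha> * z $ j * ((norm z)\<^sup>2 + e\<^sup>2) powr (- \<alpha>/2 - 1)"

definition kern_hess :: "real \<Rightarrow> real \<Rightarrow> 2 \<Rightarrow> 2 \<Rightarrow> real^2 \<Rightarrow> real" where
  "kern_hess \<alpha> e i j z = \<alpha> * (\<alpha> + 2) * z $ i * z $ j * ((norm z)\<^sup>2 + e\<^sup>2) powr (- \<alpha>/2 - 2)
     - (if i = j then \<alpha> * ((norm z)\<^sup>2 + e\<^sup>2) powr (- \<alpha>/2 - 1) else 0)"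

lemma powr_norm_sq: "((norm z)\<^sup>2) powr c = norm z powr (2 * c)"
  by (cases "norm z = 0") (auto simp: powr_def ln_realpow)

lemma kern_base_pos: "e \<noteq> 0 \<Longrightarrow> 0 < (norm z)\<^sup>2 + e\<^sup>2"
  by (simp add: add_nonneg_pos)

lemma sq_powr_has_derivative:
  fixes z :: "'a::real_inner"
  assumes "0 < z \<bullet> z + c"
  shows "((\<lambda>z. (z \<bullet> z + c) powr r) has_derivative (\<lambda>h. 2 * r * (z \<bullet> h) * (z \<bullet> z + c) powr (r - 1))) (at z)"
proof -
  have "((\<lambda>z. z \<bullet> z + c) has_derivative (\<lambda>h. 2 * (z \<bullet> h))) (at z)"
    by (auto intro!: derivative_eq_intros simp: inner_commute)
  from has_derivative_compose[OF this has_real_derivative_powr[OF assms, unfolded has_field_derivative_def]]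
  show ?thesis by (rule has_derivative_eq_rhs) (simp add: fun_eq_iff mult_ac)
qed

lemma kern_continuous:
  assumes "e \<noteq> 0"
  shows "continuous_on UNIV (kern \<alpha> e)" "continuous_on UNIV (kern_grad \<alpha> e j)" "continuous_on UNIV (kern_hess \<alpha> e i j)"
proof -
  have nz: "(norm z)\<^sup>2 + e\<^sup>2 \<noteq> 0" for z :: "real^2" by (rule less_imp_neq[OF kern_base_pos[OF assms], THEN not_sym])
  show "continuous_on UNIV (kern \<alpha> e)" "continuous_on UNIV (kern_grad \<alpha> e j)"
    unfolding kern_def kern_grad_def using nz by (intro continuous_intros; simp)+
  show "continuous_on UNIV (kern_hess \<alpha> e i j)"
    unfolding kern_hess_def using nz by (cases "i = j"; simp only: if_True if_False simp_thms; intro continuous_intros; simp)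
qed

lemma kern_measurable [measurable]:
  "kern \<alpha> e \<in> borel_measurable borel" "kern_grad \<alpha> e j \<in> borel_measurable borel"
  "kern_hess \<alpha> e i j \<in> borel_measurable borel"
proof -
  have [measurable]: "(\<lambda>z::real^2. z $ i) \<in> borel_measurable borel" for i
    by (intro borel_measurable_continuous_onI continuous_intros)
  show "kern \<alpha> e \<in> borel_measurable borel" "kern_grad \<alpha> e j \<in> borel_measurable borel"
    "kern_hess \<alpha> e i j \<in> borel_measurable borel"
    unfolding kern_def[abs_def] kern_grad_def[abs_def] kern_hess_def[abs_def] by measurable
qed

lemma kern_has_derivative:
  assumes "e \<noteq> 0"
  shows "(kern \<alpha> e has_derivative (\<lambda>h. \<Sum>j\<in>UNIV. h $ j * kern_grad \<alpha> e j z)) (at z)"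
proof -
  have pos: "0 < z \<bullet> z + e\<^sup>2" using kern_base_pos[OF assms, of z] by (simp add: power2_norm_eq_inner)
  have "((\<lambda>z. (z \<bullet> z + e\<^sup>2) powr (- \<alpha>/2)) has_derivative
      (\<lambda>h. - \<alpha> * (z \<bullet> h) * (z \<bullet> z + e\<^sup>2) powr (- \<alpha>/2 - 1))) (at z)"
    using sq_powr_has_derivative[OF pos, of "- \<alpha>/2"] by simp
  then show ?thesis
    unfolding kern_def[abs_def] kern_grad_def power2_norm_eq_inner
    by (rule has_derivative_eq_rhs) (simp add: fun_eq_iff inner_vec_def sum_2 algebra_simps)
qed

lemma kern_grad_has_derivative:
  assumes "e \<noteq> 0"
  shows "(kern_grad \<alpha> e j has_derivative (\<lambda>h. \<Sum>i\<in>UNIV. h $ i * kern_hess \<alpha> e i j z)) (at z)"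
proof -
  have pos: "0 < z \<bullet> z + e\<^sup>2" using kern_base_pos[OF assms, of z] by (simp add: power2_norm_eq_inner)
  have p: "((\<lambda>z. (z \<bullet> z + e\<^sup>2) powr (- \<alpha>/2 - 1)) has_derivative
      (\<lambda>h. (- \<alpha> - 2) * (z \<bullet> h) * (z \<bullet> z + e\<^sup>2) powr (- \<alpha>/2 - 1 - 1))) (at z)"
    using sq_powr_has_derivative[OF pos, of "- \<alpha>/2 - 1"] by (simp add: algebra_simps)
  have "((\<lambda>z. - \<alpha> * z $ j * (z \<bullet> z + e\<^sup>2) powr (- \<alpha>/2 - 1)) has_derivative
     (\<lambda>h. - \<alpha> * z $ j * ((- \<alpha> - 2) * (z \<bullet> h) * (z \<bullet> z + e\<^sup>2) powr (- \<alpha>/2 - 1 - 1))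
        + (- \<alpha> * h $ j) * (z \<bullet> z + e\<^sup>2) powr (- \<alpha>/2 - 1))) (at z)"
    by (intro has_derivative_mult p has_derivative_mult_right
        bounded_linear_imp_has_derivative[OF bounded_linear_vec_nth])
  then show ?thesis
    unfolding kern_grad_def[abs_def] kern_hess_def power2_norm_eq_inner
    apply (rule has_derivative_eq_rhs)
    using exhaust_2[of j] by (auto simp: fun_eq_iff inner_vec_def sum_2 algebra_simps)
qed

text \<open>Expressing a coordinate as the power 1/2 of the kernel base lets every factor of a
  kernel derivative be collected into a single power.\<close>

lemma component_le_sqrt: "\<bar>z $ i\<bar> \<le> ((norm z)\<^sup>2 + e\<^sup>2) powr (1/2)" for z :: "real^2"
proof -
  have "\<bar>z $ i\<bar> \<le> norm z" by (rule component_le_norm_cart)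
  also have "\<dots> \<le> sqrt ((norm z)\<^sup>2 + e\<^sup>2)" by (rule real_le_rsqrt) simp
  finally show ?thesis by (simp add: powr_half_sqrt)
qed

lemma kern_hess_uminus: "kern_hess \<alpha> e i j (- z) = kern_hess \<alpha> e i j z"
  by (simp add: kern_hess_def)

lemma line_has_derivative:
  fixes y v :: "real^2"
  shows "((\<lambda>t. y + t *\<^sub>R v) has_derivative (\<lambda>s. s *\<^sub>R v)) (at t)"
  by (auto intro!: derivative_eq_intros)

lemma norm_line_sq:
  fixes y :: "real^2"
  assumes "y $ i = 0" shows "(norm (y + t *\<^sub>R axis i 1))\<^sup>2 = (norm y)\<^sup>2 + t\<^sup>2"
  unfolding power2_norm_eq_inner
  using assms by (simp add: inner_add_left inner_add_right inner_axis inner_axis' power2_eq_square)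

context
  fixes \<alpha> :: real
  assumes \<alpha>: "0 < \<alpha>" "\<alpha> < 2"
begin

lemma kern_grad_le: "\<bar>kern_grad \<alpha> e j z\<bar> \<le> \<alpha> * ((norm z)\<^sup>2 + e\<^sup>2) powr (- (\<alpha> + 1)/2)"
proof -
  have "\<bar>kern_grad \<alpha> e j z\<bar> = \<alpha> * (\<bar>z $ j\<bar> * ((norm z)\<^sup>2 + e\<^sup>2) powr (- \<alpha>/2 - 1))"
    using \<alpha> by (simp add: kern_grad_def abs_mult)
  also have "\<dots> \<le> \<alpha> * (((norm z)\<^sup>2 + e\<^sup>2) powr (1/2) * ((norm z)\<^sup>2 + e\<^sup>2) powr (- \<alpha>/2 - 1))"
    using \<alpha> component_le_sqrt by (intro mult_left_mono mult_right_mono) auto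
  also have "\<dots> = \<alpha> * ((norm z)\<^sup>2 + e\<^sup>2) powr (- (\<alpha> + 1)/2)"
    unfolding powr_add[symmetric]
    by (rule arg_cong[where f="\<lambda>c. \<alpha> * ((norm z)\<^sup>2 + e\<^sup>2) powr c"]) (simp add: field_simps)
  finally show ?thesis .
qed

lemma kern_hess_le: "\<bar>kern_hess \<alpha> e i j z\<bar> \<le> \<alpha> * (\<alpha> + 3) * ((norm z)\<^sup>2 + e\<^sup>2) powr (- \<alpha>/2 - 1)"
proof -
  let ?s = "(norm z)\<^sup>2 + e\<^sup>2"
  have "\<bar>\<alpha> * (\<alpha> + 2) * z $ i * z $ j * ?s powr (- \<alpha>/2 - 2)\<bar> = \<alpha> * (\<alpha> + 2) * (\<bar>z $ i\<bar> * \<bar>z $ j\<bar> * ?s powr (- \<alpha>/2 - 2))"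
    using \<alpha> by (simp add: abs_mult)
  also have "\<dots> \<le> \<alpha> * (\<alpha> + 2) * (?s powr (1/2) * ?s powr (1/2) * ?s powr (- \<alpha>/2 - 2))"
    using \<alpha> component_le_sqrt by (intro mult_left_mono mult_right_mono mult_mono) auto
  also have "?s powr (1/2) * ?s powr (1/2) * ?s powr (- \<alpha>/2 - 2) = ?s powr (- \<alpha>/2 - 1)"
    unfolding powr_add[symmetric] by (rule arg_cong[where f="\<lambda>c. ?s powr c"]) simp
  finally have "\<bar>\<alpha> * (\<alpha> + 2) * z $ i * z $ j * ?s powr (- \<alpha>/2 - 2)\<bar> \<le> \<alpha> * (\<alpha> + 2) * ?s powr (- \<alpha>/2 - 1)" .
  moreover have "\<bar>if i = j then \<alpha> * ?s powr (- \<alpha>/2 - 1) else 0\<bar> \<le> \<alpha> * ?s powr (- \<alpha>/2 - 1)" using \<alpha> by simp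
  ultimately have "\<bar>kern_hess \<alpha> e i j z\<bar> \<le> \<alpha> * (\<alpha> + 2) * ?s powr (- \<alpha>/2 - 1) + \<alpha> * ?s powr (- \<alpha>/2 - 1)"
    unfolding kern_hess_def by linarith
  then show ?thesis by (simp add: algebra_simps)
qed

text \<open>Dropping \<open>e\<close> from the base only increases a negative power, so the bound is
  the homogeneous one at e = 0 and does not depend on \<open>e\<close>. It is the uniform control
  behind the limit e \<rightarrow> 0; at the origin the left side is 0 because 0 \<open>powr\<close>
  (2 + \<alpha>) = 0.\<close>

lemma kern_hess_scaled_le: "norm z powr (2 + \<alpha>) * \<bar>kern_hess \<alpha> e i j z\<bar> \<le> \<alpha> * (\<alpha> + 3)"
proof (cases "z = 0")
  case False
  have "((norm z)\<^sup>2 + e\<^sup>2) powr (- \<alpha>/2 - 1) \<le> ((norm z)\<^sup>2) powr (- \<alpha>/2 - 1)"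
    using \<alpha> False by (intro powr_mono2') auto
  also have "\<dots> = norm z powr (- (2 + \<alpha>))" unfolding powr_norm_sq by (simp add: algebra_simps)
  finally have "\<bar>kern_hess \<alpha> e i j z\<bar> \<le> \<alpha> * (\<alpha> + 3) * norm z powr (- (2 + \<alpha>))"
    using \<alpha> by (intro order.trans[OF kern_hess_le] mult_left_mono) auto
  then have "norm z powr (2 + \<alpha>) * \<bar>kern_hess \<alpha> e i j z\<bar> \<le> norm z powr (2 + \<alpha>) * (\<alpha> * (\<alpha> + 3) * norm z powr (- (2 + \<alpha>)))"
    by (intro mult_left_mono) auto
  also have "\<dots> = \<alpha> * (\<alpha> + 3)" using False by (simp add: powr_minus field_simps flip: powr_add)
  finally show ?thesis .
qed (use \<alpha> in auto)

lemma kern_bounded: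
  assumes "e \<noteq> 0"
  shows "\<bar>kern \<alpha> e z\<bar> \<le> (e\<^sup>2) powr (- \<alpha>/2)"
    "\<bar>kern_grad \<alpha> e j z\<bar> \<le> \<alpha> * (e\<^sup>2) powr (- (\<alpha> + 1)/2)"
    "\<bar>kern_hess \<alpha> e i j z\<bar> \<le> \<alpha> * (\<alpha> + 3) * (e\<^sup>2) powr (- \<alpha>/2 - 1)"
proof -
  have *: "((norm z)\<^sup>2 + e\<^sup>2) powr c \<le> (e\<^sup>2) powr c" if "c \<le> 0" for c
    using assms that by (intro powr_mono2') auto
  show "\<bar>kern \<alpha> e z\<bar> \<le> (e\<^sup>2) powr (- \<alpha>/2)" using *[of "- \<alpha>/2"] \<alpha> by (simp add: kern_def)
  show "\<bar>kern_grad \<alpha> e j z\<bar> \<le> \<alpha> * (e\<^sup>2) powr (- (\<alpha> + 1)/2)"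
    using * \<alpha> by (intro order.trans[OF kern_grad_le] mult_left_mono) auto
  show "\<bar>kern_hess \<alpha> e i j z\<bar> \<le> \<alpha> * (\<alpha> + 3) * (e\<^sup>2) powr (- \<alpha>/2 - 1)"
    using * \<alpha> by (intro order.trans[OF kern_hess_le] mult_left_mono) auto
qed

text \<open>This is the Laplacian of |z|^(-\<alpha>) in dimension two: \<alpha> (\<alpha> + 2) - 2
  \<alpha> = \<alpha>^2. At the origin both sides are 0 by the conventions for \<open>powr\<close>
  and division.\<close>

lemma kern_hess_trace: "kern_hess \<alpha> 0 1 1 z + kern_hess \<alpha> 0 2 2 z = \<alpha>\<^sup>2 / norm z powr (2 + \<alpha>)"
proof (cases "z = 0")
  case False
  let ?s = "(norm z)\<^sup>2"
  have s: "z $ 1 * z $ 1 + z $ 2 * z $ 2 = ?s"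
    by (simp add: power2_norm_eq_inner inner_vec_def sum_2)
  have "?s powr (- \<alpha>/2 - 1) = ?s powr (1 + (- \<alpha>/2 - 2))"
    by (rule arg_cong[where f="\<lambda>c. ?s powr c"]) simp
  also have "\<dots> = ?s * ?s powr (- \<alpha>/2 - 2)" using False by (subst powr_add) auto
  finally have 1: "?s * ?s powr (- \<alpha>/2 - 2) = ?s powr (- \<alpha>/2 - 1)" ..
  have "2 * (- \<alpha>/2 - 1) = - (2 + \<alpha>)" by simp
  then have 2: "?s powr (- \<alpha>/2 - 1) = 1 / norm z powr (2 + \<alpha>)"
    unfolding powr_norm_sq by (simp only: powr_minus_divide)
  have "kern_hess \<alpha> 0 1 1 z + kern_hess \<alpha> 0 2 2 z =
      \<alpha> * (\<alpha> + 2) * ((z $ 1 * z $ 1 + z $ 2 * z $ 2) * ?s powr (- \<alpha>/2 - 2)) - 2 * \<alpha> * ?s powr (- \<alpha>/2 - 1)"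
    by (simp add: kern_hess_def algebra_simps)
  also have "\<dots> = \<alpha>\<^sup>2 * ?s powr (- \<alpha>/2 - 1)" unfolding s 1 by (simp add: algebra_simps power2_eq_square)
  finally show ?thesis unfolding 2 by simp
qed (simp add: kern_hess_def)

lemma kern_hess_integrable:
  assumes "e \<noteq> 0"
  shows "integrable lborel (kern_hess \<alpha> e i j)"
proof (rule Bochner_Integration.integrable_bound)
  let ?A = "\<alpha> * (\<alpha> + 3) * (e\<^sup>2) powr (- \<alpha>/2 - 1)" and ?B = "\<alpha> * (\<alpha> + 3)"
  let ?g = "\<lambda>z::real^2. ?A * indicator (ball 0 1) z + ?B * (indicator (- ball 0 1) z * norm z powr (- (2 + \<alpha>)))"
  show "integrable lborel ?g"
    using has_bochner_integral_outside_norm_powr[of "2 + \<alpha>" 1] \<alpha>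
    by (intro Bochner_Integration.integrable_add integrable_mult_right)
      (auto simp: has_bochner_integral_iff emeasure_ball)
  have "\<bar>kern_hess \<alpha> e i j z\<bar> \<le> ?g z" for z
  proof (cases "z \<in> ball 0 1")
    case True then show ?thesis using kern_bounded(3)[OF assms] by simp
  next
    case False
    then have "0 < norm z" by (cases "z = 0") auto
    then have "\<bar>kern_hess \<alpha> e i j z\<bar> \<le> ?B * norm z powr (- (2 + \<alpha>))"
      using kern_hess_scaled_le[of z e i j] by (simp add: powr_minus field_simps del: minus_add_distrib)
    then show ?thesis using False by simp
  qed
  then show "AE z in lborel. norm (kern_hess \<alpha> e i j z) \<le> norm (?g z)"
    by (intro AE_I2) (auto intro!: order.trans[OF _ abs_ge_self])
qed measurable

text \<open>On a line in direction \<open>i\<close> the integrand is the derivative of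
  \<open>kern_grad\<close>, which decays like |t|^(-\<alpha>-1) at both ends; Fubini does the rest.
  The vanishing mean is what allows 2 u(x) to be subtracted under the integral.\<close>

lemma kern_hess_integral_zero:
  assumes e: "e \<noteq> 0"
  shows "(LINT z|lborel. kern_hess \<alpha> e i j z) = 0"
proof (rule integral_real2_zero_by_lines[OF kern_hess_integrable[OF e], of i])
  fix y :: "real^2" assume y: "y $ i = 0" and int: "integrable lborel (\<lambda>t. kern_hess \<alpha> e i j (y + t *\<^sub>R axis i 1))"
  let ?F = "\<lambda>t. kern_grad \<alpha> e j (y + t *\<^sub>R axis i 1)"
  let ?f = "\<lambda>t. kern_hess \<alpha> e i j (y + t *\<^sub>R axis i 1)"
  have bd: "norm (?F t) \<le> \<alpha> * \<bar>t\<bar> powr (- (\<alpha> + 1))" if "t \<noteq> 0" for t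
  proof -
    have "\<bar>?F t\<bar> \<le> \<alpha> * ((norm (y + t *\<^sub>R axis i 1))\<^sup>2 + e\<^sup>2) powr (- (\<alpha> + 1)/2)" by (rule kern_grad_le)
    also have "\<dots> \<le> \<alpha> * ((norm t)\<^sup>2) powr (- (\<alpha> + 1)/2)"
      using \<alpha> that unfolding norm_line_sq[OF y] by (intro mult_left_mono powr_mono2') auto
    moreover have "2 * (- (\<alpha> + 1)/2) = - (\<alpha> + 1)" by simp
    ultimately show ?thesis unfolding powr_norm_sq by (simp only: real_norm_def)
  qed
  have lim: "((\<lambda>t. \<alpha> * \<bar>t\<bar> powr (- (\<alpha> + 1))) \<longlongrightarrow> 0) F" if "filterlim (\<lambda>t::real. \<bar>t\<bar>) at_top F" for F
    using \<alpha> that by (intro tendsto_mult_right_zero tendsto_neg_powr) auto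
  have ev: "\<forall>\<^sub>F t in F. norm (?F t) \<le> \<alpha> * \<bar>t\<bar> powr (- (\<alpha> + 1))" if "filterlim (\<lambda>t::real. \<bar>t\<bar>) at_top F" for F
    using filterlim_at_top_dense[THEN iffD1, OF that, rule_format, of 0] by eventually_elim (rule bd, simp)
  have "(?F \<longlongrightarrow> 0) F" if "filterlim (\<lambda>t::real. \<bar>t\<bar>) at_top F" for F
    by (rule Lim_null_comparison[OF ev[OF that] lim[OF that]])
  moreover have "filterlim (\<lambda>t::real. \<bar>t\<bar>) at_top at_top" "filterlim (\<lambda>t::real. \<bar>t\<bar>) at_top at_bot"
    using filterlim_at_top_imp_at_infinity[OF filterlim_ident] filterlim_at_bot_imp_at_infinity[OF filterlim_ident]
    by (auto dest!: filterlim_at_infinity_imp_norm_at_top)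
  ultimately have "(?F \<longlongrightarrow> 0) at_top" "(?F \<longlongrightarrow> 0) at_bot" by blast+
  moreover have "isCont ?f t" for t
  proof -
    have "isCont (kern_hess \<alpha> e i j) w" for w
      using kern_continuous(3)[OF e, of \<alpha> i j] by (simp add: continuous_on_eq_continuous_at)
    then show ?thesis
      by (intro isCont_o2[where g="kern_hess \<alpha> e i j" and f="\<lambda>t. y + t *\<^sub>R axis i 1"]) auto
  qed
  moreover have "(?F has_vector_derivative ?f t) (at t)" for t
    unfolding has_vector_derivative_def
    by (rule has_derivative_eq_rhs[OF has_derivative_compose[OF line_has_derivative kern_grad_has_derivative[OF e]]])
      (use exhaust_2[of i] in \<open>auto simp: fun_eq_iff sum_2 axis_def\<close>)
  ultimately have "(LBINT x=-\<infinity>..\<infinity>. ?f x) = 0 - 0"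
    using int by (intro interval_integral_FTC_integrable[where F="?F"])
      (auto simp: ereal_tendsto_simps set_integrable_def)
  then show "(LINT t|lborel. ?f t) = 0"
    by (simp add: interval_lebesgue_integral_def set_lebesgue_integral_def)
qed

end

section \<open>Differentiating convolutions; the normalising constants\<close>

text \<open>Dominated convergence for the difference quotient. The linear part is at most 2 M |h|,
  one M per coordinate, and by the mean value theorem K is Lipschitz with constant 2 M, so the
  first-order remainder divided by |h| is at most 4 M; thus 4 M |f| is the majorant.\<close>

lemma convolution_has_derivative:
  fixes f K :: "real^2 \<Rightarrow> real"
  assumes f: "integrable lborel f"
    and K: "\<And>z. (K has_derivative (\<lambda>h. \<Sum>j\<in>UNIV. h $ j * K' j z)) (at z)"
    and bK: "\<And>z. \<bar>K z\<bar> \<le> M0" and bK': "\<And>j z. \<bar>K' j z\<bar> \<le> M"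
    and [measurable]: "K \<in> borel_measurable borel" "\<And>j. K' j \<in> borel_measurable borel"
  shows "((\<lambda>x. LINT y|lborel. f y * K (x - y)) has_derivative
    (\<lambda>h. \<Sum>j\<in>UNIV. h $ j * (LINT y|lborel. f y * K' j (x - y)))) (at x)"
  unfolding has_derivative_at
proof
  have [measurable]: "f \<in> borel_measurable borel" using f by auto
  have iK: "integrable lborel (\<lambda>y. f y * K (x - y))" for x
    using bounded_times_integrable[of "\<lambda>y. K (x - y)" M0 f] bK f by (simp add: mult.commute)
  have iK': "integrable lborel (\<lambda>y. f y * K' j (x - y))" for x j
    using bounded_times_integrable[of "\<lambda>y. K' j (x - y)" M f] bK' f by (simp add: mult.commute)
  have M: "0 \<le> M" using bK'[of 1 0] by linarith
  show "bounded_linear (\<lambda>h. \<Sum>j\<in>UNIV. h $ j * (LINT y|lborel. f y * K' j (x - y)))"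
    by (intro bounded_linear_sum bounded_linear_mult_const bounded_linear_vec_nth)
  let ?R = "\<lambda>h y. K (x + h - y) - K (x - y) - (\<Sum>j\<in>UNIV. h $ j * K' j (x - y))"
  have lin: "\<bar>\<Sum>j\<in>UNIV. h $ j * K' j z\<bar> \<le> 2 * M * norm h" for h z
  proof -
    have "\<bar>h $ j * K' j z\<bar> \<le> norm h * M" for j
      unfolding abs_mult using bK' M by (intro mult_mono component_le_norm_cart) auto
    from this[of 1] this[of 2] have "\<bar>\<Sum>j\<in>UNIV. h $ j * K' j z\<bar> \<le> norm h * M + norm h * M"
      unfolding sum_2 by linarith
    then show ?thesis by (simp add: mult_ac)
  qed
  have on: "onorm (\<lambda>h. \<Sum>j\<in>UNIV. h $ j * K' j z) \<le> 2 * M" for z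
    by (rule onorm_le) (simp only: real_norm_def lin)
  have lip: "\<bar>K z - K w\<bar> \<le> 2 * M * norm (z - w)" for z w
    using differentiable_bound[of UNIV K "\<lambda>z h. \<Sum>j\<in>UNIV. h $ j * K' j z" "2 * M" z w] K on
    by simp
  have R: "\<bar>?R h y\<bar> \<le> 4 * M * norm h" for h y
    using lip[of "x + h - y" "x - y"] lin[of h "x - y"] by simp
  have eq: "(LINT y|lborel. f y * K (x + h - y)) - (LINT y|lborel. f y * K (x - y)) -
      (\<Sum>j\<in>UNIV. h $ j * (LINT y|lborel. f y * K' j (x - y))) = (LINT y|lborel. f y * ?R h y)" for h
  proof -
    have "(LINT y|lborel. f y * ?R h y) = (LINT y|lborel. f y * K (x + h - y) - f y * K (x - y)
        - (h $ 1 * (f y * K' 1 (x - y)) + h $ 2 * (f y * K' 2 (x - y))))"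
      by (intro Bochner_Integration.integral_cong refl) (simp add: sum_2 algebra_simps)
    also have "\<dots> = (LINT y|lborel. f y * K (x + h - y)) - (LINT y|lborel. f y * K (x - y))
        - (h $ 1 * (LINT y|lborel. f y * K' 1 (x - y)) + h $ 2 * (LINT y|lborel. f y * K' 2 (x - y)))"
      using iK iK' by simp
    finally show ?thesis by (simp add: sum_2)
  qed
  have "(\<lambda>n. norm (LINT y|lborel. f y * ?R (X n) y) / norm (X n)) \<longlonglongrightarrow> 0"
    if X: "\<And>n. X n \<noteq> 0" "X \<longlonglongrightarrow> 0" for X
  proof -
    have "(\<lambda>n. LINT y|lborel. f y * (?R (X n) y / norm (X n))) \<longlonglongrightarrow> (LINT y|(lborel :: (real^2) measure). 0 :: real)"
    proof (rule integral_dominated_convergence[where w="\<lambda>y. 4 * M * \<bar>f y\<bar>"])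
      show "integrable lborel (\<lambda>y. 4 * M * \<bar>f y\<bar>)" using f by auto
      show "AE y in lborel. (\<lambda>n. f y * (?R (X n) y / norm (X n))) \<longlonglongrightarrow> 0"
      proof (rule AE_I2)
        fix y
        have "(\<lambda>h. norm (K (x - y + h) - K (x - y) - (\<Sum>j\<in>UNIV. h $ j * K' j (x - y))) / norm h) \<midarrow>0\<rightarrow> 0"
          using K[of "x - y"] unfolding has_derivative_at by blast
        then have "(\<lambda>n. norm (K (x - y + X n) - K (x - y) - (\<Sum>j\<in>UNIV. X n $ j * K' j (x - y))) / norm (X n)) \<longlonglongrightarrow> 0"
          using X by (auto simp: tendsto_at_iff_sequentially o_def)
        then have "(\<lambda>n. norm (?R (X n) y / norm (X n))) \<longlonglongrightarrow> 0"
          by (simp add: algebra_simps)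
        then have "(\<lambda>n. ?R (X n) y / norm (X n)) \<longlonglongrightarrow> 0" by (rule tendsto_norm_zero_cancel)
        from tendsto_mult_right_zero[OF this, of "f y"]
        show "(\<lambda>n. f y * (?R (X n) y / norm (X n))) \<longlonglongrightarrow> 0" .
      qed
      show "AE y in lborel. norm (f y * (?R (X n) y / norm (X n))) \<le> 4 * M * \<bar>f y\<bar>" for n
      proof (rule AE_I2)
        fix y
        have "\<bar>?R (X n) y\<bar> / norm (X n) \<le> 4 * M"
          using R[of "X n" y] X(1)[of n] by (simp add: divide_le_eq)
        then have "\<bar>f y\<bar> * (\<bar>?R (X n) y\<bar> / norm (X n)) \<le> \<bar>f y\<bar> * (4 * M)" by (intro mult_left_mono) auto
        then show "norm (f y * (?R (X n) y / norm (X n))) \<le> 4 * M * \<bar>f y\<bar>"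
          by (simp add: abs_mult mult.commute)
      qed
    qed measurable
    then have "(\<lambda>n. (LINT y|lborel. f y * ?R (X n) y) / norm (X n)) \<longlonglongrightarrow> 0" by simp
    from tendsto_norm[OF this] show ?thesis by simp
  qed
  then show "(\<lambda>h. norm ((LINT y|lborel. f y * K (x + h - y)) - (LINT y|lborel. f y * K (x - y)) -
      (\<Sum>j\<in>UNIV. h $ j * (LINT y|lborel. f y * K' j (x - y)))) / norm h) \<midarrow>0\<rightarrow> 0"
    unfolding eq by (simp add: tendsto_at_iff_sequentially o_def)
qed

text \<open>With a = \<alpha>/2, the functional equation turns Gamma(-a) into -Gamma(1-a)/a and
  Gamma(1+a) into a Gamma(a). The quotient of the two constants is therefore -4 a^2 = -\<alpha>^2,
  the 4 coming from the powers of 2; the negative sign is what the absolute value removes.\<close>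

lemma gamma2_relation:
  assumes \<alpha>: "0 < \<alpha>" "\<alpha> < 2"
  shows "gamma2 (2 - \<alpha>) = \<alpha>\<^sup>2 * \<bar>gamma2 (- \<alpha>)\<bar>"
proof -
  let ?a = "\<alpha> / 2"
  have g1: "Gamma (1 + ?a) = ?a * Gamma ?a"
  proof -
    have "?a \<notin> \<int>\<^sub>\<le>\<^sub>0" using \<alpha> nonpos_Ints_nonpos[of ?a] by auto
    then show ?thesis using Gamma_plus1[of ?a] by (simp add: add.commute)
  qed
  \<comment> \<open>Gamma has no pole here: -a lies strictly between -1 and 0.\<close>
  have "- ?a \<notin> \<int>\<^sub>\<le>\<^sub>0"
  proof
    assume "- ?a \<in> \<int>\<^sub>\<le>\<^sub>0"
    then obtain n where n: "- ?a = of_int n" "n \<le> 0" by (elim nonpos_Ints_cases)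
    then have "-1 < (of_int n :: real)" "of_int n < (0::real)" using \<alpha> by linarith+
    then have "-1 < n" "n < 0" by linarith+
    then show False by simp
  qed
  then have g2: "Gamma (1 - ?a) = - ?a * Gamma (- ?a)"
    using Gamma_plus1[of "- ?a"] by simp
  have pos: "0 < Gamma ?a" "0 < Gamma (1 - ?a)" using \<alpha> by auto
  have neg: "Gamma (- ?a) = - (Gamma (1 - ?a) / ?a)" using g2 \<alpha> by (simp add: field_simps)
  have A: "gamma2 (2 - \<alpha>) = 4 * 2 powr (- \<alpha>) * pi * Gamma (1 - ?a) / Gamma ?a"
    by (simp add: gamma2_def powr_diff powr_minus_divide diff_divide_distrib)
  have "0 < gamma2 (2 - \<alpha>)" unfolding A using pos by simp
  have "gamma2 (- \<alpha>) = 2 powr (- \<alpha>) * pi * Gamma (- ?a) / Gamma (1 + ?a)"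
    by (simp add: gamma2_def add_divide_distrib)
  also have "\<dots> = - (4 * 2 powr (- \<alpha>) * pi * Gamma (1 - ?a) / Gamma ?a / \<alpha>\<^sup>2)"
    unfolding neg g1 using \<alpha> by (simp add: field_simps power2_eq_square)
  finally have "gamma2 (- \<alpha>) = - (gamma2 (2 - \<alpha>) / \<alpha>\<^sup>2)" unfolding A .
  then show ?thesis
    using \<open>0 < gamma2 (2 - \<alpha>)\<close> \<alpha> by simp
qed

section \<open>The Riesz potential of the gradient\<close>

text \<open>The i-th partial derivative of a weighted polynomial, extended by zero, once
  \<open>q\<close> is the polynomial family produced by
  \<open>weighted_ext_has_derivative\<close>.\<close>

definition weighted_partial :: "real \<Rightarrow> (2 \<Rightarrow> real^2 \<Rightarrow> real) \<Rightarrow> 2 \<Rightarrow> real^2 \<Rightarrow> real" where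
  "weighted_partial \<alpha> q i x = indicator \<Omega> x * (weight (\<alpha>/2 - 1) x * q i x)"

context
  fixes \<alpha> :: real and p :: "real^2 \<Rightarrow> real" and q :: "2 \<Rightarrow> real^2 \<Rightarrow> real"
  assumes \<alpha>: "0 < \<alpha>" "\<alpha> < 2" and p: "real_polynomial_function p"
    and q: "\<And>i. real_polynomial_function (q i)"
    and d: "\<And>x. x \<in> \<Omega> \<Longrightarrow> (weighted_ext \<alpha> p has_derivative
       (\<lambda>h. \<Sum>i\<in>UNIV. h $ i * (weight (\<alpha>/2 - 1) x * q i x))) (at x)"
begin

lemma weighted_partial_measurable [measurable]: "weighted_partial \<alpha> q i \<in> borel_measurable borel"
proof -
  have [measurable]: "q i \<in> borel_measurable borel" by (rule real_polynomial_borel_measurable[OF q])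
  have [measurable]: "\<Omega> \<in> sets borel" by simp
  show ?thesis unfolding weighted_partial_def[abs_def] weight_def by measurable
qed

text \<open>The gradient may blow up at the circle, but its exponent \<alpha>/2 - 1 exceeds -1 since
  \<alpha> > 0.\<close>

lemma weighted_partial_integrable: "integrable lborel (weighted_partial \<alpha> q i)"
proof -
  obtain C where C: "C \<ge> 0" "\<And>x. x \<in> cball 0 1 \<Longrightarrow> \<bar>q i x\<bar> \<le> C"
    using real_polynomial_bounded[OF q] by blast
  show ?thesis
  proof (rule Bochner_Integration.integrable_bound)
    show "integrable lborel (\<lambda>x::real^2. C * (indicator (ball 0 1) x * (1 - (norm x)\<^sup>2) powr (\<alpha>/2 - 1)))"
      using \<alpha> by (intro integrable_mult_right integrable_weight_powr) auto
    have "\<bar>weighted_partial \<alpha> q i x\<bar> \<le> C * (indicator \<Omega> x * (1 - (norm x)\<^sup>2) powr (\<alpha>/2 - 1))" for x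
    proof (cases "x \<in> \<Omega>")
      case True
      then have "weight (\<alpha>/2 - 1) x * \<bar>q i x\<bar> \<le> weight (\<alpha>/2 - 1) x * C"
        using C by (intro mult_left_mono) (auto simp: weight_def)
      then show ?thesis using True by (simp add: weighted_partial_def abs_mult weight_def mult.commute)
    qed (simp add: weighted_partial_def)
    then show "AE x in lborel. norm (weighted_partial \<alpha> q i x) \<le>
        norm (C * (indicator \<Omega> x * (1 - (norm x)\<^sup>2) powr (\<alpha>/2 - 1)))"
      by (intro AE_I2) (auto intro!: order.trans[OF _ abs_ge_self])
  qed simp
qed

text \<open>The pole of the kernel at x and the boundary singularity of the gradient are a positive
  distance apart. On the ball of half that distance the gradient is bounded and the kernel
  integrable, because \<alpha> < 2; outside it the kernel is bounded and the gradient
  integrable.\<close>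

lemma weighted_partial_riesz_integrable:
  assumes x: "x \<in> \<Omega>"
  shows "integrable lborel (\<lambda>y. weighted_partial \<alpha> q i y * norm (x - y) powr (- \<alpha>))"
proof -
  obtain C where C: "C \<ge> 0" "\<And>x. x \<in> cball 0 1 \<Longrightarrow> \<bar>q i x\<bar> \<le> C"
    using real_polynomial_bounded[OF q] by blast
  let ?r = "(1 - norm x) / 2"
  have r: "0 < ?r" using x by simp
  let ?M = "?r powr (\<alpha>/2 - 1) * C"
  let ?k = "\<lambda>z::real^2. indicator (ball 0 ?r) z * norm z powr (- \<alpha>)"
  have k: "integrable lborel ?k"
    using has_bochner_integral_ball_norm_powr[of \<alpha> ?r] \<alpha> r by (simp add: has_bochner_integral_iff)
  let ?g = "\<lambda>y. ?M * ?k (x - y) + ?r powr (- \<alpha>) * \<bar>weighted_partial \<alpha> q i y\<bar>"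
  show ?thesis
  proof (rule Bochner_Integration.integrable_bound[of _ ?g])
    show "integrable lborel ?g"
      by (intro Bochner_Integration.integrable_add integrable_mult_right integrable_abs
          weighted_partial_integrable integrable_lborel_reflect[OF k])
    have "\<bar>weighted_partial \<alpha> q i y * norm (x - y) powr (- \<alpha>)\<bar> \<le> ?g y" for y
    proof (cases "x - y \<in> ball 0 ?r")
      case True
      have "norm y \<le> norm x + norm (x - y)" by (metis norm_minus_commute norm_triangle_sub)
      then have y: "norm y < (1 + norm x) / 2" using True by (simp add: field_simps)
      then have y\<Omega>: "y \<in> \<Omega>" using r by simp
      have "(norm y)\<^sup>2 \<le> norm y" using y\<Omega> by (simp add: power2_eq_square mult_left_le)
      then have "?r \<le> 1 - (norm y)\<^sup>2" using y by (simp add: field_simps)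
      then have "weight (\<alpha>/2 - 1) y \<le> ?r powr (\<alpha>/2 - 1)"
        unfolding weight_def using r \<alpha> by (intro powr_mono2') auto
      then have "weight (\<alpha>/2 - 1) y * \<bar>q i y\<bar> \<le> ?M"
        using C y\<Omega> by (intro mult_mono) auto
      then have "\<bar>weighted_partial \<alpha> q i y\<bar> \<le> ?M"
        using y\<Omega> by (simp add: weighted_partial_def abs_mult weight_def)
      then have "\<bar>weighted_partial \<alpha> q i y * norm (x - y) powr (- \<alpha>)\<bar> \<le> ?M * norm (x - y) powr (- \<alpha>)"
        by (simp add: abs_mult mult_right_mono)
      also have "\<dots> \<le> ?g y" using True by simp
      finally show ?thesis .
    next
      case False
      then have "?r \<le> norm (x - y)" by simp
      then have "norm (x - y) powr (- \<alpha>) \<le> ?r powr (- \<alpha>)" using r \<alpha> by (intro powr_mono2') auto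
      then have "\<bar>weighted_partial \<alpha> q i y * norm (x - y) powr (- \<alpha>)\<bar> \<le> \<bar>weighted_partial \<alpha> q i y\<bar> * ?r powr (- \<alpha>)"
        by (simp add: abs_mult mult_left_mono)
      then show ?thesis using False by (simp add: mult.commute)
    qed
    then show "AE y in lborel. norm (weighted_partial \<alpha> q i y * norm (x - y) powr (- \<alpha>)) \<le> norm (?g y)"
      by (intro AE_I2) (auto intro!: order.trans[OF _ abs_ge_self])
  qed measurable
qed

lemma weighted_ext_continuous: "continuous_on UNIV (weighted_ext \<alpha> p)"
proof -
  obtain C where C: "C \<ge> 0" "\<And>x y. \<bar>weighted_ext \<alpha> p x - weighted_ext \<alpha> p y\<bar> \<le> C * norm (x - y) powr (\<alpha>/2)"
    using weighted_ext_holder[OF \<alpha> p] by blast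
  have "(weighted_ext \<alpha> p \<longlongrightarrow> weighted_ext \<alpha> p x) (at x)" for x
  proof -
    have "((\<lambda>y. norm (y - x) powr (\<alpha>/2)) \<longlongrightarrow> 0 powr (\<alpha>/2)) (at x)"
      using \<alpha> by (intro tendsto_powr') (auto intro!: tendsto_eq_intros)
    then have "((\<lambda>y. C * norm (y - x) powr (\<alpha>/2)) \<longlongrightarrow> 0) (at x)"
      by (intro tendsto_mult_right_zero) simp
    then have "((\<lambda>y. weighted_ext \<alpha> p y - weighted_ext \<alpha> p x) \<longlongrightarrow> 0) (at x)"
      by (rule Lim_null_comparison[rotated]) (use C(2) in auto)
    then show ?thesis by (rule Lim_null[THEN iffD2])
  qed
  then show ?thesis by (simp add: continuous_on_def)
qed

text \<open>On a line in direction \<open>i\<close> that meets the disk, the product of u and the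
  kernel gradient is continuous on the closed chord and zero at its ends, but differentiable only in
  the interior, as the gradient of u can be singular at the ends; hence the interior form of the
  fundamental theorem. The sign of the integration by parts cancels against the derivative of x - y
  in y.\<close>

lemma kernel_integration_by_parts:
  assumes e: "e \<noteq> 0"
  shows "(LINT y|lborel. weighted_partial \<alpha> q i y * kern_grad \<alpha> e j (x - y)) =
    (LINT y|lborel. weighted_ext \<alpha> p y * kern_hess \<alpha> e i j (x - y))"
proof -
  let ?u = "weighted_ext \<alpha> p" and ?f = "weighted_partial \<alpha> q i"
  let ?D = "\<lambda>y. ?f y * kern_grad \<alpha> e j (x - y) - ?u y * kern_hess \<alpha> e i j (x - y)"
  have i1: "integrable lborel (\<lambda>y. ?f y * kern_grad \<alpha> e j (x - y))"
    using bounded_times_integrable[of "\<lambda>y. kern_grad \<alpha> e j (x - y)", OF kern_bounded(2)[OF \<alpha> e] _ weighted_partial_integrable]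
    by (simp add: mult.commute)
  have i2: "integrable lborel (\<lambda>y. ?u y * kern_hess \<alpha> e i j (x - y))"
    using bounded_times_integrable[of "\<lambda>y. kern_hess \<alpha> e i j (x - y)", OF kern_bounded(3)[OF \<alpha> e] _ weighted_ext_integrable[OF \<alpha> p]]
    by (simp add: mult.commute)
  have "(LINT y|lborel. ?D y) = 0"
  proof (rule integral_real2_zero_by_lines[of _ i])
    show "integrable lborel ?D" using i1 i2 by simp
    fix y :: "real^2" assume y: "y $ i = 0" and int: "integrable lborel (\<lambda>t. ?D (y + t *\<^sub>R axis i 1))"
    let ?l = "\<lambda>t. y + t *\<^sub>R axis i 1"
    have in\<Omega>: "?l t \<in> \<Omega> \<longleftrightarrow> (norm y)\<^sup>2 + t\<^sup>2 < 1" for t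
      using norm_line_sq[OF y, of t] abs_square_less_1[of "norm (?l t)"] by simp
    have out: "?D (?l t) = 0" if "?l t \<notin> \<Omega>" for t
      using that by (simp add: weighted_partial_def weighted_ext_def)
    have "((\<lambda>t. ?D (?l t)) has_integral 0) UNIV"
    proof (cases "norm y < 1")
      case False
      then have "1 \<le> (norm y)\<^sup>2" by simp
      then have "?l t \<notin> \<Omega>" for t unfolding in\<Omega> using zero_le_power2[of t] by linarith
      then have "?D (?l t) = 0" for t by (rule out)
      then have "(\<lambda>t. ?D (?l t)) = (\<lambda>t. 0)" by blast
      then show ?thesis by (simp only: has_integral_0)
    next
      case True
      \<comment> \<open>Half the length of the chord cut out by the line, by Pythagoras.\<close>
      define s where "s = sqrt (1 - (norm y)\<^sup>2)"
      have s2: "s\<^sup>2 = 1 - (norm y)\<^sup>2" and s0: "0 \<le> s"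
        using True abs_square_less_1[of "norm y"] by (auto simp: s_def)
      have ins: "?l t \<in> \<Omega> \<longleftrightarrow> \<bar>t\<bar> < s" for t
      proof -
        have "s \<le> \<bar>t\<bar> \<longleftrightarrow> s\<^sup>2 \<le> t\<^sup>2" using abs_le_square_iff[of s t] s0 by simp
        then show ?thesis unfolding in\<Omega> s2 by linarith
      qed
      let ?F = "\<lambda>t. ?u (?l t) * kern_grad \<alpha> e j (x - ?l t)"
      have "((\<lambda>t. ?D (?l t)) has_integral (?F s - ?F (- s))) {- s..s}"
      proof (rule fundamental_theorem_of_calculus_interior)
        show "- s \<le> s" using s0 by simp
        show "continuous_on {- s..s} ?F"
          by (intro continuous_intros continuous_on_compose2[OF weighted_ext_continuous]
              continuous_on_compose2[OF kern_continuous(2)[OF e]]) auto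
        fix t assume "t \<in> {- s<..<s}"
        then have t: "?l t \<in> \<Omega>" unfolding ins by auto
        have 1: "((\<lambda>t. ?u (?l t)) has_derivative (\<lambda>h. h * ?f (?l t))) (at t)"
          by (rule has_derivative_eq_rhs[OF has_derivative_compose[OF line_has_derivative d[OF t]]])
            (use t exhaust_2[of i] in \<open>auto simp: fun_eq_iff weighted_partial_def axis_def sum_2\<close>)
        have xl: "((\<lambda>t. x - ?l t) has_derivative (\<lambda>h. - (h *\<^sub>R axis i 1))) (at t)"
          by (auto intro!: derivative_eq_intros)
        have 2: "((\<lambda>t. kern_grad \<alpha> e j (x - ?l t)) has_derivative (\<lambda>h. - (h * kern_hess \<alpha> e i j (x - ?l t)))) (at t)"
          by (rule has_derivative_eq_rhs[OF has_derivative_compose[OF xl kern_grad_has_derivative[OF e]]])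
            (use exhaust_2[of i] in \<open>auto simp: fun_eq_iff axis_def sum_2\<close>)
        show "(?F has_vector_derivative ?D (?l t)) (at t)"
          unfolding has_vector_derivative_def
          by (rule has_derivative_eq_rhs[OF has_derivative_mult[OF 1 2]]) (simp add: fun_eq_iff algebra_simps)
      qed
      moreover have "?F s = 0" "?F (- s) = 0"
        using ins[of s] ins[of "- s"] s0 by (auto simp: weighted_ext_def)
      ultimately have "((\<lambda>t. ?D (?l t)) has_integral 0) {- s..s}" by (simp only: diff_self)
      then show ?thesis
      proof (rule has_integral_on_superset)
        show "?D (?l t) = 0" if "t \<notin> {- s..s}" for t
        proof (rule out)
          show "?l t \<notin> \<Omega>" unfolding ins using that by auto
        qed
      qed simp
    qed
    then show "(LINT t|lborel. ?D (?l t)) = 0"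
      using has_integral_integral_lborel[OF int] has_integral_unique by blast
  qed
  then show ?thesis using i1 i2 by simp
qed

lemma kernel_second_diff:
  assumes e: "e \<noteq> 0"
  shows "(LINT y|lborel. weighted_ext \<alpha> p y * kern_hess \<alpha> e i j (x - y)) =
    1/2 * (LINT z|lborel. second_diff (weighted_ext \<alpha> p) x z * kern_hess \<alpha> e i j z)"
proof -
  let ?u = "weighted_ext \<alpha> p" and ?k = "kern_hess \<alpha> e i j"
  obtain C where C: "C \<ge> 0" "\<And>x. \<bar>?u x\<bar> \<le> C"
    using weighted_ext_bounded[OF \<alpha> p] by blast
  have [measurable]: "?u \<in> borel_measurable borel" by (rule weighted_ext_borel[OF \<alpha> p])
  have k: "integrable lborel ?k" by (rule kern_hess_integrable[OF \<alpha> e])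
  have mu: "(\<lambda>y. ?u y * ?k (x - y)) \<in> borel_measurable borel" by measurable
  have ip: "integrable lborel (\<lambda>z. ?u (x + z) * ?k z)"
    by (rule bounded_times_integrable[OF C(2) _ k]) measurable
  have im: "integrable lborel (\<lambda>z. ?u (x - z) * ?k z)"
    by (rule bounded_times_integrable[OF C(2) _ k]) measurable
  have e1: "(LINT y|lborel. ?u y * ?k (x - y)) = (LINT z|lborel. ?u (x - z) * ?k z)"
    using integral_lborel_reflect[OF mu, of x] by simp
  have e2: "(LINT y|lborel. ?u y * ?k (x - y)) = (LINT z|lborel. ?u (x + z) * ?k z)"
    using integral_lborel_translate[OF mu, of x] by (simp add: kern_hess_uminus)
  have "(LINT z|lborel. second_diff ?u x z * ?k z) =
      (LINT z|lborel. (?u (x + z) * ?k z + ?u (x - z) * ?k z) - 2 * ?u x * ?k z)"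
    by (simp add: second_diff_def algebra_simps)
  also have "\<dots> = 2 * (LINT y|lborel. ?u y * ?k (x - y))"
    using ip im k e1 e2 kern_hess_integral_zero[OF \<alpha> e, of i j] by (subst Bochner_Integration.integral_diff) auto
  finally show ?thesis by simp
qed

text \<open>The theorem on limits of functions with uniformly convergent derivatives. Uniformity
  needs a whole neighbourhood of \<open>x0\<close> served by one majorant of the second differences;
  the error between smoothed and singular Hessian integrals is then bounded by a number depending on
  n alone.\<close>

lemma riesz_partial_has_derivative:
  assumes x0: "x0 \<in> \<Omega>"
  shows "((\<lambda>x. LINT y|lborel. weighted_partial \<alpha> q i y * norm (x - y) powr (- \<alpha>)) has_derivative
    (\<lambda>h. \<Sum>j\<in>UNIV. h $ j * (1/2 * (LINT z|lborel. second_diff (weighted_ext \<alpha> p) x0 z * kern_hess \<alpha> 0 i j z)))) (at x0)"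
proof -
  let ?u = "weighted_ext \<alpha> p" and ?f = "weighted_partial \<alpha> q i"
  have [measurable]: "?u \<in> borel_measurable borel" by (rule weighted_ext_borel[OF \<alpha> p])
  define \<delta> where "\<delta> = (1 - norm x0) / 2"
  have \<delta>: "0 < \<delta>" using x0 by (simp add: \<delta>_def)
  define S where "S = ball x0 \<delta>"
  have S: "\<delta> \<le> 1 - norm x" "x \<in> \<Omega>" if "x \<in> S" for x
  proof -
    have "norm x \<le> norm x0 + norm (x0 - x)" by (metis norm_minus_commute norm_triangle_sub)
    then show "\<delta> \<le> 1 - norm x" using that by (simp add: S_def \<delta>_def dist_norm field_simps)
    then show "x \<in> \<Omega>" using \<delta> by simp
  qed
  obtain C where C: "C \<ge> 0" and bd: "\<And>x z. x \<in> \<Omega> \<Longrightarrow> \<bar>second_diff ?u x z / norm z powr (2 + \<alpha>)\<bar> \<le>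
     C * ((1 - norm x) powr (\<alpha>/2 - 2) * (indicator (ball 0 (1 - norm x)) z * norm z powr (- \<alpha>))
        + indicator (- ball 0 ((1 - norm x) / 2)) z * norm z powr (- (2 + \<alpha>/2)))"
    using second_diff_kernel_bound[OF \<alpha> p] by blast
  \<comment> \<open>The pointwise bound with 1 - |x| replaced by its worst values on
    \<open>S\<close>: by \<delta> in the negative power and in the exterior region, and by 1 in the
    inner ball.\<close>
  define \<Phi> where "\<Phi> z = C * (\<delta> powr (\<alpha>/2 - 2) * (indicator (ball 0 1) z * norm z powr (- \<alpha>))
        + indicator (- ball 0 (\<delta> / 2)) z * norm z powr (- (2 + \<alpha>/2)))" for z :: "real^2"
  have \<Phi>: "integrable lborel \<Phi>"
    using has_bochner_integral_ball_norm_powr[of \<alpha> 1] has_bochner_integral_outside_norm_powr[of "2 + \<alpha>/2" "\<delta>/2"] \<alpha> \<delta>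
    unfolding \<Phi>_def has_bochner_integral_iff
    by (intro Bochner_Integration.integrable_add integrable_mult_right) auto
  have [measurable]: "\<Phi> \<in> borel_measurable borel" using \<Phi> by auto
  have \<Phi>n: "0 \<le> \<Phi> z" for z unfolding \<Phi>_def using C by simp
  have sd: "\<bar>second_diff ?u x z\<bar> \<le> \<Phi> z * norm z powr (2 + \<alpha>)" if x: "x \<in> S" for x z
  proof (cases "z = 0")
    case True then show ?thesis by (simp add: second_diff_def)
  next
    case False
    have "(1 - norm x) powr (\<alpha>/2 - 2) \<le> \<delta> powr (\<alpha>/2 - 2)" using S[OF x] \<delta> \<alpha> by (intro powr_mono2') auto
    moreover have "indicator (ball 0 (1 - norm x)) z \<le> (indicator (ball 0 1) z :: real)"
      using norm_ge_zero[of x] by (simp add: indicator_def del: norm_ge_zero)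
    moreover have "indicator (- ball 0 ((1 - norm x) / 2)) z \<le> (indicator (- ball 0 (\<delta> / 2)) z :: real)"
      using S[OF x] by (auto simp: indicator_def)
    ultimately have "\<bar>second_diff ?u x z / norm z powr (2 + \<alpha>)\<bar> \<le> \<Phi> z"
      unfolding \<Phi>_def using C
      by (intro order.trans[OF bd[OF S(2)[OF x]]] mult_left_mono add_mono mult_mono mult_right_mono) auto
    then show ?thesis using False by (simp add: abs_divide field_simps)
  qed
  define e where "e n = inverse (real (Suc n))" for n
  have e: "e n \<noteq> 0" for n by (simp add: e_def)
  have elim: "e \<longlonglongrightarrow> 0" unfolding e_def by (rule LIMSEQ_inverse_real_of_nat)
  \<comment> \<open>Twice the largest possible error of the Hessian integral over all x in
    \<open>S\<close>. Since |z|^(2+\<alpha>) times the Hessian difference is bounded uniformly in n,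
    dominated convergence sends it to 0.\<close>
  define E where "E n j = (LINT z|lborel. \<Phi> z * (norm z powr (2 + \<alpha>) * \<bar>kern_hess \<alpha> (e n) i j z - kern_hess \<alpha> 0 i j z\<bar>))" for n j
  let ?B = "2 * (\<alpha> * (\<alpha> + 3))"
  have diffb: "norm z powr (2 + \<alpha>) * \<bar>kern_hess \<alpha> (e n) i j z - kern_hess \<alpha> 0 i j z\<bar> \<le> ?B" for n j z
  proof -
    have "norm z powr (2 + \<alpha>) * \<bar>kern_hess \<alpha> (e n) i j z - kern_hess \<alpha> 0 i j z\<bar> \<le>
      norm z powr (2 + \<alpha>) * (\<bar>kern_hess \<alpha> (e n) i j z\<bar> + \<bar>kern_hess \<alpha> 0 i j z\<bar>)"
      by (intro mult_left_mono) auto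
    then show ?thesis
      using kern_hess_scaled_le[OF \<alpha>, of z "e n" i j] kern_hess_scaled_le[OF \<alpha>, of z 0 i j]
      by (simp add: distrib_left)
  qed
  have Eint: "integrable lborel (\<lambda>z. \<Phi> z * (norm z powr (2 + \<alpha>) * \<bar>kern_hess \<alpha> (e n) i j z - kern_hess \<alpha> 0 i j z\<bar>))" for n j
    using bounded_times_integrable[of "\<lambda>z. norm z powr (2 + \<alpha>) * \<bar>kern_hess \<alpha> (e n) i j z - kern_hess \<alpha> 0 i j z\<bar>" ?B \<Phi>]
      diffb \<Phi> by (simp add: mult.commute abs_mult)
  have Elim: "(\<lambda>n. E n j) \<longlonglongrightarrow> 0" for j
  proof -
    have "(\<lambda>n. E n j) \<longlonglongrightarrow> (LINT z|(lborel :: (real^2) measure). 0 :: real)"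
      unfolding E_def
    proof (rule integral_dominated_convergence[where w="\<lambda>z. \<Phi> z * ?B"])
      show "integrable lborel (\<lambda>z. \<Phi> z * ?B)" using \<Phi> by simp
      show "AE z in lborel. norm (\<Phi> z * (norm z powr (2 + \<alpha>) * \<bar>kern_hess \<alpha> (e n) i j z - kern_hess \<alpha> 0 i j z\<bar>)) \<le> \<Phi> z * ?B" for n
        using diffb \<Phi>n by (intro AE_I2) (simp add: abs_mult mult_left_mono)
      show "AE z in lborel. (\<lambda>n. \<Phi> z * (norm z powr (2 + \<alpha>) * \<bar>kern_hess \<alpha> (e n) i j z - kern_hess \<alpha> 0 i j z\<bar>)) \<longlonglongrightarrow> 0"
      proof (rule AE_I2)
        fix z :: "real^2"
        show "(\<lambda>n. \<Phi> z * (norm z powr (2 + \<alpha>) * \<bar>kern_hess \<alpha> (e n) i j z - kern_hess \<alpha> 0 i j z\<bar>)) \<longlonglongrightarrow> 0"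
        proof (cases "z = 0")
          case False
          have "(\<lambda>n. (norm z)\<^sup>2 + (e n)\<^sup>2) \<longlonglongrightarrow> (norm z)\<^sup>2 + 0\<^sup>2"
            using elim by (intro tendsto_intros)
          then have pw: "(\<lambda>n. ((norm z)\<^sup>2 + (e n)\<^sup>2) powr c) \<longlonglongrightarrow> ((norm z)\<^sup>2 + 0\<^sup>2) powr c" for c
            using False by (intro tendsto_powr tendsto_const) auto
          have "(\<lambda>n. if i = j then \<alpha> * ((norm z)\<^sup>2 + (e n)\<^sup>2) powr (- \<alpha>/2 - 1) else 0) \<longlonglongrightarrow>
              (if i = j then \<alpha> * ((norm z)\<^sup>2 + 0\<^sup>2) powr (- \<alpha>/2 - 1) else 0)"
            using tendsto_mult_left[OF pw] by (cases "i = j") auto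
          then have "(\<lambda>n. kern_hess \<alpha> (e n) i j z) \<longlonglongrightarrow> kern_hess \<alpha> 0 i j z"
            unfolding kern_hess_def by (rule tendsto_diff[OF tendsto_mult_left[OF pw]])
          then have "(\<lambda>n. \<bar>kern_hess \<alpha> (e n) i j z - kern_hess \<alpha> 0 i j z\<bar>) \<longlonglongrightarrow> 0"
            by (intro tendsto_rabs_zero) (simp add: LIM_zero)
          then show ?thesis by (intro tendsto_mult_right_zero)
        qed simp
      qed
    qed measurable
    then show ?thesis by simp
  qed
  have sdint: "integrable lborel (\<lambda>z. second_diff ?u x z * kern_hess \<alpha> a i j z)" if x: "x \<in> S" for x a j
  proof (rule Bochner_Integration.integrable_bound)
    show "integrable lborel (\<lambda>z. \<Phi> z * (\<alpha> * (\<alpha> + 3)))" using \<Phi> by simp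
    have "\<bar>second_diff ?u x z * kern_hess \<alpha> a i j z\<bar> \<le> \<Phi> z * (\<alpha> * (\<alpha> + 3))" for z
    proof -
      have "\<bar>second_diff ?u x z\<bar> * \<bar>kern_hess \<alpha> a i j z\<bar> \<le> (\<Phi> z * norm z powr (2 + \<alpha>)) * \<bar>kern_hess \<alpha> a i j z\<bar>"
        by (intro mult_right_mono sd x) auto
      also have "\<dots> = \<Phi> z * (norm z powr (2 + \<alpha>) * \<bar>kern_hess \<alpha> a i j z\<bar>)" by simp
      also have "\<dots> \<le> \<Phi> z * (\<alpha> * (\<alpha> + 3))" by (intro mult_left_mono kern_hess_scaled_le[OF \<alpha>] \<Phi>n)
      finally show ?thesis by (simp add: abs_mult)
    qed
    then show "AE z in lborel. norm (second_diff ?u x z * kern_hess \<alpha> a i j z) \<le> norm (\<Phi> z * (\<alpha> * (\<alpha> + 3)))"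
      by (intro AE_I2) (auto intro!: order.trans[OF _ abs_ge_self])
  qed (unfold second_diff_def, measurable)
  let ?H = "\<lambda>a j x. 1/2 * (LINT z|lborel. second_diff ?u x z * kern_hess \<alpha> a i j z)"
  have Hdiff: "\<bar>?H (e n) j x - ?H 0 j x\<bar> \<le> 1/2 * E n j" if x: "x \<in> S" for n j x
  proof -
    let ?D = "\<lambda>z. second_diff ?u x z * kern_hess \<alpha> (e n) i j z - second_diff ?u x z * kern_hess \<alpha> 0 i j z"
    have "?H (e n) j x - ?H 0 j x = 1/2 * (LINT z|lborel. ?D z)"
      by (simp only: Bochner_Integration.integral_diff[OF sdint[OF x] sdint[OF x]] right_diff_distrib)
    then have "\<bar>?H (e n) j x - ?H 0 j x\<bar> = 1/2 * \<bar>LINT z|lborel. ?D z\<bar>"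
      by (simp only: abs_mult)
    also have "\<dots> \<le> 1/2 * (LINT z|lborel. \<bar>?D z\<bar>)"
      by (intro mult_left_mono integral_abs_bound) simp
    also have "\<dots> \<le> 1/2 * E n j"
      unfolding E_def
    proof (intro mult_left_mono integral_mono Eint integrable_abs Bochner_Integration.integrable_diff sdint x)
      fix z
      have "\<bar>second_diff ?u x z\<bar> * \<bar>kern_hess \<alpha> (e n) i j z - kern_hess \<alpha> 0 i j z\<bar> \<le>
         (\<Phi> z * norm z powr (2 + \<alpha>)) * \<bar>kern_hess \<alpha> (e n) i j z - kern_hess \<alpha> 0 i j z\<bar>"
        by (intro mult_right_mono sd x) auto
      then show "\<bar>second_diff ?u x z * kern_hess \<alpha> (e n) i j z - second_diff ?u x z * kern_hess \<alpha> 0 i j z\<bar> \<le>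
        \<Phi> z * (norm z powr (2 + \<alpha>) * \<bar>kern_hess \<alpha> (e n) i j z - kern_hess \<alpha> 0 i j z\<bar>)"
        by (simp add: abs_mult mult.assoc flip: right_diff_distrib)
    qed simp
    finally show ?thesis .
  qed
  let ?F = "\<lambda>x. LINT y|lborel. ?f y * norm (x - y) powr (- \<alpha>)"
  let ?Fe = "\<lambda>n x. LINT y|lborel. ?f y * kern \<alpha> (e n) (x - y)"
  have Fe_der: "(?Fe n has_derivative (\<lambda>h. \<Sum>j\<in>UNIV. h $ j * ?H (e n) j x)) (at x within S)" for n x
    using convolution_has_derivative[where x=x, OF weighted_partial_integrable[of i] kern_has_derivative[OF e] kern_bounded(1)[OF \<alpha> e] kern_bounded(2)[OF \<alpha> e]
        kern_measurable(1) kern_measurable(2)]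
    unfolding kernel_integration_by_parts[OF e] kernel_second_diff[OF e]
    by (rule has_derivative_at_withinI)
  have Fe_lim: "(\<lambda>n. ?Fe n x) \<longlonglongrightarrow> ?F x" if x: "x \<in> \<Omega>" for x
  proof (rule integral_dominated_convergence[where w="\<lambda>y. \<bar>?f y * norm (x - y) powr (- \<alpha>)\<bar>"])
    show "integrable lborel (\<lambda>y. \<bar>?f y * norm (x - y) powr (- \<alpha>)\<bar>)"
      by (intro integrable_abs weighted_partial_riesz_integrable x)
    \<comment> \<open>The point y = x must be removed: there |x - y| \<open>powr\<close> (-\<alpha>)
      is 0 by convention while the smoothed kernels tend to infinity, so neither convergence nor
      domination need hold.\<close>
    have ae: "AE y in lborel. y \<noteq> x" by (rule AE_lborel_singleton)
    have n2: "((norm z)\<^sup>2) powr (- \<alpha>/2) = norm z powr (- \<alpha>)" for z :: "real^2" unfolding powr_norm_sq by simp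
    show "AE y in lborel. (\<lambda>n. ?f y * kern \<alpha> (e n) (x - y)) \<longlonglongrightarrow> ?f y * norm (x - y) powr (- \<alpha>)"
      using ae
    proof eventually_elim
      case (elim y)
      have "(\<lambda>n. kern \<alpha> (e n) (x - y)) \<longlonglongrightarrow> ((norm (x - y))\<^sup>2 + 0\<^sup>2) powr (- \<alpha>/2)"
        unfolding kern_def using elim elim \<open>e \<longlonglongrightarrow> 0\<close> by (intro tendsto_intros) auto
      then show ?case using n2 by (intro tendsto_mult_left) simp
    qed
    show "AE y in lborel. norm (?f y * kern \<alpha> (e n) (x - y)) \<le> \<bar>?f y * norm (x - y) powr (- \<alpha>)\<bar>" for n
      using ae
    proof eventually_elim
      case (elim y)
      have "kern \<alpha> (e n) (x - y) \<le> ((norm (x - y))\<^sup>2) powr (- \<alpha>/2)"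
        unfolding kern_def using elim \<alpha> by (intro powr_mono2') auto
      then show ?case unfolding n2 by (simp add: abs_mult kern_def mult_left_mono)
    qed
  qed measurable
  have "\<exists>g. \<forall>x\<in>S. (\<lambda>n. ?Fe n x) \<longlonglongrightarrow> g x \<and> (g has_derivative (\<lambda>h. \<Sum>j\<in>UNIV. h $ j * ?H 0 j x)) (at x within S)"
  proof (rule has_derivative_sequence[where f'="\<lambda>n x h. \<Sum>j\<in>UNIV. h $ j * ?H (e n) j x"])
    show "convex S" by (simp add: S_def)
    show "x0 \<in> S" using \<delta> by (simp add: S_def)
    show "(\<lambda>n. ?Fe n x0) \<longlonglongrightarrow> ?F x0" by (rule Fe_lim[OF x0])
    fix r :: real assume r: "0 < r"
    have "\<forall>\<^sub>F n in sequentially. E n 1 < r \<and> E n 2 < r"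
      using order_tendstoD(2)[OF Elim r, of 1] order_tendstoD(2)[OF Elim r, of 2] by eventually_elim simp
    then show "\<forall>\<^sub>F n in sequentially. \<forall>x\<in>S. \<forall>h. norm ((\<Sum>j\<in>UNIV. h $ j * ?H (e n) j x) - (\<Sum>j\<in>UNIV. h $ j * ?H 0 j x)) \<le> r * norm h"
    proof eventually_elim
      case (elim n)
      show ?case
      proof (intro ballI allI)
        fix x h assume x: "x \<in> S"
        have t: "\<bar>h $ j * (?H (e n) j x - ?H 0 j x)\<bar> \<le> norm h * (1/2 * r)" for j
          unfolding abs_mult[of "h $ j"]
        proof (rule mult_mono)
          have "E n j \<le> r" using elim exhaust_2[of j] by auto
          then show "\<bar>?H (e n) j x - ?H 0 j x\<bar> \<le> 1/2 * r" using Hdiff[OF x, of n j] by linarith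
        qed (auto simp: component_le_norm_cart)
        have "norm ((\<Sum>j\<in>UNIV. h $ j * ?H (e n) j x) - (\<Sum>j\<in>UNIV. h $ j * ?H 0 j x))
          = \<bar>h $ 1 * (?H (e n) 1 x - ?H 0 1 x) + h $ 2 * (?H (e n) 2 x - ?H 0 2 x)\<bar>"
          by (simp add: sum_2 algebra_simps)
        also have "\<dots> \<le> norm h * (1/2 * r) + norm h * (1/2 * r)" using t[of 1] t[of 2] by linarith
        also have "\<dots> = r * norm h" by simp
        finally show "norm ((\<Sum>j\<in>UNIV. h $ j * ?H (e n) j x) - (\<Sum>j\<in>UNIV. h $ j * ?H 0 j x)) \<le> r * norm h" .
      qed
    qed
  qed (rule Fe_der)
  then obtain g where g: "\<And>x. x \<in> S \<Longrightarrow> (\<lambda>n. ?Fe n x) \<longlonglongrightarrow> g x"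
    and gd: "\<And>x. x \<in> S \<Longrightarrow> (g has_derivative (\<lambda>h. \<Sum>j\<in>UNIV. h $ j * ?H 0 j x)) (at x within S)" by blast
  have x0S: "x0 \<in> S" and oS: "open S" using \<delta> by (auto simp: S_def)
  have "(g has_derivative (\<lambda>h. \<Sum>j\<in>UNIV. h $ j * ?H 0 j x0)) (at x0)"
    using gd[OF x0S] at_within_open[OF x0S oS] by simp
  \<comment> \<open>The theorem yields some limit function \<open>g\<close>; uniqueness of limits
    identifies it with the potential throughout \<open>S\<close>.\<close>
  then show ?thesis
    by (rule has_derivative_transform_within_open[OF _ oS x0S])
      (use g Fe_lim S(2) LIMSEQ_unique in blast)
qed

lemma grad_weighted_ext:
  assumes "x \<in> \<Omega>" shows "grad (weighted_ext \<alpha> p) x $ i = weighted_partial \<alpha> q i x"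
  unfolding grad_def using frechet_derivative_at[OF d[OF assms], symmetric] assms exhaust_2[of i]
  by (auto simp: weighted_partial_def axis_def sum_2)

lemma flux_weighted_ext:
  "flux (k *\<^sub>R mat 1) (weighted_ext \<alpha> p) x $ i = k * weighted_partial \<alpha> q i x"
proof (cases "x \<in> \<Omega>")
  case True
  then show ?thesis
    using grad_weighted_ext[OF True, of 1] grad_weighted_ext[OF True, of 2] exhaust_2[of i]
    by (auto simp: flux_def matrix_vector_mult_def mat_def sum_2)
qed (simp add: flux_def weighted_partial_def)

text \<open>The kernel argument y is written as x - (x - y) so that the integrand becomes a function
  of x - y, the shape to which the reflection lemmas apply.\<close>

lemma riesz_integrand_flux:
  "riesz_integrand \<alpha> (\<lambda>y. flux (k *\<^sub>R mat 1) (weighted_ext \<alpha> p) y $ i) x =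
    (\<lambda>y. k * (weighted_partial \<alpha> q i (x - y) * norm (x - (x - y)) powr (- \<alpha>)))"
  by (auto simp: riesz_integrand_def flux_weighted_ext powr_minus_divide)

lemma riesz_field_defined_flux:
  assumes "x \<in> \<Omega>"
  shows "riesz_field_defined \<alpha> (flux (k *\<^sub>R mat 1) (weighted_ext \<alpha> p)) x"
  unfolding riesz_field_defined_def riesz_integrand_flux
proof
  fix i
  have "integrable lborel (\<lambda>y. k * (weighted_partial \<alpha> q i (x - y) * norm (x - (x - y)) powr (- \<alpha>)))"
    by (intro integrable_mult_right integrable_lborel_reflect[OF weighted_partial_riesz_integrable[OF assms]])
  then show "integrable lebesgue (\<lambda>y. k * (weighted_partial \<alpha> q i (x - y) * norm (x - (x - y)) powr (- \<alpha>)))"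
    by (subst integrable_completion) auto
qed

lemma riesz_field_flux:
  "riesz_field \<alpha> (flux (k *\<^sub>R mat 1) (weighted_ext \<alpha> p)) x $ i =
    k / gamma2 (2 - \<alpha>) * (LINT y|lborel. weighted_partial \<alpha> q i y * norm (x - y) powr (- \<alpha>))"
proof -
  have "(LINT y|lebesgue. k * (weighted_partial \<alpha> q i (x - y) * norm (x - (x - y)) powr (- \<alpha>))) =
    (LINT y|lborel. k * (weighted_partial \<alpha> q i (x - y) * norm (x - (x - y)) powr (- \<alpha>)))"
    by (intro integral_completion) measurable
  also have "\<dots> = k * (LINT y|lborel. weighted_partial \<alpha> q i y * norm (x - y) powr (- \<alpha>))"
    by (subst integral_mult_right_zero, subst integral_lborel_reflect) auto
  finally show ?thesis
    by (simp add: riesz_field_def riesz_potential_def riesz_integrand_flux)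
qed

lemma riesz_field_flux_has_derivative:
  assumes x: "x \<in> \<Omega>"
  shows "(riesz_field \<alpha> (flux (k *\<^sub>R mat 1) (weighted_ext \<alpha> p)) has_derivative
    (\<lambda>h. \<chi> i. k / gamma2 (2 - \<alpha>) * (\<Sum>j\<in>UNIV. h $ j * 
       (1/2 * (LINT z|lborel. second_diff (weighted_ext \<alpha> p) x z * kern_hess \<alpha> 0 i j z))))) (at x)"
  unfolding has_derivative_componentwise_within[of "riesz_field _ _"]
proof
  fix b :: "real^2" assume "b \<in> Basis"
  then obtain i where b: "b = axis i 1" by (auto simp: Basis_vec_def)
  show "((\<lambda>x. riesz_field \<alpha> (flux (k *\<^sub>R mat 1) (weighted_ext \<alpha> p)) x \<bullet> b) has_derivative
    (\<lambda>h. (\<chi> i. k / gamma2 (2 - \<alpha>) * (\<Sum>j\<in>UNIV. h $ j *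
       (1/2 * (LINT z|lborel. second_diff (weighted_ext \<alpha> p) x z * kern_hess \<alpha> 0 i j z)))) \<bullet> b)) (at x)"
    unfolding b inner_axis riesz_field_flux
    using has_derivative_mult_right[OF riesz_partial_has_derivative[OF x], of "k / gamma2 (2 - \<alpha>)" i]
    by simp
qed

lemma second_diff_hess_integrable:
  assumes x: "x \<in> \<Omega>"
  shows "integrable lborel (\<lambda>z. second_diff (weighted_ext \<alpha> p) x z * kern_hess \<alpha> 0 i j z)"
proof (rule Bochner_Integration.integrable_bound)
  let ?f = "\<lambda>z. second_diff (weighted_ext \<alpha> p) x z / norm z powr (2 + \<alpha>)"
  have [measurable]: "weighted_ext \<alpha> p \<in> borel_measurable borel" by (rule weighted_ext_borel[OF \<alpha> p])
  show "(\<lambda>z. second_diff (weighted_ext \<alpha> p) x z * kern_hess \<alpha> 0 i j z) \<in> borel_measurable lborel"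
    unfolding second_diff_def by measurable
  show "integrable lborel (\<lambda>z. (\<alpha> * (\<alpha> + 3)) * ?f z)"
    using second_diff_kernel_integrable[OF \<alpha> p] x by (intro integrable_mult_right) blast
  have "\<bar>second_diff (weighted_ext \<alpha> p) x z * kern_hess \<alpha> 0 i j z\<bar> \<le> \<bar>(\<alpha> * (\<alpha> + 3)) * ?f z\<bar>" for z
  proof (cases "z = 0")
    case False
    have "\<bar>second_diff (weighted_ext \<alpha> p) x z * kern_hess \<alpha> 0 i j z\<bar> =
        \<bar>?f z\<bar> * (norm z powr (2 + \<alpha>) * \<bar>kern_hess \<alpha> 0 i j z\<bar>)"
      using False by (simp add: abs_mult abs_divide)
    also have "\<dots> \<le> \<bar>?f z\<bar> * (\<alpha> * (\<alpha> + 3))" by (intro mult_left_mono kern_hess_scaled_le[OF \<alpha>]) auto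
    also have "\<dots> = \<bar>(\<alpha> * (\<alpha> + 3)) * ?f z\<bar>" using \<alpha> by (simp add: abs_mult)
    finally show ?thesis .
  qed (simp add: second_diff_def)
  then show "AE z in lborel. norm (second_diff (weighted_ext \<alpha> p) x z * kern_hess \<alpha> 0 i j z) \<le> norm ((\<alpha> * (\<alpha> + 3)) * ?f z)"
    by (intro AE_I2) simp
qed

lemma div_riesz_grad_weighted_ext:
  assumes x: "x \<in> \<Omega>"
  shows "div_riesz_grad \<alpha> (k *\<^sub>R mat 1) (weighted_ext \<alpha> p) x = - (k * frac_laplacian \<alpha> (weighted_ext \<alpha> p) x)"
proof -
  let ?I = "\<lambda>i j. LINT z|lborel. second_diff (weighted_ext \<alpha> p) x z * kern_hess \<alpha> 0 i j z"
  have "div_riesz_grad \<alpha> (k *\<^sub>R mat 1) (weighted_ext \<alpha> p) x = k / gamma2 (2 - \<alpha>) * (1/2 * (?I 1 1 + ?I 2 2))"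
    unfolding div_riesz_grad_def divergence_def
      frechet_derivative_at[OF riesz_field_flux_has_derivative[OF x], symmetric]
    by (simp add: sum_2 axis_def algebra_simps)
  also have "?I 1 1 + ?I 2 2 = (LINT z|lborel. second_diff (weighted_ext \<alpha> p) x z * (kern_hess \<alpha> 0 1 1 z + kern_hess \<alpha> 0 2 2 z))"
    using second_diff_hess_integrable[OF x] by (simp add: distrib_left)
  also have "\<dots> = (LINT z|lborel. \<alpha>\<^sup>2 * (second_diff (weighted_ext \<alpha> p) x z / norm z powr (2 + \<alpha>)))"
    unfolding kern_hess_trace[OF \<alpha>] by (simp add: mult.commute)
  also have "\<dots> = \<alpha>\<^sup>2 * (LINT z|lborel. second_diff (weighted_ext \<alpha> p) x z / norm z powr (2 + \<alpha>))"
    by (rule integral_mult_right_zero)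
  finally show ?thesis
    unfolding frac_laplacian_weighted_ext[OF \<alpha> p x] gamma2_relation[OF \<alpha>] using \<alpha> by simp
qed

lemma div_riesz_grad_defined_weighted_ext:
  assumes "x \<in> \<Omega>"
  shows "div_riesz_grad_defined \<alpha> (k *\<^sub>R mat 1) (weighted_ext \<alpha> p) x"
  unfolding div_riesz_grad_defined_def
proof (intro conjI ballI)
  show "weighted_ext \<alpha> p differentiable (at y)" if "y \<in> \<Omega>" for y
    using d[OF that] by (rule differentiableI)
  show "riesz_field_defined \<alpha> (flux (k *\<^sub>R mat 1) (weighted_ext \<alpha> p)) y" if "y \<in> \<Omega>" for y
    using that by (rule riesz_field_defined_flux)
  show "riesz_field \<alpha> (flux (k *\<^sub>R mat 1) (weighted_ext \<alpha> p)) differentiable (at x)"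
    using riesz_field_flux_has_derivative[OF assms] by (rule differentiableI)
qed

end

section \<open>Orthogonality of the basis\<close>

text \<open>Pascal's rule. Up to sign the alternating sum is an iterated finite difference, and this
  is the recursion that peels off one difference.\<close>

lemma alternating_binomial_sum_Suc:
  fixes f :: "nat \<Rightarrow> real"
  shows "(\<Sum>i\<le>Suc n. (-1) ^ i * real (Suc n choose i) * f i) =
    (\<Sum>i\<le>n. (-1) ^ i * real (n choose i) * (f i - f (Suc i)))"
proof -
  have "(\<Sum>i\<le>Suc n. (-1) ^ i * real (Suc n choose i) * f i) =
     f 0 + (\<Sum>i\<le>n. (-1) ^ Suc i * (real (n choose i) + real (n choose Suc i)) * f (Suc i))"
    by (subst sum.atMost_Suc_shift) simp
  also have "\<dots> = f 0 + (\<Sum>i\<le>n. (-1) ^ Suc i * real (n choose Suc i) * f (Suc i)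
     - (-1) ^ i * real (n choose i) * f (Suc i))"
    by (intro arg_cong2[where f="(+)"] sum.cong refl) (simp add: algebra_simps)
  also have "\<dots> = (f 0 + (\<Sum>i\<le>n. (-1) ^ Suc i * real (n choose Suc i) * f (Suc i)))
     - (\<Sum>i\<le>n. (-1) ^ i * real (n choose i) * f (Suc i))"
    by (simp only: sum_subtractf add_diff_eq)
  also have "f 0 + (\<Sum>i\<le>n. (-1) ^ Suc i * real (n choose Suc i) * f (Suc i)) =
     (\<Sum>i\<le>Suc n. (-1) ^ i * real (n choose i) * f i)"
    by (subst sum.atMost_Suc_shift) simp
  \<comment> \<open>The top term drops out because n choose Suc n is 0.\<close>
  also have "\<dots> = (\<Sum>i\<le>n. (-1) ^ i * real (n choose i) * f i)" by simp
  finally show ?thesis by (simp add: right_diff_distrib sum_subtractf)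
qed

lemma pochhammer_difference: "pochhammer (x + 1) (Suc k) - pochhammer x (Suc k) = real (Suc k) * pochhammer (x + 1) k"
  for x :: real
  unfolding pochhammer_rec[of x] pochhammer_Suc[of "x + 1"] by (simp add: algebra_simps)

text \<open>An n-th difference annihilates polynomials of degree below n. Rising factorials behave
  under differences as powers do under derivatives, so each difference lowers the degree by one
  within the same family.\<close>

lemma alternating_binomial_pochhammer:
  fixes x :: real
  shows "k < n \<Longrightarrow> (\<Sum>i\<le>n. (-1) ^ i * real (n choose i) * pochhammer (x + real i) k) = 0"
proof (induction n arbitrary: k x)
  case (Suc n)
  show ?case
  proof (cases k)
    case 0
    then show ?thesis by (subst alternating_binomial_sum_Suc) simp
  next
    case (Suc m)
    have "(\<Sum>i\<le>Suc n. (-1) ^ i * real (Suc n choose i) * pochhammer (x + real i) k) =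
      (\<Sum>i\<le>n. (-1) ^ i * real (n choose i) * (- real k * pochhammer (x + 1 + real i) m))"
      unfolding alternating_binomial_sum_Suc
    proof (intro sum.cong refl arg_cong2[where f="(*)"])
      fix i
      show "pochhammer (x + real i) k - pochhammer (x + real (Suc i)) k = - real k * pochhammer (x + 1 + real i) m"
        using pochhammer_difference[of "x + real i" m] Suc by (simp add: algebra_simps)
    qed
    also have "\<dots> = - real k * (\<Sum>i\<le>n. (-1) ^ i * real (n choose i) * pochhammer (x + 1 + real i) m)"
      by (simp add: sum_distrib_left mult_ac)
    also have "\<dots> = 0" using Suc Suc.prems by (simp add: Suc.IH)
    finally show ?thesis .
  qed
qed simp

lemma jacobi_shifted:
  "jacobi a b n (2 * s - 1) = (\<Sum>i\<le>n. ((real n + a) gchoose i) * ((real n + b) gchoose (n - i)) * (s - 1) ^ (n - i) * s ^ i)"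
  by (simp add: jacobi_def diff_divide_distrib)

lemma has_integral_beta_monomial:
  fixes c :: real
  assumes c: "0 < c"
  shows "((\<lambda>s. (1 - s) powr c * (s - 1) ^ j * s ^ i) has_integral
    (-1) ^ j * Beta (real i + 1) (c + real j + 1)) {0..1}"
proof -
  have "((\<lambda>t. t powr ((real i + 1) - 1) * (1 - t) powr ((c + real j + 1) - 1)) has_integral Beta (real i + 1) (c + real j + 1)) {0..1}"
    using c by (intro has_integral_Beta_real) auto
  from has_integral_mult_right[OF this, of "(-1) ^ j"]
  have "((\<lambda>t. (-1) ^ j * (t powr (real i) * (1 - t) powr (c + real j))) has_integral (-1) ^ j * Beta (real i + 1) (c + real j + 1)) {0<..<1}"
    by (simp add: has_integral_Icc_iff_Ioo)
  \<comment> \<open>The comparison is made on the open interval because at 0 the two power functions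
    differ: 0 \<open>powr\<close> 0 is 0, whereas 0 ^ 0 is 1.\<close>
  then have "((\<lambda>s. (1 - s) powr c * (s - 1) ^ j * s ^ i) has_integral (-1) ^ j * Beta (real i + 1) (c + real j + 1)) {0<..<1}"
  proof (rule has_integral_eq[rotated])
    fix t :: real assume t: "t \<in> {0<..<1}"
    have "(t - 1) ^ j = (-1) ^ j * (1 - t) ^ j" by (simp flip: power_mult_distrib)
    then show "(-1) ^ j * (t powr real i * (1 - t) powr (c + real j)) = (1 - t) powr c * (t - 1) ^ j * t ^ i"
      using t by (simp add: powr_realpow powr_add)
  qed
  then show ?thesis by (simp add: has_integral_Icc_iff_Ioo)
qed

text \<open>The factor Gamma(c + n - i + 1) cancels between the binomial coefficient and the Beta
  integral. What still depends on i is 1 / (i! (n-i)!), a binomial coefficient up to n!, and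
  (l+k+i)! / (l+i)!, a rising factorial of degree k in i: precisely the shape that a finite
  difference kills.\<close>

lemma jacobi_coefficient_beta:
  fixes c :: real
  assumes c: "0 < c" and i: "i \<le> n"
  shows "((real n + c) gchoose i) * ((real n + real l) gchoose (n - i)) * Beta (real (l + k + i) + 1) (c + real (n - i) + 1) =
    Gamma (real n + c + 1) * fact (n + l) / (fact n * Gamma (real (l + k + n) + c + 2)) *
      (real (n choose i) * pochhammer (real (l + i) + 1) k)"
proof -
  have 1: "((real n + c) gchoose i) = Gamma (real n + c + 1) / (fact i * Gamma (c + real (n - i) + 1))"
  proof -
    have "real n + c + 1 \<notin> \<int>\<^sub>\<le>\<^sub>0" using c nonpos_Ints_nonpos[of "real n + c + 1"] by auto
    then show ?thesis using i by (subst gbinomial_Gamma) (auto simp: of_nat_diff algebra_simps)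
  qed
  have 2: "((real n + real l) gchoose (n - i)) = fact (n + l) / (fact (n - i) * fact (l + i))"
  proof -
    have "((real n + real l) gchoose (n - i)) = real ((n + l) choose (n - i))"
      by (simp add: binomial_gbinomial)
    also have "\<dots> = fact (n + l) / (fact (n - i) * fact (n + l - (n - i)))"
      using i by (intro binomial_fact) auto
    also have "n + l - (n - i) = l + i" using i by simp
    finally show ?thesis .
  qed
  have 3: "Beta (real (l + k + i) + 1) (c + real (n - i) + 1) =
      fact (l + k + i) * Gamma (c + real (n - i) + 1) / Gamma (real (l + k + n) + c + 2)"
  proof -
    have "real (l + k + i) + 1 + (c + real (n - i) + 1) = real (l + k + n) + c + 2"
      using i by (simp add: of_nat_diff)
    then show ?thesis unfolding Beta_def Gamma_fact[symmetric] by (simp add: add_ac)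
  qed
  have 4: "pochhammer (real (l + i) + 1) k = fact (l + k + i) / fact (l + i)"
  proof -
    have "pochhammer (real (l + i) + 1) k = pochhammer (1 + real (l + i)) k" by (simp add: add.commute)
    moreover have "pochhammer 1 (l + i + k) = pochhammer 1 (l + i) * pochhammer (1 + real (l + i)) k"
      by (rule pochhammer_product') 
    ultimately show ?thesis by (simp add: pochhammer_fact[symmetric] add_ac)
  qed
  have 5: "real (n choose i) = fact n / (fact i * fact (n - i))" using i by (rule binomial_fact)
  have "Gamma (c + real (n - i) + 1) \<noteq> 0" using c by (intro less_imp_neq[THEN not_sym] Gamma_real_pos) (simp add: add_pos_nonneg del: of_nat_diff)
  then show ?thesis unfolding 1 2 3 4 5 by (simp add: field_simps)
qed

lemma jacobi_orthogonal_monomial: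
  fixes c :: real
  assumes c: "0 < c" and k: "k < n"
  shows "((\<lambda>s. (1 - s) powr c * s ^ (l + k) * jacobi c (real l) n (2 * s - 1)) has_integral 0) {0..1}"
proof -
  let ?w = "\<lambda>i. ((real n + c) gchoose i) * ((real n + real l) gchoose (n - i))"
  have "((\<lambda>s. \<Sum>i\<le>n. ?w i * ((1 - s) powr c * (s - 1) ^ (n - i) * s ^ (l + k + i))) has_integral
    (\<Sum>i\<le>n. ?w i * ((-1) ^ (n - i) * Beta (real (l + k + i) + 1) (c + real (n - i) + 1)))) {0..1}"
    by (intro has_integral_sum has_integral_mult_right has_integral_beta_monomial c) auto
  also have "(\<Sum>i\<le>n. ?w i * ((-1) ^ (n - i) * Beta (real (l + k + i) + 1) (c + real (n - i) + 1))) =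
    (\<Sum>i\<le>n. (-1) ^ n * (Gamma (real n + c + 1) * fact (n + l) / (fact n * Gamma (real (l + k + n) + c + 2))) *
      ((-1) ^ i * real (n choose i) * pochhammer (real l + 1 + real i) k))"
  proof (intro sum.cong refl)
    fix i assume "i \<in> {..n}"
    then have i: "i \<le> n" by simp
    have "(-1) ^ (n - i) = ((-1) ^ n * (-1) ^ i :: real)"
      using i by (metis (no_types) minus_one_power_iff even_diff_nat even_add mult_minus1_right mult_minus_left mult_1 minus_minus le_antisym linorder_not_less)
    moreover have "pochhammer (real l + 1 + real i) k = pochhammer (real (l + i) + 1) k" by (simp add: add_ac)
    ultimately show "?w i * ((-1) ^ (n - i) * Beta (real (l + k + i) + 1) (c + real (n - i) + 1)) =
       (-1) ^ n * (Gamma (real n + c + 1) * fact (n + l) / (fact n * Gamma (real (l + k + n) + c + 2))) *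
      ((-1) ^ i * real (n choose i) * pochhammer (real l + 1 + real i) k)"
      using jacobi_coefficient_beta[OF c i, of l k] by (simp add: mult_ac)
  qed
  also have "\<dots> = 0"
    unfolding sum_distrib_left[symmetric] using alternating_binomial_pochhammer[OF k, of "real l + 1"] by simp
  finally show ?thesis
  proof (rule has_integral_eq[rotated])
    fix s :: real
    show "(\<Sum>i\<le>n. ?w i * ((1 - s) powr c * (s - 1) ^ (n - i) * s ^ (l + k + i))) =
       (1 - s) powr c * s ^ (l + k) * jacobi c (real l) n (2 * s - 1)"
      unfolding jacobi_shifted sum_distrib_left by (intro sum.cong refl) (simp only: power_add mult_ac)
  qed
qed

text \<open>The explicit Jacobi sum is written in products of powers of s - 1 and s, so these are
  the test functions. Expanding one factor s - 1 reduces j by one and keeps the total degree below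
  n.\<close>

lemma jacobi_orthogonal_low_degree:
  fixes c :: real
  assumes c: "0 < c"
  shows "i + j < n \<Longrightarrow> ((\<lambda>s. (1 - s) powr c * s ^ l * jacobi c (real l) n (2 * s - 1) * ((s - 1) ^ j * s ^ i)) has_integral 0) {0..1}"
proof (induction j arbitrary: i)
  case 0
  then show ?case
    using jacobi_orthogonal_monomial[OF c, of i n l] by (simp add: power_add mult_ac)
next
  case (Suc j)
  have "((\<lambda>s. (1 - s) powr c * s ^ l * jacobi c (real l) n (2 * s - 1) * ((s - 1) ^ j * s ^ Suc i)
     - (1 - s) powr c * s ^ l * jacobi c (real l) n (2 * s - 1) * ((s - 1) ^ j * s ^ i)) has_integral 0 - 0) {0..1}"
    using Suc.prems by (intro has_integral_diff Suc.IH) auto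
  then have "((\<lambda>s. (1 - s) powr c * s ^ l * jacobi c (real l) n (2 * s - 1) * ((s - 1) ^ j * s ^ Suc i)
     - (1 - s) powr c * s ^ l * jacobi c (real l) n (2 * s - 1) * ((s - 1) ^ j * s ^ i)) has_integral 0) {0..1}"
    by (simp only: diff_self)
  then show ?case by (rule has_integral_eq[rotated]) (simp add: algebra_simps)
qed

lemma jacobi_orthogonal:
  fixes c :: real
  assumes c: "0 < c" and nm: "n \<noteq> m"
  shows "((\<lambda>s. (1 - s) powr c * s ^ l * (jacobi c (real l) n (2 * s - 1) * jacobi c (real l) m (2 * s - 1))) has_integral 0) {0..1}"
proof -
  have *: "((\<lambda>s. (1 - s) powr c * s ^ l * (jacobi c (real l) n (2 * s - 1) * jacobi c (real l) m (2 * s - 1))) has_integral 0) {0..1}"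
    if "m < n" for n m
  proof -
    let ?w = "\<lambda>i. ((real m + c) gchoose i) * ((real m + real l) gchoose (m - i))"
    have "((\<lambda>s. \<Sum>i\<le>m. ?w i * ((1 - s) powr c * s ^ l * jacobi c (real l) n (2 * s - 1) * ((s - 1) ^ (m - i) * s ^ i))) has_integral (\<Sum>i\<le>m. ?w i * 0)) {0..1}"
      using that by (intro has_integral_sum has_integral_mult_right jacobi_orthogonal_low_degree c) auto
    then have "((\<lambda>s. \<Sum>i\<le>m. ?w i * ((1 - s) powr c * s ^ l * jacobi c (real l) n (2 * s - 1) * ((s - 1) ^ (m - i) * s ^ i))) has_integral 0) {0..1}"
      by simp
    then show ?thesis
    proof (rule has_integral_eq[rotated])
      fix s :: real
      show "(\<Sum>i\<le>m. ?w i * ((1 - s) powr c * s ^ l * jacobi c (real l) n (2 * s - 1) * ((s - 1) ^ (m - i) * s ^ i)))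
        = (1 - s) powr c * s ^ l * (jacobi c (real l) n (2 * s - 1) * jacobi c (real l) m (2 * s - 1))"
        unfolding jacobi_shifted[of _ _ m] sum_distrib_left by (intro sum.cong refl) (simp only: mult_ac)
    qed
  qed
  show ?thesis
  proof (cases "m < n")
    case False
    then show ?thesis using *[of n m] nm by (simp add: mult.commute)
  qed (rule *)
qed

section \<open>Solid harmonics as complex powers, and rotations\<close>

abbreviation complex_point :: "real^2 \<Rightarrow> complex" where
  "complex_point x \<equiv> Complex (x $ 1) (x $ 2)"

lemma norm_complex_point: "cmod (complex_point x) = norm x"
  by (simp add: cmod_def norm_vec_def L2_set_def sum_2)

text \<open>De Moivre removes the discontinuous polar angle: the harmonics are the real and
  imaginary parts of a complex power, hence polynomials, and rotations act on that power by a
  unimodular factor.\<close>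

lemma solid_harmonic_eq:
  "solid_harmonic l \<mu> x = (if \<mu> = 1 then Re (complex_point x ^ l) else Im (complex_point x ^ l))"
proof -
  have "complex_point x ^ l = rcis (norm x) (polar_angle x) ^ l"
    unfolding polar_angle_def norm_complex_point[symmetric] by (simp only: rcis_cmod_Arg)
  also have "\<dots> = rcis (norm x ^ l) (real l * polar_angle x)" by (rule DeMoivre2)
  finally show ?thesis by (simp add: solid_harmonic_def)
qed

lemma real_polynomial_complex_power:
  "real_polynomial_function (\<lambda>x. Re (complex_point x ^ l)) \<and> real_polynomial_function (\<lambda>x. Im (complex_point x ^ l))"
proof (induction l)
  case 0
  show ?case by (simp add: real_polynomial_function.intros(2))
next
  case (Suc l)
  then show ?case
    by (auto intro!: real_polynomial_function_diff real_polynomial_function.intros(3,4) real_polynomial_component)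
qed

lemma real_polynomial_jacobi:
  "real_polynomial_function (\<lambda>x::real^2. jacobi a b n (2 * (norm x)\<^sup>2 - 1))"
  unfolding jacobi_shifted
  by (intro real_polynomial_function_sum real_polynomial_function.intros(2,4) real_polynomial_function_power
      real_polynomial_function_diff real_polynomial_norm_sq) auto

lemma real_polynomial_solid_harmonic: "real_polynomial_function (solid_harmonic l \<mu>)"
  unfolding solid_harmonic_eq[abs_def] using real_polynomial_complex_power[of l] by (cases "\<mu> = 1") auto

lemma real_polynomial_basis_fun: "real_polynomial_function (basis_fun \<alpha> j)"
  by (cases j) (auto simp: basis_fun_def
      intro!: real_polynomial_function.intros(4) real_polynomial_solid_harmonic real_polynomial_jacobi)

definition plane_rotation :: "real \<Rightarrow> real^2 \<Rightarrow> real^2" where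
  "plane_rotation t x = (\<chi> i. if i = 1 then cos t * x $ 1 - sin t * x $ 2 else sin t * x $ 1 + cos t * x $ 2)"

lemma complex_point_rotation: "complex_point (plane_rotation t x) = cis t * complex_point x"
  by (simp add: plane_rotation_def complex_eq_iff)

lemma norm_plane_rotation: "norm (plane_rotation t x) = norm x"
  unfolding norm_complex_point[symmetric] complex_point_rotation by (simp add: norm_mult)

lemma orthogonal_plane_rotation: "orthogonal_transformation (plane_rotation t)"
  unfolding orthogonal_transformation
proof
  show "linear (plane_rotation t)"
    by (intro linearI) (auto simp: plane_rotation_def vec_eq_iff algebra_simps)
qed (simp add: norm_plane_rotation)

text \<open>Rotations preserve Lebesgue measure, the disk and the radial weight, so the integral
  equals its own negative.\<close>

lemma weighted_ext_integral_zero_by_rotation: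
  assumes \<alpha>: "0 < \<alpha>" "\<alpha> < 2" and p: "real_polynomial_function p"
    and neg: "\<And>x. p (plane_rotation t x) = - p x"
  shows "(LINT x|lborel. weighted_ext \<alpha> p x) = 0"
proof -
  have [measurable]: "weighted_ext \<alpha> p \<in> borel_measurable borel" by (rule weighted_ext_borel[OF \<alpha> p])
  have [measurable]: "plane_rotation t \<in> borel_measurable borel"
    using orthogonal_transformation_linear[OF orthogonal_plane_rotation]
    by (intro borel_measurable_continuous_onI linear_continuous_on) (simp add: linear_linear)
  have "(LINT x|lborel. weighted_ext \<alpha> p x) = (LINT x|lborel. weighted_ext \<alpha> p (plane_rotation t x))"
    by (subst lborel_distr_orthogonal[OF orthogonal_plane_rotation, of t, symmetric]) (simp add: integral_distr)
  also have "\<dots> = - (LINT x|lborel. weighted_ext \<alpha> p x)"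
    by (simp add: weighted_ext_def weight_def norm_plane_rotation neg flip: integral_minus cong: if_cong)
      (rule Bochner_Integration.integral_cong, auto)
  finally show ?thesis by simp
qed

text \<open>The expression has angular frequency a - b, so a rotation through pi / (a - b)
  multiplies it by exp(i pi) = -1.\<close>

lemma rotation_flips_angular:
  assumes "a \<noteq> b"
  shows "complex_point (plane_rotation (pi / (real a - real b)) x) ^ a * cnj (complex_point (plane_rotation (pi / (real a - real b)) x)) ^ b
    = - (complex_point x ^ a * cnj (complex_point x) ^ b)"
proof -
  let ?t = "pi / (real a - real b)"
  have "real a * ?t - real b * ?t = (real a - real b) * ?t" by (simp only: left_diff_distrib)
  also have "\<dots> = pi" using assms by simp
  finally have "cis (real a * ?t - real b * ?t) = -1" by simp
  then have "cis ?t ^ a * cnj (cis ?t) ^ b = -1"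
    by (simp add: Complex.DeMoivre cis_cnj cis_mult)
  then have "cis ?t ^ a * cnj (cis ?t) ^ b * (complex_point x ^ a * cnj (complex_point x) ^ b)
    = - (complex_point x ^ a * cnj (complex_point x) ^ b)" by simp
  then show ?thesis
    unfolding complex_point_rotation by (simp add: power_mult_distrib mult_ac)
qed


lemma weighted_inner_eq_integral:
  assumes \<alpha>: "0 < \<alpha>" "\<alpha> < 2" and "real_polynomial_function f" "real_polynomial_function g"
  shows "weighted_inner \<alpha> f g = (LINT x|lborel. weighted_ext \<alpha> (\<lambda>x. f x * g x) x)"
proof -
  have "weighted_inner \<alpha> f g = (LINT x|lebesgue. weighted_ext \<alpha> (\<lambda>x. f x * g x) x)"
    unfolding weighted_inner_def set_lebesgue_integral_def
    by (intro Bochner_Integration.integral_cong refl) (simp add: weighted_ext_def indicator_def)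
  also have "\<dots> = (LINT x|lborel. weighted_ext \<alpha> (\<lambda>x. f x * g x) x)"
    using weighted_ext_borel[OF \<alpha> real_polynomial_function.intros(4)[OF assms(3,4)]]
    by (intro integral_completion) simp
  finally show ?thesis .
qed

lemma real_polynomial_angular:
  "real_polynomial_function (\<lambda>x. Re (complex_point x ^ a * cnj (complex_point x) ^ b))"
  "real_polynomial_function (\<lambda>x. Im (complex_point x ^ a * cnj (complex_point x) ^ b))"
  using real_polynomial_complex_power[of a] real_polynomial_complex_power[of b]
  unfolding complex_cnj_power[symmetric] times_complex.simps cnj.simps
  by (auto intro!: real_polynomial_function_diff real_polynomial_function.intros(3,4) real_polynomial_function_minus)

context
  fixes \<alpha> :: real
  assumes \<alpha>: "0 < \<alpha>" "\<alpha> < 2"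
begin

text \<open>The power of r^2 is what remains of two harmonics of equal degree l. After the
  substitution s = r^2 it becomes the weight s^l of the one-dimensional Jacobi
  orthogonality.\<close>

lemma radial_factor_orthogonal:
  assumes "n \<noteq> m"
  shows "(LINT x|lborel. weighted_ext \<alpha> (\<lambda>x. jacobi (\<alpha>/2) (real l) n (2 * (norm x)\<^sup>2 - 1) *
     jacobi (\<alpha>/2) (real l) m (2 * (norm x)\<^sup>2 - 1) * ((norm x)\<^sup>2) ^ l) x) = 0" (is "(LINT x|lborel. ?u x) = 0")
proof -
  have int: "integrable lborel ?u"
    by (intro weighted_ext_integrable[OF \<alpha>] real_polynomial_function.intros(4) real_polynomial_jacobi
        real_polynomial_function_power real_polynomial_norm_sq)
  let ?f = "\<lambda>s. (1 - s) powr (\<alpha>/2) * s ^ l * (jacobi (\<alpha>/2) (real l) n (2 * s - 1) * jacobi (\<alpha>/2) (real l) m (2 * s - 1))"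
  let ?F = "\<lambda>s. indicator {..<1} s * ?f s"
  have u: "?u x = ?F ((norm x)\<^sup>2)" for x
    using abs_square_less_1[of "norm x"] by (simp add: weighted_ext_def weight_def indicator_def)
  have jm: "(\<lambda>s. jacobi (\<alpha>/2) (real l) k (2 * s - 1)) \<in> borel_measurable borel" for k
    unfolding jacobi_shifted by measurable
  have Fm: "?F \<in> borel_measurable borel" using jm by measurable
  have hb: "has_bochner_integral lborel (\<lambda>s. pi * indicator {0..} s * ?F s) (LINT x|lborel. ?u x)"
    using int has_bochner_integral_norm_sq_iff[OF Fm, of "LINT x|lborel. ?u x"]
    unfolding has_bochner_integral_iff u[abs_def] by blast
  have 1: "((\<lambda>s. pi * indicator {0..} s * ?F s) has_integral (LINT x|lborel. ?u x)) UNIV"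
    by (rule has_integral_integral_lborel[OF integrable.intros[OF hb], unfolded has_bochner_integral_integral_eq[OF hb]])
  have "(?f has_integral 0) {0..1}" using \<alpha> assms by (intro jacobi_orthogonal) auto
  then have "((\<lambda>s. pi * (indicator {0..1} s * ?f s)) has_integral pi * 0) UNIV"
    by (intro has_integral_mult_right) (simp only: has_integral_indicator_UNIV)
  then have 2: "((\<lambda>s. pi * indicator {0..} s * ?F s) has_integral pi * 0) UNIV"
    by (rule has_integral_spike[where S="{1}", rotated 2]) (auto simp: indicator_def)
  show ?thesis using has_integral_unique[OF 1 2] by simp
qed

lemma angular_factor_orthogonal:
  assumes J: "real_polynomial_function (\<lambda>x::real^2. J ((norm x)\<^sup>2))" and ab: "a \<noteq> b"
  shows "(LINT x|lborel. weighted_ext \<alpha> (\<lambda>x. J ((norm x)\<^sup>2) * Re (complex_point x ^ a * cnj (complex_point x) ^ b)) x) = 0"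
    "(LINT x|lborel. weighted_ext \<alpha> (\<lambda>x. J ((norm x)\<^sup>2) * Im (complex_point x ^ a * cnj (complex_point x) ^ b)) x) = 0"
  by (rule weighted_ext_integral_zero_by_rotation[OF \<alpha>, where t="pi / (real a - real b)"];
      (intro real_polynomial_function.intros(4) J real_polynomial_angular)?;
      simp only: norm_plane_rotation rotation_flips_angular[OF ab] uminus_complex.simps mult_minus_right)+

lemma integral_weighted_ext_combination:
  assumes "real_polynomial_function f" "real_polynomial_function g"
  shows "(LINT x|lborel. weighted_ext \<alpha> (\<lambda>x. a * f x + b * g x) x) =
    a * (LINT x|lborel. weighted_ext \<alpha> f x) + b * (LINT x|lborel. weighted_ext \<alpha> g x)"
proof -
  have "(LINT x|lborel. weighted_ext \<alpha> (\<lambda>x. a * f x + b * g x) x) =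
     (LINT x|lborel. a * weighted_ext \<alpha> f x + b * weighted_ext \<alpha> g x)"
    by (intro Bochner_Integration.integral_cong refl) (simp add: weighted_ext_def algebra_simps)
  then show ?thesis
    using weighted_ext_integrable[OF \<alpha> assms(1)] weighted_ext_integrable[OF \<alpha> assms(2)] by simp
qed

text \<open>Product-to-sum formulas write the product of two harmonics through z^(l+l') and z^l
  times the conjugate of z^l'. Rotation kills the first unless l = l' = 0 and the second unless l =
  l'. In the remaining case the latter is the real number |z|^(2l), so sine-cosine products vanish
  and equal types reduce to the radial orthogonality.\<close>

lemma basis_fun_orthogonal:
  assumes j: "j \<in> basis_index" "j' \<in> basis_index" "j \<noteq> j'"
  shows "weighted_inner \<alpha> (basis_fun \<alpha> j) (basis_fun \<alpha> j') = 0"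
proof -
  obtain l n \<mu> where jj: "j = (l, n, \<mu>)" by (cases j)
  obtain l' n' \<mu>' where jj': "j' = (l', n', \<mu>')" by (cases j')
  have \<mu>: "\<mu> = 1 \<or> \<mu> = -1" "\<mu>' = 1 \<or> \<mu>' = -1" "(l, \<mu>) \<noteq> (0, -1)" "(l', \<mu>') \<noteq> (0, -1)"
    using j by (auto simp: jj jj' basis_index_def)
  define J where "J s = jacobi (\<alpha>/2) (real l) n (2 * s - 1) * jacobi (\<alpha>/2) (real l') n' (2 * s - 1)" for s
  have J: "real_polynomial_function (\<lambda>x::real^2. J ((norm x)\<^sup>2))"
    unfolding J_def by (intro real_polynomial_function.intros(4) real_polynomial_jacobi)
  \<comment> \<open>The factor with exponent 0 puts \<open>A\<close> into the form treated by the
    rotation argument, with frequency l + l'.\<close>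
  define A where "A x = complex_point x ^ (l + l') * cnj (complex_point x) ^ 0" for x
  define C where "C x = complex_point x ^ l * cnj (complex_point x) ^ l'" for x
  let ?I = "\<lambda>f. LINT x|lborel. weighted_ext \<alpha> (\<lambda>x. J ((norm x)\<^sup>2) * f x) x"
  have split: "weighted_inner \<alpha> (basis_fun \<alpha> j) (basis_fun \<alpha> j') = a * ?I f + b * ?I g"
    if "\<And>x. solid_harmonic l \<mu> x * solid_harmonic l' \<mu>' x = a * f x + b * g x"
      "real_polynomial_function f" "real_polynomial_function g" for a b f g
  proof -
    have "weighted_inner \<alpha> (basis_fun \<alpha> j) (basis_fun \<alpha> j') = (LINT x|lborel. weighted_ext \<alpha> (\<lambda>x. basis_fun \<alpha> j x * basis_fun \<alpha> j' x) x)"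
      by (intro weighted_inner_eq_integral \<alpha> real_polynomial_basis_fun)
    also have "(\<lambda>x. basis_fun \<alpha> j x * basis_fun \<alpha> j' x) = (\<lambda>x. a * (J ((norm x)\<^sup>2) * f x) + b * (J ((norm x)\<^sup>2) * g x))"
    proof
      fix x
      have "basis_fun \<alpha> j x * basis_fun \<alpha> j' x = J ((norm x)\<^sup>2) * (solid_harmonic l \<mu> x * solid_harmonic l' \<mu>' x)"
        by (simp add: jj jj' basis_fun_def J_def mult_ac)
      also have "\<dots> = a * (J ((norm x)\<^sup>2) * f x) + b * (J ((norm x)\<^sup>2) * g x)"
        unfolding that(1) by (simp add: algebra_simps)
      finally show "basis_fun \<alpha> j x * basis_fun \<alpha> j' x = a * (J ((norm x)\<^sup>2) * f x) + b * (J ((norm x)\<^sup>2) * g x)" .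
    qed
    finally show ?thesis
      using integral_weighted_ext_combination[OF real_polynomial_function.intros(4)[OF J that(2)] real_polynomial_function.intros(4)[OF J that(3)]]
      by simp
  qed
  have A0: "?I (\<lambda>x. Re (A x)) = 0" "?I (\<lambda>x. Im (A x)) = 0" if "l + l' \<noteq> 0"
    unfolding A_def using angular_factor_orthogonal[OF J, of "l + l'" 0] that by auto
  have C0: "?I (\<lambda>x. Re (C x)) = 0" "?I (\<lambda>x. Im (C x)) = 0" if "l \<noteq> l'"
    unfolding C_def using angular_factor_orthogonal[OF J, of l l'] that by auto
  have Cl: "C x = complex_of_real (((norm x)\<^sup>2) ^ l)" if "l = l'" for x
    unfolding C_def that[symmetric] power_mult_distrib[symmetric] complex_norm_square[symmetric] norm_complex_point by simp
  have radial: "?I (\<lambda>x. Re (C x)) = 0" if "l = l'" "n \<noteq> n'"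
    unfolding Cl[OF that(1)] J_def using radial_factor_orthogonal[OF that(2), of l] that(1) by simp
  have ReA: "real_polynomial_function (\<lambda>x. Re (A x))" "real_polynomial_function (\<lambda>x. Im (A x))"
    "real_polynomial_function (\<lambda>x. Re (C x))" "real_polynomial_function (\<lambda>x. Im (C x))"
    unfolding A_def C_def by (rule real_polynomial_angular)+
  have AC: "A x = complex_point x ^ l * complex_point x ^ l'" "C x = complex_point x ^ l * cnj (complex_point x ^ l')" for x
    by (simp_all add: A_def C_def power_add)
  show ?thesis
  proof (cases "\<mu> = \<mu>'")
    case True
    define s :: real where "s = (if \<mu> = 1 then 1/2 else -1/2)"
    have "weighted_inner \<alpha> (basis_fun \<alpha> j) (basis_fun \<alpha> j') = s * ?I (\<lambda>x. Re (A x)) + 1/2 * ?I (\<lambda>x. Re (C x))"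
      using True \<mu> by (intro split ReA) (auto simp: solid_harmonic_eq AC s_def algebra_simps simp del: complex_cnj_power)
    moreover have "?I (\<lambda>x. Re (C x)) = 0"
      using C0 radial j True by (cases "l = l'") (auto simp: jj jj')
    moreover have "?I (\<lambda>x. Re (A x)) = 0"
    proof (cases "l + l' = 0")
      case True': True
      \<comment> \<open>Both harmonics are constant here, so rotations give nothing and the radial
        orthogonality takes over.\<close>
      then have "A = C" by (simp add: A_def C_def fun_eq_iff)
      then show ?thesis using \<open>?I (\<lambda>x. Re (C x)) = 0\<close> by simp
    qed (rule A0)
    ultimately show ?thesis by simp
  next
    case False
    define s :: real where "s = (if \<mu> = 1 then -1/2 else 1/2)"
    have "weighted_inner \<alpha> (basis_fun \<alpha> j) (basis_fun \<alpha> j') = 1/2 * ?I (\<lambda>x. Im (A x)) + s * ?I (\<lambda>x. Im (C x))"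
      using False \<mu> by (intro split ReA) (auto simp: solid_harmonic_eq AC s_def algebra_simps simp del: complex_cnj_power)
    moreover have "?I (\<lambda>x. Im (C x)) = 0"
      using C0 Cl by (cases "l = l'") (auto simp: weighted_ext_def cong: if_cong)
    \<comment> \<open>With l = l' = 0 one of the two different types would be the sine of degree 0,
      which is excluded from \<open>basis_index\<close>.\<close>
    moreover have "l + l' \<noteq> 0" using False \<mu> by auto
    ultimately show ?thesis using A0 by simp
  qed
qed

end

section \<open>Term-by-term action\<close>

lemma weighted_ext_le_boundary_powr:
  assumes \<alpha>: "0 < \<alpha>" "\<alpha> < 2" and q: "real_polynomial_function q"
  shows "\<exists>C\<ge>0. \<forall>x\<in>\<Omega>. \<bar>weighted_ext \<alpha> q x\<bar> \<le> C * (1 - norm x) powr (\<alpha>/2)"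
proof -
  obtain C where C: "C \<ge> 0" "\<And>x. x \<in> cball 0 1 \<Longrightarrow> \<bar>q x\<bar> \<le> C"
    using real_polynomial_bounded[OF q] by blast
  have "\<bar>weighted_ext \<alpha> q x\<bar> \<le> (2 powr (\<alpha>/2) * C) * (1 - norm x) powr (\<alpha>/2)" if x: "x \<in> \<Omega>" for x
  proof -
    have "1 - (norm x)\<^sup>2 = (1 + norm x) * (1 - norm x)" by (simp add: algebra_simps power2_eq_square)
    also have "\<dots> \<le> 2 * (1 - norm x)" using x by (intro mult_right_mono) auto
    finally have "weight (\<alpha>/2) x \<le> (2 * (1 - norm x)) powr (\<alpha>/2)"
      unfolding weight_def using weight_base_pos[OF x] \<alpha> by (intro powr_mono2) auto
    also have "\<dots> = 2 powr (\<alpha>/2) * (1 - norm x) powr (\<alpha>/2)" by (simp only: powr_mult)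
    finally have "weight (\<alpha>/2) x * \<bar>q x\<bar> \<le> (2 powr (\<alpha>/2) * (1 - norm x) powr (\<alpha>/2)) * C"
      using C x by (intro mult_mono) auto
    then show ?thesis using x by (simp add: weighted_ext_def abs_mult weight_def mult_ac)
  qed
  then show ?thesis using C by (intro exI[of _ "2 powr (\<alpha>/2) * C"]) auto
qed

text \<open>The possible growth (1 - |x|)^(-\<alpha>/2) of the truncated operators is exactly
  compensated by the decay (1 - |x|)^(\<alpha>/2) of the weighted test function, so a constant on
  \<Omega> is a majorant for the limit \<epsilon> \<rightarrow> 0 in the truncated symmetry.\<close>

lemma frac_laplacian_symmetric:
  assumes \<alpha>: "0 < \<alpha>" "\<alpha> < 2" and p: "real_polynomial_function p" and q: "real_polynomial_function q"
  shows "(LINT x|lborel. indicator \<Omega> x * frac_laplacian \<alpha> (weighted_ext \<alpha> p) x * weighted_ext \<alpha> q x) =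
    (LINT x|lborel. indicator \<Omega> x * frac_laplacian \<alpha> (weighted_ext \<alpha> q) x * weighted_ext \<alpha> p x)"
proof -
  define e where "e n = inverse (real (Suc n))" for n
  have e: "0 < e n" for n by (simp add: e_def)
  have e_lim: "filterlim e (at_right 0) sequentially"
    using LIMSEQ_inverse_real_of_nat unfolding e_def[abs_def]
    by (auto simp: filterlim_at simp del: of_nat_Suc)
  have lim: "(\<lambda>n. LINT x|lborel. frac_truncated \<alpha> (weighted_ext \<alpha> p) x (e n) * weighted_ext \<alpha> q x) \<longlonglongrightarrow>
     (LINT x|lborel. indicator \<Omega> x * frac_laplacian \<alpha> (weighted_ext \<alpha> p) x * weighted_ext \<alpha> q x)"
    if p: "real_polynomial_function p" and q: "real_polynomial_function q" for p q
  proof -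
    obtain C where C: "C \<ge> 0" "\<And>x \<epsilon>. x \<in> \<Omega> \<Longrightarrow> 0 < \<epsilon> \<Longrightarrow> \<bar>frac_truncated \<alpha> (weighted_ext \<alpha> p) x \<epsilon>\<bar> \<le> C * (1 - norm x) powr (- (\<alpha>/2))"
      using frac_truncated_bound[OF \<alpha> p] by blast
    obtain D where D: "D \<ge> 0" "\<And>x. x \<in> \<Omega> \<Longrightarrow> \<bar>weighted_ext \<alpha> q x\<bar> \<le> D * (1 - norm x) powr (\<alpha>/2)"
      using weighted_ext_le_boundary_powr[OF \<alpha> q] by blast
    show ?thesis
    proof (rule integral_dominated_convergence[where w="\<lambda>x. (C * D) * indicator \<Omega> x"])
      show "integrable lborel (\<lambda>x::real^2. (C * D) * indicator \<Omega> x :: real)"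
        by (intro integrable_mult_right) (auto simp: emeasure_ball)
      show "(\<lambda>x. indicator \<Omega> x * frac_laplacian \<alpha> (weighted_ext \<alpha> p) x * weighted_ext \<alpha> q x) \<in> borel_measurable lborel"
        using borel_measurable_times[OF frac_laplacian_measurable[OF \<alpha> p] weighted_ext_borel[OF \<alpha> q]] by simp
      show "(\<lambda>x. frac_truncated \<alpha> (weighted_ext \<alpha> p) x (e n) * weighted_ext \<alpha> q x) \<in> borel_measurable lborel" for n
        using frac_truncated_measurable[OF \<alpha> p e] weighted_ext_borel[OF \<alpha> q] by (intro borel_measurable_times) auto
      show "AE x in lborel. (\<lambda>n. frac_truncated \<alpha> (weighted_ext \<alpha> p) x (e n) * weighted_ext \<alpha> q x) \<longlonglongrightarrow>
        indicator \<Omega> x * frac_laplacian \<alpha> (weighted_ext \<alpha> p) x * weighted_ext \<alpha> q x"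
      proof (rule AE_I2)
        fix x
        show "(\<lambda>n. frac_truncated \<alpha> (weighted_ext \<alpha> p) x (e n) * weighted_ext \<alpha> q x) \<longlonglongrightarrow>
          indicator \<Omega> x * frac_laplacian \<alpha> (weighted_ext \<alpha> p) x * weighted_ext \<alpha> q x"
        proof (cases "x \<in> \<Omega>")
          case True
          have "(\<lambda>n. frac_truncated \<alpha> (weighted_ext \<alpha> p) x (e n)) \<longlonglongrightarrow> frac_laplacian \<alpha> (weighted_ext \<alpha> p) x"
            using filterlim_compose[OF frac_truncated_tendsto[OF \<alpha> p True] e_lim]
            unfolding frac_laplacian_weighted_ext[OF \<alpha> p True] .
          then show ?thesis using True by (simp add: tendsto_mult_right)
        qed (simp add: weighted_ext_def)
      qed
      show "AE x in lborel. norm (frac_truncated \<alpha> (weighted_ext \<alpha> p) x (e n) * weighted_ext \<alpha> q x) \<le> (C * D) * indicator \<Omega> x" for n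
      proof (rule AE_I2)
        fix x
        show "norm (frac_truncated \<alpha> (weighted_ext \<alpha> p) x (e n) * weighted_ext \<alpha> q x) \<le> (C * D) * indicator \<Omega> x"
        proof (cases "x \<in> \<Omega>")
          case True
          have "\<bar>frac_truncated \<alpha> (weighted_ext \<alpha> p) x (e n)\<bar> * \<bar>weighted_ext \<alpha> q x\<bar> \<le>
            (C * (1 - norm x) powr (- (\<alpha>/2))) * (D * (1 - norm x) powr (\<alpha>/2))"
            using C D True e by (intro mult_mono) auto
          also have "\<dots> = C * D"
            using True by (simp add: powr_minus)
          finally show ?thesis using True by (simp add: abs_mult)
        qed (simp add: weighted_ext_def)
      qed
    qed
  qed
  have eq: "(LINT x|lborel. frac_truncated \<alpha> (weighted_ext \<alpha> q) x (e n) * weighted_ext \<alpha> p x) =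
    (LINT x|lborel. frac_truncated \<alpha> (weighted_ext \<alpha> p) x (e n) * weighted_ext \<alpha> q x)" for n
    unfolding frac_truncated_symmetric[OF \<alpha> p q e] by (simp only: mult.commute)
  show ?thesis
    by (rule LIMSEQ_unique[OF lim[OF p q] lim[OF q p, unfolded eq]])
qed

section \<open>The weighted space and Bessel's inequality\<close>

lemma weight_measurable [measurable]: "weight c \<in> borel_measurable borel"
  unfolding weight_def[abs_def] by measurable

lemma weight_nonneg: "0 \<le> weight c x"
  by (simp add: weight_def)

text \<open>Serves the comparison of the two operators, which are identified inside \<Omega>
  only.\<close>

lemma weighted_L2_cong:
  assumes "\<And>x. x \<in> \<Omega> \<Longrightarrow> f x = g x"
  shows "f \<in> weighted_L2 \<alpha> \<longleftrightarrow> g \<in> weighted_L2 \<alpha>"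
proof -
  have "(\<lambda>x. indicator \<Omega> x *\<^sub>R f x) = (\<lambda>x. indicator \<Omega> x *\<^sub>R g x)"
    "(\<lambda>x. indicator \<Omega> x *\<^sub>R (weight (\<alpha>/2) x * (f x)\<^sup>2)) = (\<lambda>x. indicator \<Omega> x *\<^sub>R (weight (\<alpha>/2) x * (g x)\<^sup>2))"
    using assms by (auto simp: indicator_def)
  then show ?thesis
    unfolding weighted_L2_def set_borel_measurable_def set_integrable_def by simp
qed

lemma weighted_inner_cong:
  assumes "\<And>x. x \<in> \<Omega> \<Longrightarrow> f x = f' x" "\<And>x. x \<in> \<Omega> \<Longrightarrow> g x = g' x"
  shows "weighted_inner \<alpha> f g = weighted_inner \<alpha> f' g'"
  unfolding weighted_inner_def set_lebesgue_integral_def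
  using assms by (intro Bochner_Integration.integral_cong refl) (auto simp: indicator_def)

lemma weighted_inner_integrable:
  assumes "f \<in> weighted_L2 \<alpha>" "g \<in> weighted_L2 \<alpha>"
  shows "integrable lebesgue (\<lambda>x. indicator \<Omega> x * (weight (\<alpha>/2) x * (f x * g x)))"
proof (rule Bochner_Integration.integrable_bound)
  have m[measurable]: "(\<lambda>x. indicator \<Omega> x * f x) \<in> borel_measurable lebesgue" "(\<lambda>x. indicator \<Omega> x * g x) \<in> borel_measurable lebesgue"
    using assms by (auto simp: weighted_L2_def set_borel_measurable_def)
  have [measurable]: "weight (\<alpha>/2) \<in> borel_measurable lebesgue" by (intro measurable_completion) simp
  show "integrable lebesgue (\<lambda>x. indicator \<Omega> x * (weight (\<alpha>/2) x * (f x)\<^sup>2) + indicator \<Omega> x * (weight (\<alpha>/2) x * (g x)\<^sup>2))"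
    using assms by (intro Bochner_Integration.integrable_add) (auto simp: weighted_L2_def set_integrable_def)
  have "(\<lambda>x. weight (\<alpha>/2) x * ((indicator \<Omega> x * f x) * (indicator \<Omega> x * g x))) \<in> borel_measurable lebesgue"
    by measurable
  also have "(\<lambda>x. weight (\<alpha>/2) x * ((indicator \<Omega> x * f x) * (indicator \<Omega> x * g x))) = (\<lambda>x. indicator \<Omega> x * (weight (\<alpha>/2) x * (f x * g x)))"
    by (auto simp: indicator_def)
  finally show "(\<lambda>x. indicator \<Omega> x * (weight (\<alpha>/2) x * (f x * g x))) \<in> borel_measurable lebesgue" .
  have "\<bar>indicator \<Omega> x * (weight (\<alpha>/2) x * (f x * g x))\<bar> \<le> 
     indicator \<Omega> x * (weight (\<alpha>/2) x * (f x)\<^sup>2) + indicator \<Omega> x * (weight (\<alpha>/2) x * (g x)\<^sup>2)" for x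
  proof -
    have "0 \<le> (\<bar>f x\<bar> - \<bar>g x\<bar>)\<^sup>2" by simp
    then have "2 * (\<bar>f x\<bar> * \<bar>g x\<bar>) \<le> (f x)\<^sup>2 + (g x)\<^sup>2" by (simp add: power2_diff)
    moreover have "0 \<le> \<bar>f x\<bar> * \<bar>g x\<bar>" by simp
    ultimately have "\<bar>f x * g x\<bar> \<le> (f x)\<^sup>2 + (g x)\<^sup>2" unfolding abs_mult by linarith
    then have "weight (\<alpha>/2) x * \<bar>f x * g x\<bar> \<le> weight (\<alpha>/2) x * ((f x)\<^sup>2 + (g x)\<^sup>2)"
      by (intro mult_left_mono weight_nonneg)
    then show ?thesis by (simp add: abs_mult weight_nonneg indicator_def distrib_left)
  qed
  then show "AE x in lebesgue. norm (indicator \<Omega> x * (weight (\<alpha>/2) x * (f x * g x))) \<le>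
     norm (indicator \<Omega> x * (weight (\<alpha>/2) x * (f x)\<^sup>2) + indicator \<Omega> x * (weight (\<alpha>/2) x * (g x)\<^sup>2))"
    by (intro AE_I2) (auto intro!: order.trans[OF _ abs_ge_self])
qed

lemma weighted_inner_eq_indicator: "weighted_inner \<alpha> f g = (LINT x|lebesgue. indicator \<Omega> x * (weight (\<alpha>/2) x * (f x * g x)))"
  by (simp add: weighted_inner_def set_lebesgue_integral_def)

lemma weighted_inner_self_nonneg: "0 \<le> weighted_inner \<alpha> f f"
  unfolding weighted_inner_eq_indicator by (intro integral_nonneg_AE) (auto simp: weight_nonneg)

text \<open>The squared distance of g from its orthogonal projection onto the finite family is
  nonnegative; expanding it, orthogonality leaves only the diagonal.\<close>

lemma bessel_inequality:
  assumes g: "g \<in> weighted_L2 \<alpha>" and P: "\<And>j. j \<in> F \<Longrightarrow> P j \<in> weighted_L2 \<alpha>" and F: "finite F"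
    and orth: "\<And>i j. i \<in> F \<Longrightarrow> j \<in> F \<Longrightarrow> i \<noteq> j \<Longrightarrow> weighted_inner \<alpha> (P i) (P j) = 0"
  shows "(\<Sum>j\<in>F. (weighted_inner \<alpha> g (P j))\<^sup>2 / weighted_inner \<alpha> (P j) (P j)) \<le> weighted_inner \<alpha> g g"
proof -
  define c where "c j = weighted_inner \<alpha> g (P j) / weighted_inner \<alpha> (P j) (P j)" for j
  let ?w = "\<lambda>x f g. indicator \<Omega> x * (weight (\<alpha>/2) x * (f * g :: real))"
  have "0 \<le> (LINT x|lebesgue. ?w x (g x - (\<Sum>j\<in>F. c j * P j x)) (g x - (\<Sum>j\<in>F. c j * P j x)))"
    by (intro integral_nonneg_AE) (auto simp: weight_nonneg)
  also have "\<dots> = (LINT x|lebesgue. ?w x (g x) (g x) - 2 * (\<Sum>j\<in>F. c j * ?w x (g x) (P j x)) + (\<Sum>i\<in>F. \<Sum>j\<in>F. c i * c j * ?w x (P i x) (P j x)))"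
  proof (intro Bochner_Integration.integral_cong refl)
    fix x
    let ?s = "\<Sum>j\<in>F. c j * P j x"
    have "?w x (g x - ?s) (g x - ?s) = ?w x (g x) (g x) - 2 * (?w x (g x) ?s) + ?w x ?s ?s"
      by (simp add: algebra_simps)
    also have "?w x (g x) ?s = (\<Sum>j\<in>F. c j * ?w x (g x) (P j x))"
      by (simp add: sum_distrib_left mult_ac)
    also have "?w x ?s ?s = (\<Sum>i\<in>F. \<Sum>j\<in>F. c i * c j * ?w x (P i x) (P j x))"
      by (simp add: sum_product sum_distrib_left mult_ac)
    finally show "?w x (g x - ?s) (g x - ?s) = ?w x (g x) (g x) - 2 * (\<Sum>j\<in>F. c j * ?w x (g x) (P j x)) + (\<Sum>i\<in>F. \<Sum>j\<in>F. c i * c j * ?w x (P i x) (P j x))" .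
  qed
  also have "\<dots> = weighted_inner \<alpha> g g - 2 * (\<Sum>j\<in>F. c j * weighted_inner \<alpha> g (P j)) + (\<Sum>i\<in>F. \<Sum>j\<in>F. c i * c j * weighted_inner \<alpha> (P i) (P j))"
    unfolding weighted_inner_eq_indicator using g P
    by (simp add: weighted_inner_integrable Bochner_Integration.integrable_sum Bochner_Integration.integral_sum)
  also have "(\<Sum>i\<in>F. \<Sum>j\<in>F. c i * c j * weighted_inner \<alpha> (P i) (P j)) = (\<Sum>i\<in>F. c i * weighted_inner \<alpha> g (P i))"
  proof (intro sum.cong refl)
    fix i assume i: "i \<in> F"
    have "(\<Sum>j\<in>F. c i * c j * weighted_inner \<alpha> (P i) (P j)) = (\<Sum>j\<in>F. if j = i then c i * c i * weighted_inner \<alpha> (P i) (P i) else 0)"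
      using orth i by (intro sum.cong refl) auto
    \<comment> \<open>If the norm of \<open>P i\<close> is 0, then c i = 0 by the division
      convention and both sides vanish.\<close>
    also have "\<dots> = c i * weighted_inner \<alpha> g (P i)" using i F by (simp add: c_def)
    finally show "(\<Sum>j\<in>F. c i * c j * weighted_inner \<alpha> (P i) (P j)) = c i * weighted_inner \<alpha> g (P i)" .
  qed
  finally show ?thesis by (simp add: c_def power2_eq_square)
qed

context
  fixes \<alpha> :: real
  assumes \<alpha>: "0 < \<alpha>" "\<alpha> < 2"
begin

lemma polynomial_weighted_L2:
  assumes p: "real_polynomial_function p"
  shows "p \<in> weighted_L2 \<alpha>"
proof -
  have [measurable]: "p \<in> borel_measurable borel" "\<Omega> \<in> sets borel"
    using real_polynomial_borel_measurable[OF p] by auto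
  have pm: "(\<lambda>x. indicator \<Omega> x *\<^sub>R p x) \<in> borel_measurable lebesgue"
    by (intro measurable_completion) measurable
  have "integrable lborel (weighted_ext \<alpha> (\<lambda>x. p x * p x))"
    by (intro weighted_ext_integrable[OF \<alpha>] real_polynomial_function.intros(4) p)
  then have "integrable lebesgue (weighted_ext \<alpha> (\<lambda>x. p x * p x))"
    by (subst integrable_completion) auto
  also have "weighted_ext \<alpha> (\<lambda>x. p x * p x) = (\<lambda>x. indicator \<Omega> x *\<^sub>R (weight (\<alpha>/2) x * (p x)\<^sup>2))"
    by (auto simp: weighted_ext_def indicator_def power2_eq_square)
  finally show ?thesis
    using pm by (auto simp: weighted_L2_def set_integrable_def set_borel_measurable_def)
qed

text \<open>The square of the boundary bound has exponent -\<alpha> and the weight contributes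
  \<alpha>/2; the sum -\<alpha>/2 exceeds -1 because \<alpha> < 2.\<close>

lemma frac_laplacian_weighted_L2:
  assumes p: "real_polynomial_function p"
  shows "(\<lambda>x. k * frac_laplacian \<alpha> (weighted_ext \<alpha> p) x) \<in> weighted_L2 \<alpha>"
proof -
  let ?L = "frac_laplacian \<alpha> (weighted_ext \<alpha> p)"
  obtain C where C: "C \<ge> 0" "\<And>x. x \<in> \<Omega> \<Longrightarrow> \<bar>?L x\<bar> \<le> C * (1 - norm x) powr (- (\<alpha>/2))"
    using frac_truncated_bound[OF \<alpha> p] by blast
  have m[measurable]: "(\<lambda>x. indicator \<Omega> x * ?L x) \<in> borel_measurable borel"
    by (rule frac_laplacian_measurable[OF \<alpha> p])
  have "(\<lambda>x. k * (indicator \<Omega> x * ?L x)) \<in> borel_measurable lebesgue"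
    by (intro measurable_completion) simp
  then have 1: "set_borel_measurable lebesgue \<Omega> (\<lambda>x. k * ?L x)"
    unfolding set_borel_measurable_def by (simp add: mult_ac)
  \<comment> \<open>The power of 1/2 comes from 1 - r \<ge> (1 - r^2)/2, which converts the distance
    to the circle into the base of the weight.\<close>
  let ?A = "(k * C * (1/2) powr (- (\<alpha>/2)))\<^sup>2"
  have "integrable lborel (\<lambda>x. weight (\<alpha>/2) x * (k * (indicator \<Omega> x * ?L x))\<^sup>2)"
  proof (rule Bochner_Integration.integrable_bound)
    show "integrable lborel (\<lambda>x::real^2. ?A * (indicator (ball 0 1) x * (1 - (norm x)\<^sup>2) powr (- (\<alpha>/2))))"
      using \<alpha> by (intro integrable_mult_right integrable_weight_powr) auto
    have "weight (\<alpha>/2) x * (k * (indicator \<Omega> x * ?L x))\<^sup>2 \<le> ?A * (indicator \<Omega> x * (1 - (norm x)\<^sup>2) powr (- (\<alpha>/2)))" for x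
    proof (cases "x \<in> \<Omega>")
      case True
      let ?s = "1 - (norm x)\<^sup>2"
      have s: "0 < ?s" by (rule weight_base_pos[OF True])
      have "?s = (1 + norm x) * (1 - norm x)" by (simp add: algebra_simps power2_eq_square)
      also have "\<dots> \<le> 2 * (1 - norm x)" using True by (intro mult_right_mono) auto
      finally have "(1 - norm x) powr (- (\<alpha>/2)) \<le> (1/2 * ?s) powr (- (\<alpha>/2))"
        using s \<alpha> by (intro powr_mono2') auto
      also have "\<dots> = (1/2) powr (- (\<alpha>/2)) * ?s powr (- (\<alpha>/2))" by (simp only: powr_mult)
      finally have "\<bar>?L x\<bar> \<le> C * ((1/2) powr (- (\<alpha>/2)) * ?s powr (- (\<alpha>/2)))"
        using C True by (meson mult_left_mono order_trans)
      then have "\<bar>k\<bar> * \<bar>?L x\<bar> \<le> \<bar>k\<bar> * (C * ((1/2) powr (- (\<alpha>/2)) * ?s powr (- (\<alpha>/2))))"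
        by (intro mult_left_mono) auto
      then have "(\<bar>k\<bar> * \<bar>?L x\<bar>)\<^sup>2 \<le> (\<bar>k\<bar> * (C * ((1/2) powr (- (\<alpha>/2)) * ?s powr (- (\<alpha>/2)))))\<^sup>2"
        by (intro power_mono) auto
      also have "\<dots> = ?A * (?s powr (- (\<alpha>/2)))\<^sup>2" by (simp add: power_mult_distrib)
      also have "(?s powr (- (\<alpha>/2)))\<^sup>2 = ?s powr (- \<alpha>)" using s by (simp add: power2_eq_square flip: powr_add)
      finally have "weight (\<alpha>/2) x * (k * ?L x)\<^sup>2 \<le> weight (\<alpha>/2) x * (?A * ?s powr (- \<alpha>))"
        by (intro mult_left_mono weight_nonneg) (simp add: power_mult_distrib)
      also have "\<dots> = ?A * ?s powr (- (\<alpha>/2))"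
        unfolding weight_def using s by (simp flip: powr_add)
      finally show ?thesis using True by simp
    qed simp
    then show "AE x in lborel. norm (weight (\<alpha>/2) x * (k * (indicator \<Omega> x * ?L x))\<^sup>2) \<le>
       norm (?A * (indicator \<Omega> x * (1 - (norm x)\<^sup>2) powr (- (\<alpha>/2))))"
      by (intro AE_I2) (simp add: weight_nonneg abs_mult)
  qed simp
  then have "integrable lebesgue (\<lambda>x. weight (\<alpha>/2) x * (k * (indicator \<Omega> x * ?L x))\<^sup>2)"
    by (subst integrable_completion) auto
  also have "(\<lambda>x. weight (\<alpha>/2) x * (k * (indicator \<Omega> x * ?L x))\<^sup>2) = (\<lambda>x. indicator \<Omega> x *\<^sub>R (weight (\<alpha>/2) x * (k * ?L x)\<^sup>2))"
    by (auto simp: indicator_def)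
  finally show ?thesis using 1 by (simp add: weighted_L2_def set_integrable_def)
qed

lemma weighted_inner_frac_laplacian:
  assumes p: "real_polynomial_function p" and q: "real_polynomial_function q"
  shows "weighted_inner \<alpha> (\<lambda>x. k * frac_laplacian \<alpha> (weighted_ext \<alpha> p) x) q =
    k * (LINT x|lborel. indicator \<Omega> x * frac_laplacian \<alpha> (weighted_ext \<alpha> p) x * weighted_ext \<alpha> q x)"
proof -
  let ?f = "\<lambda>x. indicator \<Omega> x * frac_laplacian \<alpha> (weighted_ext \<alpha> p) x * weighted_ext \<alpha> q x"
  have m: "?f \<in> borel_measurable borel"
    using borel_measurable_times[OF frac_laplacian_measurable[OF \<alpha> p] weighted_ext_borel[OF \<alpha> q]] by simp
  have "weighted_inner \<alpha> (\<lambda>x. k * frac_laplacian \<alpha> (weighted_ext \<alpha> p) x) q = (LINT x|lebesgue. k * ?f x)"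
    unfolding weighted_inner_eq_indicator
    by (intro Bochner_Integration.integral_cong refl) (auto simp: weighted_ext_def indicator_def)
  also have "\<dots> = k * (LINT x|lebesgue. ?f x)" by (rule integral_mult_right_zero)
  also have "(LINT x|lebesgue. ?f x) = (LINT x|lborel. ?f x)" using m by (intro integral_completion) simp
  finally show ?thesis .
qed

text \<open>By Bessel's inequality the two coefficient families are square summable up to the
  normalisation, so only orthogonality is needed here, not completeness.\<close>

lemma basis_coeff_products_summable:
  assumes g: "g \<in> weighted_L2 \<alpha>" and h: "h \<in> weighted_L2 \<alpha>"
  shows "(\<lambda>j. basis_coeff \<alpha> g j * weighted_inner \<alpha> h (basis_fun \<alpha> j)) summable_on basis_index"
proof -
  let ?N = "\<lambda>j. weighted_inner \<alpha> (basis_fun \<alpha> j) (basis_fun \<alpha> j)"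
  let ?b = "\<lambda>f j. (weighted_inner \<alpha> f (basis_fun \<alpha> j))\<^sup>2 / ?N j"
  have s: "?b f summable_on basis_index" if f: "f \<in> weighted_L2 \<alpha>" for f
  proof (rule nonneg_bdd_above_summable_on)
    show "0 \<le> ?b f j" for j by (intro divide_nonneg_nonneg weighted_inner_self_nonneg) simp
    show "bdd_above (sum (?b f) ` {F. F \<subseteq> basis_index \<and> finite F})"
    proof (rule bdd_aboveI2)
      fix F assume F: "F \<in> {F. F \<subseteq> basis_index \<and> finite F}"
      show "sum (?b f) F \<le> weighted_inner \<alpha> f f"
        by (rule bessel_inequality)
          (use F f in \<open>auto intro!: polynomial_weighted_L2 real_polynomial_basis_fun basis_fun_orthogonal[OF \<alpha>]\<close>)
    qed
  qed
  have "(\<lambda>j. ?b g j + ?b h j) summable_on basis_index" by (intro summable_on_add s g h)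
  then have "(\<lambda>j. norm (basis_coeff \<alpha> g j * weighted_inner \<alpha> h (basis_fun \<alpha> j))) summable_on basis_index"
  proof (rule Infinite_Sum.abs_summable_on_comparison_test')
    fix j
    let ?x = "weighted_inner \<alpha> g (basis_fun \<alpha> j)" and ?y = "weighted_inner \<alpha> h (basis_fun \<alpha> j)"
    have "0 \<le> (\<bar>?x\<bar> - \<bar>?y\<bar>)\<^sup>2" by simp
    then have "2 * (\<bar>?x\<bar> * \<bar>?y\<bar>) \<le> ?x\<^sup>2 + ?y\<^sup>2" by (simp add: power2_diff)
    moreover have "0 \<le> \<bar>?x\<bar> * \<bar>?y\<bar>" by simp
    ultimately have "\<bar>?x\<bar> * \<bar>?y\<bar> \<le> ?x\<^sup>2 + ?y\<^sup>2" by linarith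
    then have "(\<bar>?x\<bar> * \<bar>?y\<bar>) / ?N j \<le> (?x\<^sup>2 + ?y\<^sup>2) / ?N j"
      by (intro divide_right_mono weighted_inner_self_nonneg)
    then show "norm (basis_coeff \<alpha> g j * ?y) \<le> ?b g j + ?b h j"
      using weighted_inner_self_nonneg[of \<alpha> "basis_fun \<alpha> j"]
      by (simp add: basis_coeff_def abs_mult abs_divide add_divide_distrib)
  qed
  then show ?thesis by (rule abs_summable_summable)
qed

text \<open>Symmetry moves the operator from the j-th to the i-th basis function, so the sum over j
  becomes a pairing of two coefficient families, summable by Bessel. The sum is named explicitly, in
  terms of g, k and i but not of \<open>T\<close>, so that any two operators satisfying the
  hypothesis share the same coefficient.\<close>

lemma has_termwise_coeff_frac_laplacian:
  assumes g: "g \<in> weighted_L2 \<alpha>"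
    and T: "\<And>j x. j \<in> basis_index \<Longrightarrow> x \<in> \<Omega> \<Longrightarrow>
      T (weighted_ext \<alpha> (basis_fun \<alpha> j)) x = k * frac_laplacian \<alpha> (weighted_ext \<alpha> (basis_fun \<alpha> j)) x"
  shows "has_termwise_coeff \<alpha> T g i (infsum (\<lambda>j. basis_coeff \<alpha> g j *
     weighted_inner \<alpha> (\<lambda>x. k * frac_laplacian \<alpha> (weighted_ext \<alpha> (basis_fun \<alpha> i)) x) (basis_fun \<alpha> j)) basis_index
     / weighted_inner \<alpha> (basis_fun \<alpha> i) (basis_fun \<alpha> i))"
proof -
  let ?h = "\<lambda>j x. k * frac_laplacian \<alpha> (weighted_ext \<alpha> (basis_fun \<alpha> j)) x"
  let ?N = "weighted_inner \<alpha> (basis_fun \<alpha> i) (basis_fun \<alpha> i)"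
  have L2: "T (weighted_ext \<alpha> (basis_fun \<alpha> j)) \<in> weighted_L2 \<alpha>" if "j \<in> basis_index" for j
    using weighted_L2_cong[OF T[OF that]] frac_laplacian_weighted_L2[OF real_polynomial_basis_fun] by simp
  have co: "basis_coeff \<alpha> (T (weighted_ext \<alpha> (basis_fun \<alpha> j))) i = weighted_inner \<alpha> (?h i) (basis_fun \<alpha> j) / ?N"
    if "j \<in> basis_index" for j
  proof -
    have "weighted_inner \<alpha> (T (weighted_ext \<alpha> (basis_fun \<alpha> j))) (basis_fun \<alpha> i) = weighted_inner \<alpha> (?h j) (basis_fun \<alpha> i)"
      by (rule weighted_inner_cong[OF T[OF that] refl])
    also have "\<dots> = weighted_inner \<alpha> (?h i) (basis_fun \<alpha> j)"
      unfolding weighted_inner_frac_laplacian[OF real_polynomial_basis_fun real_polynomial_basis_fun]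
      using frac_laplacian_symmetric[OF \<alpha> real_polynomial_basis_fun real_polynomial_basis_fun] by simp
    finally show ?thesis by (simp add: basis_coeff_def)
  qed
  have "((\<lambda>j. basis_coeff \<alpha> g j * weighted_inner \<alpha> (?h i) (basis_fun \<alpha> j)) has_sum
      infsum (\<lambda>j. basis_coeff \<alpha> g j * weighted_inner \<alpha> (?h i) (basis_fun \<alpha> j)) basis_index) basis_index"
    by (intro has_sum_infsum basis_coeff_products_summable g frac_laplacian_weighted_L2 real_polynomial_basis_fun)
  from has_sum_cmult_left[OF this, of "inverse ?N"]
  have "((\<lambda>j. basis_coeff \<alpha> g j * (weighted_inner \<alpha> (?h i) (basis_fun \<alpha> j) / ?N)) has_sum
      infsum (\<lambda>j. basis_coeff \<alpha> g j * weighted_inner \<alpha> (?h i) (basis_fun \<alpha> j)) basis_index / ?N) basis_index"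
    by (simp add: divide_inverse mult.assoc)
  then have "((\<lambda>j. basis_coeff \<alpha> g j * basis_coeff \<alpha> (T (weighted_ext \<alpha> (basis_fun \<alpha> j))) i) has_sum
      infsum (\<lambda>j. basis_coeff \<alpha> g j * weighted_inner \<alpha> (?h i) (basis_fun \<alpha> j)) basis_index / ?N) basis_index"
    by (rule has_sum_cong[THEN iffD1, rotated]) (simp add: co)
  then show ?thesis using L2 by (simp add: has_termwise_coeff_def)
qed

end

theorem corollary4p1:
  fixes \<alpha> k :: real
  assumes "0 < \<alpha>" and "\<alpha> < 2"
  shows "(\<forall>j\<in>basis_index. \<forall>x\<in>\<Omega>.
            frac_laplacian_defined \<alpha> (weighted_ext \<alpha> (basis_fun \<alpha> j)) x \<and>
            div_riesz_grad_defined \<alpha> (k *\<^sub>R mat 1) (weighted_ext \<alpha> (basis_fun \<alpha> j)) x \<and>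
            k * frac_laplacian \<alpha> (weighted_ext \<alpha> (basis_fun \<alpha> j)) x =
              - div_riesz_grad \<alpha> (k *\<^sub>R mat 1) (weighted_ext \<alpha> (basis_fun \<alpha> j)) x) \<and>
         (\<forall>g\<in>weighted_L2 \<alpha>. \<forall>i\<in>basis_index. \<exists>s.
            has_termwise_coeff \<alpha> (\<lambda>u x. k * frac_laplacian \<alpha> u x) g i s \<and>
            has_termwise_coeff \<alpha> (\<lambda>u x. - div_riesz_grad \<alpha> (k *\<^sub>R mat 1) u x) g i s)"
proof -
  have div: "div_riesz_grad_defined \<alpha> (k *\<^sub>R mat 1) (weighted_ext \<alpha> (basis_fun \<alpha> j)) x \<and>
    k * frac_laplacian \<alpha> (weighted_ext \<alpha> (basis_fun \<alpha> j)) x =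
      - div_riesz_grad \<alpha> (k *\<^sub>R mat 1) (weighted_ext \<alpha> (basis_fun \<alpha> j)) x" if x: "x \<in> \<Omega>" for j x
  proof -
    have p: "real_polynomial_function (basis_fun \<alpha> j)" by (rule real_polynomial_basis_fun)
    obtain q where q: "\<And>i. real_polynomial_function (q i)"
      and d: "\<And>x. x \<in> \<Omega> \<Longrightarrow> (weighted_ext \<alpha> (basis_fun \<alpha> j) has_derivative
        (\<lambda>h. \<Sum>i\<in>UNIV. h $ i * (weight (\<alpha>/2 - 1) x * q i x))) (at x)"
      using weighted_ext_has_derivative[OF p, of \<alpha>] by blast
    show ?thesis
      using div_riesz_grad_defined_weighted_ext[OF assms p q d x] div_riesz_grad_weighted_ext[OF assms p q d x]
      by simp
  qed
  moreover have "frac_laplacian_defined \<alpha> (weighted_ext \<alpha> (basis_fun \<alpha> j)) x" if "x \<in> \<Omega>" for j x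
    by (rule frac_laplacian_defined_weighted_ext[OF assms real_polynomial_basis_fun that])
  moreover have "\<exists>s. has_termwise_coeff \<alpha> (\<lambda>u x. k * frac_laplacian \<alpha> u x) g i s \<and>
      has_termwise_coeff \<alpha> (\<lambda>u x. - div_riesz_grad \<alpha> (k *\<^sub>R mat 1) u x) g i s" if "g \<in> weighted_L2 \<alpha>" for g i
    using has_termwise_coeff_frac_laplacian[OF assms that, where i=i and k=k and T="\<lambda>u x. k * frac_laplacian \<alpha> u x"]
      has_termwise_coeff_frac_laplacian[OF assms that, where i=i and k=k and T="\<lambda>u x. - div_riesz_grad \<alpha> (k *\<^sub>R mat 1) u x"] div
    by auto
  ultimately show ?thesis by blast
qed

end
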